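(* Let $a,b\geq 0$ be integers with $a+b\le p$. Then $$\mathrm{Hom}_K\big(V(bq,aq),\mathcal{P}(V\otimes W)\big)=\mathcal{U}(\mathfrak{u}(a,b)_{\mathbb{C}})\cdot\psi_{bq,aq}.$$ Here $K=\mathrm{U}(p)\times\mathrm{U}(q)$, $\psi_{bq,aq}$ is restricted to the copy of $V(bq,aq)$ in $\wedge^{bq}\mathfrak{p}'\otimes\wedge^{aq}\mathfrak{p}''$, and $\mathcal{U}(\mathfrak{u}(a,b)_{\mathbb{C}})$ acts by post-composition.
   Context: $V=V_+\oplus V_-$ is a complex Hermitian space of signature $(p,q)$, with basis $v_1,\dots,v_p$ of $V_+$ ($(v_\alpha,v_\beta)=\delta_{\alpha\beta}$) and $v_{p+1},\dots,v_{p+q}$ of $V_-$ ($(v_\mu,v_\nu)=-\delta_{\mu\nu}$). $W=W_+\oplus W_-$ is a complex Hermitian space of signature $(a,b)$ with analogous basis $w_1,\dots,w_{a+b}$. For $v\in V$, $v^*\in V^*$ is $v^*(u)=(u,v)$. The complexification of the Lie algebra of $\mathrm{U}(V)=\mathrm{U}(p,q)$ is $\mathrm{End}(V)=V\otimes V^*=\mathfrak{k}\oplus\mathfrak{p}$ with $\mathfrak{p}=\mathfrak{p}'\oplus\mathfrak{p}''$, $\mathfrak{p}'=V_+\otimes V_-^*$, $\mathfrak{p}''=V_-\otimes V_+^*$; its dual has elements $\xi'_{\alpha,\mu}=v_\alpha^*\otimes v_\mu\in(\mathfrak{p}')^*=V_+^*\otimes V_-$ and $\xi''_{\alpha,\mu}=-v_\mu^*\otimes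 v_\alpha\in(\mathfrak{p}'')^*=V_-^*\otimes V_+$ ($1\le\alpha\le p<\mu\le p+q$), via $\langle f_1\otimes u_1,u_2\otimes f_2\rangle=f_1(u_2)f_2(u_1)$. $V(bq,aq)$ is the irreducible representation of $K=\mathrm{U}(p)\times\mathrm{U}(q)$ with highest weight $(q^{b},0^{p-a-b},(-q)^{a};(a-b)^{q})$ (exponents denote repetition); it is the Cartan product of $S_{b\times q}(V_+)\otimes(\wedge^qV_-^* )^{\otimes b}$ and $S_{a\times q}(V_+^* )\otimes(\wedge^qV_-)^{\otimes a}$, where $S_{b\times q}$ is the Schur functor of the rectangular partition $(q,\dots,q)$ ($b$ parts), and it occurs in $\wedge^{bq}\mathfrak{p}'\otimes\wedge^{aq}\mathfrak{p}''$. Fock space. For a complex vector space $U$ write $U',U''$ for the $\pm i$ eigenspaces of multiplication by $i$ on $U\otimes_{\mathbb{R}}\mathbb{C}$. The polynomial Fock space of the dual pair $\mathrm{U}(V)\times\mathrm{U}(W)$ (for the positive complex structure determined by the splittings of $V,W$) is $$\mathcal{P}(V\otimes W)=\mathrm{Pol}\big((V_+'\otimes W_+')\oplus(V_+''\otimes W_-'')\big)\otimes\mathrm{Pol}\big((V_-'\otimes W_-')\oplus(V_-''\otimes W_+'')\big),$$ with first factor $\mathcal{P}_+$ the polynomials in coordinates $z'_{\alpha,i}$ ($1\le\alpha\le p$, $1\le i\le a$) on $V_+'\otimes W_+'$ and $z''_{\alpha,j}$ ($1\le j\le b$) on $V_+''\otimes W_-''$ relative to the bases induced by $(v_\alpha),(w_i)$.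 It carries the Weil (oscillator) representation $\omega$ of the metaplectic cover of $\mathrm{Sp}((V\otimes W)_{\mathbb{R}})$, restricted to (the double covers of) $\mathrm{U}(V)\times\mathrm{U}(W)$ and twisted by $\det_{\mathrm{U}(V)}^{(a-b)/2}\otimes\det_{\mathrm{U}(W)}^{(p+q)/2}$. With this twist $K$ acts on the constants by $1\otimes\det_{\mathrm{U}(q)}^{a-b}$ and the action of $K$ is the natural geometric one on polynomials tensored with this character; $\mathfrak{u}(a,b)_{\mathbb{C}}$, the complexified Lie algebra of $\mathrm{U}(W)$, acts through $\omega$, commuting with $K$. The cocycle $\psi_{bq,aq}\in\mathrm{Hom}_K(\wedge^{bq}\mathfrak{p}'\otimes\wedge^{aq}\mathfrak{p}'',\mathcal{P}_+)$ is $$\psi_{bq,aq}=\bigwedge_{j=1}^b\ \bigwedge_{\mu=p+1}^{p+q}\Big(\sum_{\alpha=1}^pz''_{\alpha,j}\otimes\xi'_{\alpha,\mu}\Big)\ \wedge\ \bigwedge_{i=1}^a\ \bigwedge_{\mu=p+1}^{p+q}\Big(\sum_{\alpha=1}^pz'_{\alpha,i}\otimes\xi''_{\alpha,\mu}\Big)$$ in $\mathcal{P}_+\otimes\wedge^{(a+b)q}\mathfrak{p}^*$, multiplying polynomial coefficients and wedging forms. *)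

theory Defs
  imports
    "Jordan_Normal_Form.Schur_Decomposition"
    "HOL-Library.Poly_Mapping"
    "HOL-Library.FuncSet"
begin

text \<open>
  All indices are zero-based.  The basis of V is indexed by r < p + q, with V+ spanned by r < p;
  the basis of W is indexed by k < a + b, with W+ spanned by k < a.
\<close>

definition unitary_group :: "nat \<Rightarrow> complex mat set" where
  "unitary_group n = {A \<in> carrier_mat n n. A * mat_adjoint A = 1\<^sub>m n}"

definition K_group :: "nat \<Rightarrow> nat \<Rightarrow> (complex mat \<times> complex mat) set" where
  "K_group p q = unitary_group p \<times> unitary_group q"

definition block :: "complex mat \<times> complex mat \<Rightarrow> complex mat" where
  "block k = (case k of (A, B) \<Rightarrow>
     four_block_mat A (0\<^sub>m (dim_row A) (dim_col B)) (0\<^sub>m (dim_row B) (dim_col A)) B)"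

text \<open>
  The exterior algebra over a commutative ring on generators indexed by a linearly ordered set:
  the value of an element at a finite set S is the coefficient of the
  monomial obtained by wedging the generators in S in increasing order.
\<close>

type_synonym ('i, 'r) ext = "'i set \<Rightarrow> 'r"

definition ext_gen :: "'i \<Rightarrow> 'r \<Rightarrow> ('i, 'r::zero) ext" where
  "ext_gen i c = (\<lambda>S. if S = {i} then c else 0)"

definition ext_one :: "('i, 'r::zero_neq_one) ext" where
  "ext_one = (\<lambda>S. if S = {} then 1 else 0)"

definition ext_scale :: "'r \<Rightarrow> ('i, 'r) ext \<Rightarrow> ('i, 'r::times) ext" where
  "ext_scale c x = (\<lambda>S. c * x S)"

definition ext_add :: "('i, 'r) ext \<Rightarrow> ('i, 'r) ext \<Rightarrow> ('i, 'r::plus) ext" where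
  "ext_add x y = (\<lambda>S. x S + y S)"

definition ext_zero :: "('i, 'r::zero) ext" where
  "ext_zero = (\<lambda>S. 0)"

definition wedge :: "('i::linorder, 'r::comm_ring_1) ext \<Rightarrow> ('i, 'r) ext \<Rightarrow> ('i, 'r) ext" where
  "wedge x y = (\<lambda>S. \<Sum>T\<in>Pow S.
     (- 1) ^ card {(i, j). i \<in> T \<and> j \<in> S - T \<and> j < i} * x T * y (S - T))"

definition wedge_list :: "('i::linorder, 'r::comm_ring_1) ext list \<Rightarrow> ('i, 'r) ext" where
  "wedge_list xs = foldr wedge xs ext_one"

text \<open>
  \<open>E r s\<close> stands for the matrix unit of End(V) with entry 1 in row r and column s.
  With \<open>v\<^sup>*(u) = (u, v)\<close> one has, for \<open>\<alpha> < p \<le> \<mu>\<close>,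
  \<open>E \<alpha> \<mu> = - v\<^sub>\<alpha> \<otimes> v\<^sub>\<mu>\<^sup>*\<close> and \<open>E \<mu> \<alpha> = v\<^sub>\<mu> \<otimes> v\<^sub>\<alpha>\<^sup>*\<close>.  For the pairing
  \<open>\<langle>f\<^sub>1 \<otimes> u\<^sub>1, u\<^sub>2 \<otimes> f\<^sub>2\<rangle> = f\<^sub>1(u\<^sub>2) f\<^sub>2(u\<^sub>1)\<close> the forms
  \<open>\<xi>'\<^bsub>\<alpha>,\<mu>\<^esub> = v\<^sub>\<alpha>\<^sup>* \<otimes> v\<^sub>\<mu>\<close> and \<open>\<xi>''\<^bsub>\<alpha>,\<mu>\<^esub> = - v\<^sub>\<mu>\<^sup>* \<otimes> v\<^sub>\<alpha>\<close> are then exactly the basis dual to the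
  \<open>E \<alpha> \<mu>\<close> and \<open>E \<mu> \<alpha>\<close>.  Hence the same index type serves for the exterior algebra of p
  (generator \<open>E r s\<close> = matrix unit) and that of its dual (generator \<open>E r s\<close> = dual form).
\<close>

datatype munit = E nat nat

instantiation munit :: linorder
begin

fun less_eq_munit :: "munit \<Rightarrow> munit \<Rightarrow> bool" where
  "less_eq_munit (E r s) (E r' s') = (r < r' \<or> r = r' \<and> s \<le> s')"

definition less_munit :: "munit \<Rightarrow> munit \<Rightarrow> bool" where
  "less_munit x y = (x \<le> y \<and> \<not> y \<le> x)"

instance
proof
  fix x y z :: munit
  show "x < y \<longleftrightarrow> x \<le> y \<and> \<not> y \<le> x" by (rule less_munit_def)
  show "x \<le> x" by (cases x) simp
  show "x \<le> z" if "x \<le> y" "y \<le> z" using that by (cases x; cases y; cases z) auto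
  show "x = y" if "x \<le> y" "y \<le> x" using that by (cases x; cases y) auto
  show "x \<le> y \<or> y \<le> x" by (cases x; cases y) auto
qed

end

definition p_prime :: "nat \<Rightarrow> nat \<Rightarrow> munit set" where
  "p_prime p q = {E \<alpha> \<mu> | \<alpha> \<mu>. \<alpha> < p \<and> p \<le> \<mu> \<and> \<mu> < p + q}"

definition p_dprime :: "nat \<Rightarrow> nat \<Rightarrow> munit set" where
  "p_dprime p q = {E \<mu> \<alpha> | \<alpha> \<mu>. \<alpha> < p \<and> p \<le> \<mu> \<and> \<mu> < p + q}"

text \<open>
  The tensor product of the m-th exterior power of \<open>p'\<close> and the n-th exterior power of \<open>p''\<close>, as the
  summand of bidegree (m, n) of the exterior algebra of \<open>p = p' \<oplus> p''\<close>.
\<close>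

definition ext_bideg :: "nat \<Rightarrow> nat \<Rightarrow> nat \<Rightarrow> nat \<Rightarrow> (munit, complex) ext set" where
  "ext_bideg p q m n = {x. \<forall>S. x S \<noteq> 0 \<longrightarrow>
     S \<subseteq> p_prime p q \<union> p_dprime p q \<and> card (S \<inter> p_prime p q) = m \<and> card (S \<inter> p_dprime p q) = n}"

definition Ad_unit :: "nat \<Rightarrow> nat \<Rightarrow> complex mat \<times> complex mat \<Rightarrow> munit \<Rightarrow> (munit, complex) ext" where
  "Ad_unit p q k e = (case e of E r s \<Rightarrow>
     (\<lambda>S. \<Sum>r'<p+q. \<Sum>s'<p+q.
        ext_gen (E r' s') (block k $$ (r', r) * mat_adjoint (block k) $$ (s, s')) S))"

definition ext_act ::
  "nat \<Rightarrow> nat \<Rightarrow> complex mat \<times> complex mat \<Rightarrow> (munit, complex) ext \<Rightarrow> (munit, complex) ext" where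
  "ext_act p q k x = (\<lambda>S. \<Sum>T\<in>Pow (p_prime p q \<union> p_dprime p q).
     x T * wedge_list (map (Ad_unit p q k) (sorted_list_of_set T)) S)"

definition K_submodule :: "nat \<Rightarrow> nat \<Rightarrow> (munit, complex) ext set \<Rightarrow> bool" where
  "K_submodule p q X \<longleftrightarrow>
     ext_zero \<in> X \<and>
     (\<forall>x\<in>X. \<forall>y\<in>X. ext_add x y \<in> X) \<and>
     (\<forall>c. \<forall>x\<in>X. ext_scale c x \<in> X) \<and>
     (\<forall>k\<in>K_group p q. \<forall>x\<in>X. ext_act p q k x \<in> X)"

definition K_irreducible :: "nat \<Rightarrow> nat \<Rightarrow> (munit, complex) ext set \<Rightarrow> bool" where
  "K_irreducible p q X \<longleftrightarrow>
     K_submodule p q X \<and> X \<noteq> {ext_zero} \<and>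
     (\<forall>Y. K_submodule p q Y \<and> Y \<subseteq> X \<longrightarrow> Y = {ext_zero} \<or> Y = X)"

definition is_weight :: "nat \<Rightarrow> nat \<Rightarrow> (munit, complex) ext set \<Rightarrow> (nat \<Rightarrow> int) \<Rightarrow> bool" where
  "is_weight p q X w \<longleftrightarrow>
     (\<exists>x\<in>X. x \<noteq> ext_zero \<and>
        (\<forall>t. (\<forall>r<p+q. cmod (t r) = 1) \<longrightarrow>
           ext_act p q (mat_diag p t, mat_diag q (\<lambda>i. t (p + i))) x =
           ext_scale (\<Prod>r<p+q. t r powi w r) x))"

text \<open>
  \<open>w' \<le> w\<close>: the difference is a sum of positive roots of U(p) x U(q), i.e. a combination with
  coefficients in \<open>\<nat>\<close> of the simple roots \<open>\<epsilon>\<^sub>r - \<epsilon>\<^sub>r\<^sub>+\<^sub>1\<close> inside each of the two blocks.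
\<close>

definition weight_le :: "nat \<Rightarrow> nat \<Rightarrow> (nat \<Rightarrow> int) \<Rightarrow> (nat \<Rightarrow> int) \<Rightarrow> bool" where
  "weight_le p q w' w \<longleftrightarrow>
     (\<exists>c :: nat \<Rightarrow> nat. \<forall>s<p+q. w s - w' s =
        (\<Sum>r \<in> {r. Suc r < p \<or> p \<le> r \<and> Suc r < p + q}.
           int (c r) * (of_bool (s = r) - of_bool (s = Suc r))))"

definition has_highest_weight ::
  "nat \<Rightarrow> nat \<Rightarrow> (munit, complex) ext set \<Rightarrow> (nat \<Rightarrow> int) \<Rightarrow> bool" where
  "has_highest_weight p q X w \<longleftrightarrow>
     is_weight p q X w \<and> (\<forall>w'. is_weight p q X w' \<longrightarrow> weight_le p q w' w)"

text \<open>The weight \<open>(q\<^sup>b, 0\<^bsup>p-a-b\<^esup>, (-q)\<^sup>a; (a-b)\<^sup>q)\<close>.\<close>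

definition V_weight :: "nat \<Rightarrow> nat \<Rightarrow> nat \<Rightarrow> nat \<Rightarrow> nat \<Rightarrow> int" where
  "V_weight p q a b r =
     (if r < b then int q
      else if r < p - a then 0
      else if r < p then - int q
      else int a - int b)"

definition is_V_copy :: "nat \<Rightarrow> nat \<Rightarrow> nat \<Rightarrow> nat \<Rightarrow> (munit, complex) ext set \<Rightarrow> bool" where
  "is_V_copy p q a b X \<longleftrightarrow>
     X \<subseteq> ext_bideg p q (b * q) (a * q) \<and>
     K_irreducible p q X \<and>
     has_highest_weight p q X (V_weight p q a b)"

text \<open>
  For each pair (r, k) the Fock space has exactly one coordinate \<open>Z r k\<close>.  If the basis vectors of V
  and W have the same sign it is the coordinate on \<open>V'\<^sub>+ \<otimes> W'\<^sub>+\<close> or \<open>V'\<^sub>- \<otimes> W'\<^sub>-\<close>; if they have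
  opposite signs it is the coordinate on \<open>V''\<^sub>+ \<otimes> W''\<^sub>-\<close> or \<open>V''\<^sub>- \<otimes> W''\<^sub>+\<close>.  In particular, for
  \<open>\<alpha> < p\<close>, \<open>z'\<^bsub>\<alpha>,i\<^esub>\<close> is \<open>Z \<alpha> i\<close> with i < a, and \<open>z''\<^bsub>\<alpha>,j\<^esub>\<close> is \<open>Z \<alpha> (a + j)\<close> with j < b.
\<close>

datatype fvar = Z nat nat

instantiation fvar :: linorder
begin

fun less_eq_fvar :: "fvar \<Rightarrow> fvar \<Rightarrow> bool" where
  "less_eq_fvar (Z r s) (Z r' s') = (r < r' \<or> r = r' \<and> s \<le> s')"

definition less_fvar :: "fvar \<Rightarrow> fvar \<Rightarrow> bool" where
  "less_fvar x y = (x \<le> y \<and> \<not> y \<le> x)"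

instance
proof
  fix x y z :: fvar
  show "x < y \<longleftrightarrow> x \<le> y \<and> \<not> y \<le> x" by (rule less_fvar_def)
  show "x \<le> x" by (cases x) simp
  show "x \<le> z" if "x \<le> y" "y \<le> z" using that by (cases x; cases y; cases z) auto
  show "x = y" if "x \<le> y" "y \<le> x" using that by (cases x; cases y) auto
  show "x \<le> y \<or> y \<le> x" by (cases x; cases y) auto
qed

end

type_synonym fpoly = "(fvar \<Rightarrow>\<^sub>0 nat) \<Rightarrow>\<^sub>0 complex"

definition const :: "complex \<Rightarrow> fpoly" where
  "const c = Poly_Mapping.single 0 c"

definition var :: "fvar \<Rightarrow> fpoly" where
  "var v = Poly_Mapping.single (Poly_Mapping.single v 1) 1"

definition pdiff :: "fvar \<Rightarrow> fpoly \<Rightarrow> fpoly" where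
  "pdiff v f = (\<Sum>m\<in>Poly_Mapping.keys f.
     Poly_Mapping.single (m - Poly_Mapping.single v 1)
       (of_nat (Poly_Mapping.lookup m v) * Poly_Mapping.lookup f m))"

definition psubst :: "(fvar \<Rightarrow> fpoly) \<Rightarrow> fpoly \<Rightarrow> fpoly" where
  "psubst \<sigma> f = (\<Sum>m\<in>Poly_Mapping.keys f.
     const (Poly_Mapping.lookup f m) * (\<Prod>v\<in>Poly_Mapping.keys m. \<sigma> v ^ Poly_Mapping.lookup m v))"

definition fock :: "nat \<Rightarrow> nat \<Rightarrow> nat \<Rightarrow> nat \<Rightarrow> fpoly set" where
  "fock p q a b = {f. \<forall>m\<in>Poly_Mapping.keys f.
     Poly_Mapping.keys m \<subseteq> {Z r k | r k. r < p + q \<and> k < a + b}}"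

definition same_sign :: "nat \<Rightarrow> nat \<Rightarrow> nat \<Rightarrow> nat \<Rightarrow> bool" where
  "same_sign p a r k \<longleftrightarrow> (r < p \<longleftrightarrow> k < a)"

text \<open>
  The action of K: \<open>(k f)(z) = det(k\<^sub>-)\<^bsup>a-b\<^esup> f(k\<^sup>-\<^sup>1 z)\<close>.  On \<open>V'\<close> the element k acts by its
  matrix g in the given basis, on \<open>V''\<close> by the complex conjugate matrix; so the coordinates on
  \<open>V'\<close> are transformed by \<open>g\<^sup>-\<^sup>1 = g\<^sup>*\<close> and those on \<open>V''\<close> by the transpose of g.
\<close>

definition coord_act ::
  "nat \<Rightarrow> nat \<Rightarrow> nat \<Rightarrow> complex mat \<times> complex mat \<Rightarrow> fvar \<Rightarrow> fpoly" where
  "coord_act p q a k v = (case v of Z r l \<Rightarrow>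
     (\<Sum>s<p+q. const (if same_sign p a r l then cnj (block k $$ (s, r)) else block k $$ (s, r))
                 * var (Z s l)))"

definition fock_act ::
  "nat \<Rightarrow> nat \<Rightarrow> nat \<Rightarrow> nat \<Rightarrow> complex mat \<times> complex mat \<Rightarrow> fpoly \<Rightarrow> fpoly" where
  "fock_act p q a b k f =
     const (det (snd k) powi (int a - int b)) * psubst (coord_act p q a k) f"

text \<open>
  The complexified symplectic space is \<open>V' \<otimes> W' \<oplus> V'' \<otimes> W''\<close>; its two summands are Lagrangian and
  dual to each other.  In the Fock model the basis vector \<open>v'\<^sub>r \<otimes> w'\<^sub>k\<close> acts by
  \<open>heis\<close> and the dual basis vector of \<open>V'' \<otimes> W''\<close> by \<open>heis_dual\<close>; they satisfy
  \<open>[heis r k, heis_dual s l] = \<delta>\<^bsub>rs\<^esub> \<delta>\<^bsub>kl\<^esub>\<close>.  Vectors whose dual is a coordinate of the Fock space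
  differentiate, the others multiply by a coordinate.
\<close>

definition heis :: "nat \<Rightarrow> nat \<Rightarrow> nat \<Rightarrow> nat \<Rightarrow> fpoly \<Rightarrow> fpoly" where
  "heis p a r k f = (if same_sign p a r k then pdiff (Z r k) f else var (Z r k) * f)"

definition heis_dual :: "nat \<Rightarrow> nat \<Rightarrow> nat \<Rightarrow> nat \<Rightarrow> fpoly \<Rightarrow> fpoly" where
  "heis_dual p a r k f = (if same_sign p a r k then var (Z r k) * f else - pdiff (Z r k) f)"

text \<open>
  The complexification of the Lie algebra of U(W) is End(W), i.e. all matrices Y of size a + b, with
  \<open>Y w\<^sub>k = (\<Sum>l. Y\<^bsub>lk\<^esub> w\<^sub>l)\<close>.  The sum below is the infinitesimal oscillator representation: the
  symmetrised quadratic expression in the Heisenberg operators with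
  \<open>[\<omega>(Y), heis r k] = (\<Sum>l. Y\<^bsub>lk\<^esub> heis r l)\<close>.  The trace term is the derivative of the twist by
  \<open>det\<^bsup>(p+q)/2\<^esup>\<close>.
\<close>

definition weil :: "nat \<Rightarrow> nat \<Rightarrow> nat \<Rightarrow> nat \<Rightarrow> complex mat \<Rightarrow> fpoly \<Rightarrow> fpoly" where
  "weil p q a b Y f =
     const (of_nat (p + q) / 2 * (\<Sum>k<a+b. Y $$ (k, k))) * f
     - (\<Sum>r<p+q. \<Sum>k<a+b. \<Sum>l<a+b.
          const (Y $$ (l, k) / 2) *
            (heis p a r l (heis_dual p a r k f) + heis_dual p a r k (heis p a r l f)))"

text \<open>
  The operators by which the universal enveloping algebra acts: its image in the endomorphism algebra
  is the unital subalgebra generated by the operators \<open>weil Y\<close>.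
\<close>

inductive_set env_ops :: "nat \<Rightarrow> nat \<Rightarrow> nat \<Rightarrow> nat \<Rightarrow> (fpoly \<Rightarrow> fpoly) set"
  for p q a b :: nat where
  env_one: "(\<lambda>f. f) \<in> env_ops p q a b"
| env_gen: "Y \<in> carrier_mat (a + b) (a + b) \<Longrightarrow> weil p q a b Y \<in> env_ops p q a b"
| env_comp: "u \<in> env_ops p q a b \<Longrightarrow> v \<in> env_ops p q a b \<Longrightarrow> (\<lambda>f. u (v f)) \<in> env_ops p q a b"
| env_add: "u \<in> env_ops p q a b \<Longrightarrow> v \<in> env_ops p q a b \<Longrightarrow> (\<lambda>f. u f + v f) \<in> env_ops p q a b"
| env_scale: "u \<in> env_ops p q a b \<Longrightarrow> (\<lambda>f. const c * u f) \<in> env_ops p q a b"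

definition psi_form :: "nat \<Rightarrow> nat \<Rightarrow> nat \<Rightarrow> nat \<Rightarrow> (munit, fpoly) ext" where
  "psi_form p q a b = wedge_list
     ([(\<lambda>S. \<Sum>\<alpha><p. ext_gen (E \<alpha> \<mu>) (var (Z \<alpha> (a + j))) S). j \<leftarrow> [0..<b], \<mu> \<leftarrow> [p..<p+q]] @
      [(\<lambda>S. \<Sum>\<alpha><p. ext_gen (E \<mu> \<alpha>) (var (Z \<alpha> i)) S). i \<leftarrow> [0..<a], \<mu> \<leftarrow> [p..<p+q]])"

text \<open>
  The cocycle as a map, using the pairing of the exterior algebras of p and its dual for which the
  monomials in dual bases are dual to each other.
\<close>

definition psi :: "nat \<Rightarrow> nat \<Rightarrow> nat \<Rightarrow> nat \<Rightarrow> (munit, complex) ext \<Rightarrow> fpoly" where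
  "psi p q a b x = (\<Sum>S\<in>Pow (p_prime p q \<union> p_dprime p q). const (x S) * psi_form p q a b S)"

definition Hom_K ::
  "nat \<Rightarrow> nat \<Rightarrow> nat \<Rightarrow> nat \<Rightarrow> (munit, complex) ext set \<Rightarrow> ((munit, complex) ext \<Rightarrow> fpoly) set" where
  "Hom_K p q a b X = {T \<in> X \<rightarrow>\<^sub>E fock p q a b.
     (\<forall>x\<in>X. \<forall>y\<in>X. T (ext_add x y) = T x + T y) \<and>
     (\<forall>c. \<forall>x\<in>X. T (ext_scale c x) = const c * T x) \<and>
     (\<forall>k\<in>K_group p q. \<forall>x\<in>X. T (ext_act p q k x) = fock_act p q a b k (T x))}"

end

theory Submission
  imports Defs
begin

text \<open>
  Let \<open>x\<close> be a highest weight vector of \<open>X\<close>.  Since \<open>X\<close> is irreducible, a homomorphism \<open>T\<close> is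
  determined by its value \<open>T x\<close> (\<open>Hom_K_eqI\<close>), so the theorem amounts to two facts.  The cocycle is
  K-equivariant and the Weil operators commute with K (\<open>psi_equivariant\<close>, \<open>env_ops_equivariant\<close>),
  which gives one inclusion.  Every value \<open>T x\<close> lies in the orbit of \<open>\<Delta> = psi x\<close> under the
  enveloping algebra (\<open>hw_values_in_orbit\<close>), which gives the other.

  The second fact is proved by positivity of the Fischer inner product, for which multiplication by a
  variable is adjoint to differentiation.  The quadratic invariants of U(p) and of U(q) supply
  creation operators (multiplication by \<open>\<Sum>\<^sub>r Z r k Z r l\<close>) and annihilation operators (minus the
  corresponding Laplacians); up to sign these are adjoint to each other and all of them commute with
  K.  The Lie algebra of U(W) contains, for each mode, the sum of a creation operator for one of the
  two groups and an annihilation operator for the other (\<open>weil_mode\<close>).  Take a value \<open>f = T x\<close> and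
  subtract its orthogonal projection to the span of the words in creation operators, of bounded
  length, applied to \<open>\<Delta>\<close>.  By induction on the degree the difference is harmonic, that is, killed by
  all annihilation operators.  If harmonic values are multiples of \<open>\<Delta>\<close>, then \<open>f\<close> lies in that span;
  and the span lies in the orbit, because a creation operator differs from an element of the Lie
  algebra by an annihilation operator, which lowers the degree.

  It remains to see that a harmonic highest weight vector \<open>f\<close> of the weight in question is unique up
  to a factor (\<open>harmonic_hw_diagonal\<close>).  A raising operator is a difference of an operator that acts
  on the variables of one type and one that acts on the variables of the other.  The matrix of inner
  products of the second derivatives which occur in the Laplacians has nonnegative real parts in all
  entries and its row sums vanish; so these real parts vanish, both parts of each raising operator
  kill \<open>f\<close> separately, and no monomial of \<open>f\<close> contains variables of both types in the same row
  (\<open>harmonic_raising_eq_0\<close>).  The weight then confines \<open>f\<close> to a \<open>b \<times> b\<close> and an \<open>a \<times> a\<close> block of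
  variables with all row sums \<open>q\<close>.  An identity between norms shows that the column sums are \<open>q\<close> as
  well (\<open>square_column_sums\<close>), and a monomial that is extremal for exchanges of entries must be the
  \<open>q\<close>-th power of the diagonal (\<open>extremal_monomial_diagonal\<close>).  Thus \<open>f\<close> is determined by one
  coefficient.

  The polynomial \<open>\<Delta>\<close> is not zero: the weight and the bidegree force \<open>x\<close> to be a multiple of a single
  monomial of the exterior algebra (\<open>hw_vector_support\<close>), and after a specialisation of the variables
  the cocycle becomes plus or minus the dual monomial (\<open>psi_form_top_nonzero\<close>).  The passage from
  K to raising operators uses that the weights of \<open>X\<close> bound those of all \<open>T y\<close>
  (\<open>fock_weights_below\<close>): translates of \<open>T x\<close> under plane rotations have no component of the raised
  weight, and neither has the derivative at the identity (\<open>hw_image_raising\<close>).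
\<close>

section \<open>Polynomials\<close>

(* Exponents of single variables are written with the numeral 1; rewriting it to "Suc 0" would
   hide the exponent unit_exp from the rules that mention it. *)
declare One_nat_def [simp del]

abbreviation lk :: "('i \<Rightarrow>\<^sub>0 'c::zero) \<Rightarrow> 'i \<Rightarrow> 'c" where
  "lk \<equiv> Poly_Mapping.lookup"

abbreviation monoms :: "fpoly \<Rightarrow> (fvar \<Rightarrow>\<^sub>0 nat) set" where
  "monoms \<equiv> Poly_Mapping.keys"

abbreviation unit_exp :: "fvar \<Rightarrow> (fvar \<Rightarrow>\<^sub>0 nat)" where
  "unit_exp v \<equiv> Poly_Mapping.single v 1"

lemmas exp_simps = lookup_add lookup_minus lookup_single when_def

lemma unit_exp_cancel: "lk m v \<noteq> 0 \<Longrightarrow> m - unit_exp v + unit_exp v = (m :: fvar \<Rightarrow>\<^sub>0 nat)"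
  by (rule poly_mapping_eqI) (auto simp: exp_simps)

lemma sum_of_monomials:
  fixes f :: "'i \<Rightarrow>\<^sub>0 'c::comm_monoid_add"
  assumes "finite K" "Poly_Mapping.keys f \<subseteq> K"
  shows "f = (\<Sum>k\<in>K. Poly_Mapping.single k (lk f k))"
proof (rule poly_mapping_eqI)
  fix k
  have "lk (\<Sum>k\<in>K. Poly_Mapping.single k (lk f k)) k = (\<Sum>j\<in>K. if j = k then lk f k else 0)"
    unfolding lookup_sum by (intro sum.cong) (auto simp: lookup_single when_def)
  also have "\<dots> = lk f k"
    using assms by (auto simp: in_keys_iff subset_iff)
  finally show "lk f k = lk (\<Sum>k\<in>K. Poly_Mapping.single k (lk f k)) k" ..
qed

lemma lookup_const_mult [simp]: "lk (const c * f) m = c * lk f m"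
  unfolding const_def mult_map_scale_conv_mult[symmetric]
  by (simp add: Poly_Mapping.map.rep_eq when_def)

lemma lookup_const: "lk (const c) m = (if m = 0 then c else 0)"
  by (simp add: const_def lookup_single when_def)

lemma const_hom [simp]:
  "const 0 = 0" "const 1 = 1" "const c + const d = const (c + d)" "const c * const d = const (c * d)"
  "- const c = const (- c)" "const c - const d = const (c - d)"
  by (simp_all add: const_def single_add mult_single single_uminus single_diff)

lemma const_mult_const: "const c * (const d * f) = const (c * d) * f"
  by (simp add: mult.assoc[symmetric])

lemma const_sum: "const (sum c A) = (\<Sum>x\<in>A. const (c x))"
  by (induction A rule: infinite_finite_induct) (auto simp flip: const_hom(3))

lemma const_eq_0_iff [simp]: "const c = 0 \<longleftrightarrow> c = 0"
  by (metis const_hom(1) lookup_const lookup_zero)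

lemma lookup_var_mult:
  "lk (var v * f) m = (if lk m v = 0 then 0 else lk f (m - unit_exp v))"
proof -
  have *: "unit_exp v + k = m \<longleftrightarrow> lk m v \<noteq> 0 \<and> k = m - unit_exp v" for k
    by (auto simp: poly_mapping_eq_iff fun_eq_iff exp_simps)
  have "var v * f = (\<Sum>k\<in>monoms f. Poly_Mapping.single (unit_exp v + k) (lk f k))"
    by (subst (1) sum_of_monomials[of "monoms f" f])
       (auto simp: var_def sum_distrib_left mult_single)
  then have "lk (var v * f) m = (\<Sum>k\<in>monoms f. lk f k when unit_exp v + k = m)"
    by (simp add: lookup_sum lookup_single)
  also have "\<dots> = (\<Sum>k\<in>monoms f. if k = m - unit_exp v then (if lk m v = 0 then 0 else lk f k) else 0)"
    by (intro sum.cong) (auto simp: * when_def)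
  also have "\<dots> = (if lk m v = 0 then 0 else lk f (m - unit_exp v))"
    by (auto simp: in_keys_iff)
  finally show ?thesis .
qed

lemma lookup_pdiff: "lk (pdiff v f) m = of_nat (lk m v + 1) * lk f (m + unit_exp v)"
proof -
  have *: "lk k v \<noteq> 0 \<Longrightarrow> k - unit_exp v = m \<longleftrightarrow> k = m + unit_exp v" for k
    by (auto simp: poly_mapping_eq_iff fun_eq_iff exp_simps)
  have "lk (pdiff v f) m = (\<Sum>k\<in>monoms f. of_nat (lk k v) * lk f k when k - unit_exp v = m)"
    by (simp add: pdiff_def lookup_sum lookup_single)
  also have "\<dots> = (\<Sum>k\<in>monoms f. if k = m + unit_exp v then of_nat (lk k v) * lk f k else 0)"
    apply (intro sum.cong refl)
    subgoal for k by (cases "lk k v = 0") (auto simp: * when_def)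
    done
  also have "\<dots> = of_nat (lk m v + 1) * lk f (m + unit_exp v)"
    by (auto simp: in_keys_iff lookup_add)
  finally show ?thesis .
qed

lemma pdiff_add: "pdiff v (f + g) = pdiff v f + pdiff v g"
  by (rule poly_mapping_eqI) (simp add: lookup_pdiff lookup_add ring_distribs)

lemma pdiff_zero [simp]: "pdiff v 0 = 0"
  by (simp add: pdiff_def)

lemma pdiff_sum: "pdiff v (sum f A) = (\<Sum>x\<in>A. pdiff v (f x))"
  by (induction A rule: infinite_finite_induct) (auto simp: pdiff_add)

lemma pdiff_scale: "pdiff v (const c * f) = const c * pdiff v f"
  by (rule poly_mapping_eqI) (simp add: lookup_pdiff)

lemma pdiff_uminus: "pdiff v (- f) = - pdiff v f"
  using pdiff_scale[of v "-1" f] by (simp flip: const_hom(5))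

lemma pdiff_const [simp]: "pdiff v (const c) = 0"
  by (simp add: pdiff_def const_def)

lemma pdiff_var_mult: "pdiff v (var w * f) = (if v = w then f else 0) + var w * pdiff v f"
proof (rule poly_mapping_eqI)
  fix m
  have [simp]: "m + unit_exp v - unit_exp w = m - unit_exp w + unit_exp v" if "lk m w \<noteq> 0"
    using that by (intro poly_mapping_eqI) (auto simp: exp_simps)
  have [simp]: "m - unit_exp u + unit_exp u = m" if "0 < lk m u" for u
    using that by (simp add: unit_exp_cancel)
  show "lk (pdiff v (var w * f)) m = lk ((if v = w then f else 0) + var w * pdiff v f) m"
    by (cases "lk m w = 0")
       (auto simp: lookup_pdiff lookup_var_mult exp_simps ring_distribs)
qed

lemma pdiff_commute: "pdiff u (pdiff v f) = pdiff v (pdiff u f)"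
  by (rule poly_mapping_eqI) (auto simp: lookup_pdiff lookup_add lookup_single when_def add_ac)

definition polys_in :: "fvar set \<Rightarrow> fpoly set" where
  "polys_in V = {f. \<forall>m\<in>monoms f. Poly_Mapping.keys m \<subseteq> V}"

lemma polys_in_UNIV [simp]: "f \<in> polys_in UNIV"
  by (simp add: polys_in_def)

lemma polys_in_iff: "f \<in> polys_in V \<longleftrightarrow> (\<forall>m v. lk f m \<noteq> 0 \<longrightarrow> lk m v \<noteq> 0 \<longrightarrow> v \<in> V)"
  by (auto simp: polys_in_def in_keys_iff subset_iff)

lemma polys_in_const [simp]: "const c \<in> polys_in V"
  by (auto simp: polys_in_iff lookup_const)

lemma polys_in_0 [simp]: "0 \<in> polys_in V"
  by (simp add: polys_in_iff)

lemma polys_in_add: "f \<in> polys_in V \<Longrightarrow> g \<in> polys_in V \<Longrightarrow> f + g \<in> polys_in V"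
  by (auto simp: polys_in_iff lookup_add) (metis add_0)

lemma polys_in_sum: "(\<And>x. x \<in> A \<Longrightarrow> f x \<in> polys_in V) \<Longrightarrow> sum f A \<in> polys_in V"
  by (induction A rule: infinite_finite_induct) (auto simp: polys_in_add)

lemma polys_in_scale: "f \<in> polys_in V \<Longrightarrow> const c * f \<in> polys_in V"
  by (auto simp: polys_in_iff)

lemma polys_in_uminus: "f \<in> polys_in V \<Longrightarrow> - f \<in> polys_in V"
  by (auto simp: polys_in_iff)

lemma polys_in_var_mult: "v \<in> V \<Longrightarrow> f \<in> polys_in V \<Longrightarrow> var v * f \<in> polys_in V"
  unfolding polys_in_iff lookup_var_mult
  apply (intro allI impI)
  subgoal for m w
    by (cases "w = v") (auto split: if_splits simp: lookup_minus lookup_single dest: spec[of _ "m - unit_exp v"] spec[of _ w])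
  done

lemma polys_in_pdiff: "f \<in> polys_in V \<Longrightarrow> pdiff v f \<in> polys_in V"
  unfolding polys_in_iff lookup_pdiff
  by (auto simp: lookup_add)

lemma single_polys_in_induct:
  assumes c: "\<And>c. P (const c)"
    and v: "\<And>v f. v \<in> V \<Longrightarrow> f \<in> polys_in V \<Longrightarrow> P f \<Longrightarrow> P (var v * f)"
    and m: "Poly_Mapping.keys m \<subseteq> V"
  shows "P (Poly_Mapping.single m c)"
  using m
proof (induction "\<Sum>v\<in>Poly_Mapping.keys m. lk m v" arbitrary: m rule: less_induct)
  case less
  show ?case
  proof (cases "m = 0")
    case True
    then show ?thesis using c[of c] by (simp add: const_def)
  next
    case False
    then obtain v where v0: "v \<in> Poly_Mapping.keys m" by (metis equals0I keys_eq_empty)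
    define m' where "m' = m - unit_exp v"
    have mm: "m = unit_exp v + m'"
      using v0 by (intro poly_mapping_eqI)
         (auto simp: m'_def exp_simps in_keys_iff)
    have sub: "Poly_Mapping.keys m' \<subseteq> Poly_Mapping.keys m"
      by (auto simp: in_keys_iff m'_def lookup_minus)
    have "(\<Sum>v\<in>Poly_Mapping.keys m'. lk m' v) = (\<Sum>v\<in>Poly_Mapping.keys m. lk m' v)"
      using sub by (intro sum.mono_neutral_left) (auto simp: in_keys_iff)
    also have "\<dots> < (\<Sum>v\<in>Poly_Mapping.keys m. lk m v)"
      using v0 by (intro sum_strict_mono_ex1) (auto simp: m'_def lookup_minus lookup_single in_keys_iff intro!: bexI[of _ v])
    finally have "P (Poly_Mapping.single m' c)"
      using less sub by auto
    moreover have "Poly_Mapping.single m' c \<in> polys_in V"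
      using less.prems sub by (auto simp: polys_in_def)
    ultimately have "P (var v * Poly_Mapping.single m' c)"
      using v0 less.prems by (intro v) auto
    then show ?thesis by (simp add: var_def mult_single mm)
  qed
qed

text \<open>
  Operator identities on polynomials are verified below on constants and then propagated through sums
  and through multiplication by a single variable, where only commutators with a variable matter.
\<close>

lemma polys_in_induct [consumes 1, case_names const add var]:
  assumes "f \<in> polys_in V"
    and "\<And>c. P (const c)"
    and add: "\<And>f g. f \<in> polys_in V \<Longrightarrow> g \<in> polys_in V \<Longrightarrow> P f \<Longrightarrow> P g \<Longrightarrow> P (f + g)"
    and "\<And>v f. v \<in> V \<Longrightarrow> f \<in> polys_in V \<Longrightarrow> P f \<Longrightarrow> P (var v * f)"
  shows "P f"
proof -
  have "P (\<Sum>k\<in>K. Poly_Mapping.single k (lk f k)) \<and> (\<Sum>k\<in>K. Poly_Mapping.single k (lk f k)) \<in> polys_in V"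
    if "finite K" "K \<subseteq> monoms f" for K
    using that
  proof (induction K)
    case empty
    then show ?case using assms(2)[of 0] by simp
  next
    case (insert k K)
    then have k: "Poly_Mapping.keys k \<subseteq> V" using assms(1) by (auto simp: polys_in_def)
    have "P (Poly_Mapping.single k (lk f k))"
      by (rule single_polys_in_induct[where P = P and V = V]) (fact assms(2) assms(4) k)+
    moreover have "Poly_Mapping.single k (lk f k) \<in> polys_in V"
      using k by (auto simp: polys_in_def)
    moreover have "P (\<Sum>k\<in>K. Poly_Mapping.single k (lk f k))"
      and "(\<Sum>k\<in>K. Poly_Mapping.single k (lk f k)) \<in> polys_in V"
      using insert by blast+
    ultimately have "P (Poly_Mapping.single k (lk f k) + (\<Sum>k\<in>K. Poly_Mapping.single k (lk f k)))"
      and "Poly_Mapping.single k (lk f k) + (\<Sum>k\<in>K. Poly_Mapping.single k (lk f k)) \<in> polys_in V"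
      by (simp_all add: add polys_in_add)
    then show ?case using insert.hyps by simp
  qed
  from this[OF finite_keys subset_refl]
  have "P (\<Sum>k\<in>monoms f. Poly_Mapping.single k (lk f k))" ..
  moreover have "f = (\<Sum>k\<in>monoms f. Poly_Mapping.single k (lk f k))"
    by (rule sum_of_monomials) auto
  ultimately show ?thesis by argo
qed

lemma fpoly_induct [case_names const add var]:
  assumes "\<And>c. P (const c)" "\<And>f g. P f \<Longrightarrow> P g \<Longrightarrow> P (f + g)" "\<And>v f. P f \<Longrightarrow> P (var v * f)"
  shows "P f"
  using polys_in_UNIV[of f] by (induction rule: polys_in_induct) (use assms in auto)

subsection \<open>Substitution\<close>

lemma psubst_superset:
  assumes "finite K" "monoms f \<subseteq> K"
  shows "psubst \<sigma> f = (\<Sum>m\<in>K. const (lk f m) * (\<Prod>v\<in>Poly_Mapping.keys m. \<sigma> v ^ lk m v))"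
  unfolding psubst_def using assms
  by (intro sum.mono_neutral_left) (auto simp: in_keys_iff)

lemma psubst_const [simp]: "psubst \<sigma> (const c) = const c"
  by (subst psubst_superset[of "{0}"]) (auto simp: in_keys_iff lookup_const split: if_splits)

lemma psubst_0 [simp]: "psubst \<sigma> 0 = 0"
  by (simp add: psubst_def)

lemma psubst_1 [simp]: "psubst \<sigma> 1 = 1"
  using psubst_const[of \<sigma> 1] by simp

lemma psubst_add: "psubst \<sigma> (f + g) = psubst \<sigma> f + psubst \<sigma> g"
proof -
  let ?K = "monoms f \<union> monoms g"
  have "monoms (f + g) \<subseteq> ?K" by (rule keys_add)
  then show ?thesis
    by (simp add: psubst_superset[of ?K] lookup_add sum.distrib ring_distribs const_hom(3)[symmetric]
          del: const_hom)
qed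

text \<open>
  Together with additivity and the value on constants this makes \<open>psubst \<sigma>\<close> a ring homomorphism.
\<close>

lemma psubst_var_mult: "psubst \<sigma> (var v * f) = \<sigma> v * psubst \<sigma> f"
proof -
  let ?M = "\<lambda>m. \<Prod>v\<in>Poly_Mapping.keys m. \<sigma> v ^ lk m v"
  have M: "?M m = (\<Prod>w\<in>W. \<sigma> w ^ lk m w)" if "finite W" "Poly_Mapping.keys m \<subseteq> W" for m W
    using that by (intro prod.mono_neutral_left) (auto simp: in_keys_iff)
  have M1: "?M (unit_exp v + m) = \<sigma> v * ?M m" for m
  proof -
    let ?W = "insert v (Poly_Mapping.keys m)"
    have "Poly_Mapping.keys (unit_exp v + m) \<subseteq> ?W" using keys_add[of "unit_exp v" m] by auto
    then have "?M (unit_exp v + m) = (\<Prod>w\<in>?W. \<sigma> w ^ lk (unit_exp v + m) w)" by (intro M) auto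
    also have "\<dots> = (\<Prod>w\<in>?W. (if w = v then \<sigma> v else 1) * \<sigma> w ^ lk m w)"
      by (intro prod.cong) (auto simp: lookup_add lookup_single power_add)
    also have "\<dots> = \<sigma> v * (\<Prod>w\<in>?W. \<sigma> w ^ lk m w)"
      by (simp add: prod.distrib prod.delta)
    also have "(\<Prod>w\<in>?W. \<sigma> w ^ lk m w) = ?M m" by (intro M[symmetric]) auto
    finally show ?thesis .
  qed
  let ?K = "(\<lambda>m. unit_exp v + m) ` monoms f"
  have "monoms (var v * f) \<subseteq> ?K"
    using keys_mult[of "var v" f] by (auto simp: var_def)
  then have "psubst \<sigma> (var v * f) = (\<Sum>m\<in>?K. const (lk (var v * f) m) * ?M m)"
    by (intro psubst_superset) auto
  also have "\<dots> = (\<Sum>m\<in>monoms f. const (lk (var v * f) (unit_exp v + m)) * ?M (unit_exp v + m))"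
    by (subst sum.reindex) (auto simp: inj_on_def)
  also have "\<dots> = (\<Sum>m\<in>monoms f. const (lk f m) * (\<sigma> v * ?M m))"
    by (intro sum.cong refl, simp only: M1 lookup_var_mult) (simp add: lookup_add)
  also have "\<dots> = \<sigma> v * psubst \<sigma> f"
    by (simp add: psubst_def sum_distrib_left mult_ac)
  finally show ?thesis .
qed

lemma psubst_var [simp]: "psubst \<sigma> (var v) = \<sigma> v"
  using psubst_var_mult[of \<sigma> v 1] by simp

lemma psubst_mult: "psubst \<sigma> (f * g) = psubst \<sigma> f * psubst \<sigma> g"
proof (induction f rule: fpoly_induct)
  case (const c)
  show ?case
  proof (induction g rule: fpoly_induct)
    case (var v f)
    have "psubst \<sigma> (const c * (var v * f)) = psubst \<sigma> (var v * (const c * f))"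
      by (simp add: mult_ac)
    then show ?case by (simp only: psubst_var_mult var) (simp add: mult_ac)
  qed (simp_all add: psubst_add ring_distribs)
next
  case (var v f)
  then show ?case by (simp only: psubst_var_mult mult.assoc)
qed (simp add: psubst_add ring_distribs)

lemma psubst_uminus: "psubst \<sigma> (- f) = - psubst \<sigma> f"
  using psubst_add[of \<sigma> f "- f"] by (simp add: eq_neg_iff_add_eq_0 add.commute)

lemma psubst_sum: "psubst \<sigma> (sum f A) = (\<Sum>x\<in>A. psubst \<sigma> (f x))"
  by (induction A rule: infinite_finite_induct) (auto simp: psubst_add)

section \<open>The Fischer inner product\<close>

definition exp_fact :: "(fvar \<Rightarrow>\<^sub>0 nat) \<Rightarrow> nat" where
  "exp_fact m = (\<Prod>v\<in>Poly_Mapping.keys m. fact (lk m v))"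

lemma exp_fact_pos: "exp_fact m > 0"
  by (simp add: exp_fact_def)

lemma exp_fact_add_unit: "exp_fact (m + unit_exp v) = (lk m v + 1) * exp_fact m"
proof -
  let ?W = "insert v (Poly_Mapping.keys m)"
  have "Poly_Mapping.keys (m + unit_exp v) \<subseteq> ?W" using keys_add[of m "unit_exp v"] by auto
  then have "exp_fact (m + unit_exp v) = (\<Prod>w\<in>?W. fact (lk (m + unit_exp v) w))"
    unfolding exp_fact_def by (intro prod.mono_neutral_left) (auto simp: in_keys_iff)
  also have "\<dots> = (\<Prod>w\<in>?W. (if w = v then lk m v + 1 else 1) * fact (lk m w))"
    by (intro prod.cong) (auto simp: lookup_add lookup_single simp flip: Suc_eq_plus1)
  also have "\<dots> = (lk m v + 1) * (\<Prod>w\<in>?W. fact (lk m w))"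
    by (simp add: prod.distrib prod.delta)
  also have "(\<Prod>w\<in>?W. fact (lk m w)) = exp_fact m"
    unfolding exp_fact_def by (intro prod.mono_neutral_right) (auto simp: in_keys_iff)
  finally show ?thesis .
qed

text \<open>
  The weight \<open>m!\<close> of the monomial \<open>m\<close> is what makes multiplication by a variable adjoint to the
  derivative in that variable.
\<close>

definition ip :: "fpoly \<Rightarrow> fpoly \<Rightarrow> complex" where
  "ip f g = (\<Sum>m\<in>monoms f. of_nat (exp_fact m) * lk f m * cnj (lk g m))"

lemma ip_superset:
  assumes "finite K" "monoms f \<subseteq> K \<or> monoms g \<subseteq> K"
  shows "ip f g = (\<Sum>m\<in>K. of_nat (exp_fact m) * lk f m * cnj (lk g m))"
proof -
  let ?h = "\<lambda>m. of_nat (exp_fact m) * lk f m * cnj (lk g m)"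
  have "ip f g = sum ?h (monoms f \<union> K)"
    unfolding ip_def using assms(1) by (intro sum.mono_neutral_left) (auto simp: in_keys_iff)
  also have "\<dots> = sum ?h K"
    using assms by (intro sum.mono_neutral_right) (auto simp: in_keys_iff)
  finally show ?thesis .
qed

lemma ip_cnj: "ip g f = cnj (ip f g)"
  by (subst (1 2) ip_superset[of "monoms f \<union> monoms g"]) (auto simp: mult_ac)

lemma ip_add_left: "ip (f + g) h = ip f h + ip g h"
  by (subst (1 2 3) ip_superset[of "monoms h"]) (auto simp: lookup_add ring_distribs sum.distrib)

lemma ip_add_right: "ip h (f + g) = ip h f + ip h g"
  by (simp add: ip_def lookup_add ring_distribs sum.distrib)

lemma ip_scale_left: "ip (const c * f) h = c * ip f h"
  by (subst (1 2) ip_superset[of "monoms h"]) (auto simp: sum_distrib_left mult.left_commute[of c] mult.assoc)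

lemma ip_scale_right: "ip h (const c * f) = cnj c * ip h f"
  by (simp add: ip_def sum_distrib_left mult.left_commute[of "cnj c"])

lemma ip_0 [simp]: "ip 0 f = 0" "ip f 0 = 0"
  by (simp_all add: ip_def)

lemma ip_sum_left: "ip (sum f A) h = (\<Sum>x\<in>A. ip (f x) h)"
  by (induction A rule: infinite_finite_induct) (auto simp: ip_add_left)

lemma ip_sum_right: "ip h (sum f A) = (\<Sum>x\<in>A. ip h (f x))"
  by (induction A rule: infinite_finite_induct) (auto simp: ip_add_right)

lemma ip_uminus_left: "ip (- f) h = - ip f h"
  using ip_add_left[of f "- f" h] by (simp add: eq_neg_iff_add_eq_0 add.commute)

lemma ip_uminus_right: "ip h (- f) = - ip h f"
  using ip_add_right[of h f "- f"] by (simp add: eq_neg_iff_add_eq_0 add.commute)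

lemma ip_diff_left: "ip (f - g) h = ip f h - ip g h"
  using ip_add_left[of f "- g" h] by (simp add: ip_uminus_left)

lemma ip_diff_right: "ip h (f - g) = ip h f - ip h g"
  using ip_add_right[of h f "- g"] by (simp add: ip_uminus_right)

lemma ip_self: "ip f f = of_real (\<Sum>m\<in>monoms f. real (exp_fact m) * (cmod (lk f m))\<^sup>2)"
  by (simp add: ip_def mult.assoc flip: complex_norm_square)

lemma ip_self_ge_0: "Re (ip f f) \<ge> 0"
  by (simp add: ip_self sum_nonneg)

lemma ip_self_eq_0: 
  assumes "Re (ip f f) = 0"
  shows "f = 0"
proof -
  have "\<forall>m\<in>monoms f. real (exp_fact m) * (cmod (lk f m))\<^sup>2 = 0"
    using assms unfolding ip_self by (subst sum_nonneg_eq_0_iff[symmetric]) auto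
  then have "lk f m = 0" for m
    using exp_fact_pos[of m] by (cases "m \<in> monoms f") (auto simp: in_keys_iff)
  then show ?thesis by (simp add: poly_mapping_eqI)
qed

lemma var_adjoint_pdiff: "ip (var v * f) g = ip f (pdiff v g)"
proof -
  let ?K = "(\<lambda>m. m + unit_exp v) ` monoms f"
  have "monoms (var v * f) \<subseteq> ?K"
    using keys_mult[of "var v" f] by (auto simp: var_def add.commute)
  then have "ip (var v * f) g = (\<Sum>m\<in>?K. of_nat (exp_fact m) * lk (var v * f) m * cnj (lk g m))"
    by (intro ip_superset) auto
  also have "\<dots> = (\<Sum>m\<in>monoms f. of_nat (exp_fact (m + unit_exp v)) * lk (var v * f) (m + unit_exp v)
                     * cnj (lk g (m + unit_exp v)))"
    by (subst sum.reindex) (auto simp: inj_on_def)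
  also have "\<dots> = ip f (pdiff v g)"
    unfolding ip_def
    by (intro sum.cong refl, simp only: lookup_var_mult lookup_pdiff exp_fact_add_unit)
       (simp add: lookup_add mult_ac)
  finally show ?thesis .
qed

lemma pdiff_adjoint_var: "ip (pdiff v f) g = ip f (var v * g)"
  by (subst (1 2) ip_cnj) (simp add: var_adjoint_pdiff)

text \<open>
  Moving one factor to the other side leaves an inner product of second derivatives and a commutator.
  In the first term the four variables can be regrouped, because derivatives commute; all
  comparisons of norms below come from this symmetry.
\<close>

lemma ip_var_pdiff:
  "ip (var u * pdiff v f) (var x * pdiff y g) =
     ip (pdiff x (pdiff v f)) (pdiff u (pdiff y g)) + (if x = u then ip (pdiff v f) (pdiff y g) else 0)"
proof -
  have "ip (var u * pdiff v f) (var x * pdiff y g) = ip (pdiff x (var u * pdiff v f)) (pdiff y g)"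
    by (simp add: pdiff_adjoint_var)
  then show ?thesis
    by (auto simp: pdiff_var_mult ip_add_left var_adjoint_pdiff)
qed

subsection \<open>Orthogonal projection\<close>

interpretation fp: vector_space "\<lambda>c (f::fpoly). const c * f"
  by unfold_locales (auto simp: ring_distribs const_mult_const simp flip: const_hom(3))

lemma ip_span_eq_0:
  assumes "\<And>h. h \<in> B \<Longrightarrow> ip g h = 0" "k \<in> fp.span B"
  shows "ip g k = 0"
  using assms(2) by (induction rule: fp.span_induct_alt) (auto simp: assms(1) ip_add_right ip_scale_right)

text \<open>
  Gram-Schmidt: a new vector is first made orthogonal to the old span, then its component is removed.
\<close>

lemma orthogonal_projection:
  assumes "finite B"
  shows "\<exists>g. f - g \<in> fp.span B \<and> (\<forall>h\<in>B. ip g h = 0)"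
  using assms
proof (induction B arbitrary: f)
  case empty
  then show ?case by (intro exI[of _ f]) auto
next
  case (insert b B)
  obtain g where g: "f - g \<in> fp.span B" "\<forall>h\<in>B. ip g h = 0" using insert by blast
  obtain b' where b': "b - b' \<in> fp.span B" "\<forall>h\<in>B. ip b' h = 0" using insert by blast
  have mono: "x \<in> fp.span (insert b B)" if "x \<in> fp.span B" for x
    using that fp.span_mono[of B "insert b B"] by auto
  have b'_in: "b' \<in> fp.span (insert b B)"
    using fp.span_diff[OF fp.span_base[of b "insert b B"] mono[OF b'(1)]] by simp
  define c where "c = ip g b' / ip b' b'"
  define g' where "g' = g - const c * b'"
  have orth_B: "ip g' h = 0" if "h \<in> B" for h
    using that g b' by (simp add: g'_def ip_diff_left ip_scale_left)
  have "ip g' b' = 0"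
  proof (cases "b' = 0")
    case False
    then have "ip b' b' \<noteq> 0" using ip_self_eq_0[of b'] by auto
    then show ?thesis by (simp add: g'_def ip_diff_left ip_scale_left c_def)
  qed auto
  moreover have "ip g' (b - b') = 0" using orth_B b'(1) by (rule ip_span_eq_0)
  ultimately have "ip g' b = 0" by (simp add: ip_diff_right)
  moreover have "f - g' \<in> fp.span (insert b B)"
  proof -
    have "f - g' = (f - g) + const c * b'" by (simp add: g'_def)
    also have "\<dots> \<in> fp.span (insert b B)"
      by (rule fp.span_add[OF mono[OF g(1)] fp.span_scale[OF b'_in]])
    finally show ?thesis .
  qed
  ultimately show ?case using orth_B by (intro exI[of _ g']) auto
qed

section \<open>Polarizations and positivity\<close>

text \<open>
  An infinitesimal row operation: one factor from row \<open>s\<close> is replaced by the factor of row \<open>r\<close> in the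
  same column, with columns restricted to \<open>C\<close>.  On the variables of one type these operators represent
  the matrix units of the general linear Lie algebra of the rows.
\<close>

definition polarize :: "nat set \<Rightarrow> nat \<Rightarrow> nat \<Rightarrow> fpoly \<Rightarrow> fpoly" where
  "polarize C r s f = (\<Sum>k\<in>C. var (Z r k) * pdiff (Z s k) f)"

text \<open>
  Let \<open>w r\<close> be the family of second derivatives \<open>pdiff (Z r k) (pdiff (Z r l) f)\<close>, with \<open>k\<close> in \<open>Mi\<close> and \<open>l\<close>
  in \<open>Pl\<close>, and let \<open>G\<close> be the Gram matrix of these families.  For \<open>r \<noteq> s\<close> its entry is the inner product of the
  two parts of a raising or lowering operator applied to \<open>f\<close>.  For \<open>r < s\<close> the two parts agree, so the
  entry is a squared norm.  By symmetry all entries have nonnegative real part, while harmonicity says that the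
  \<open>w r\<close> add up to zero, so that every row of \<open>G\<close> sums to zero.  Hence all these norms vanish.
\<close>

lemma harmonic_raising_eq_0:
  fixes B Pl Mi :: "nat set"
  assumes fin: "finite B" "finite Pl" "finite Mi"
    and raise: "\<And>r s. r \<in> B \<Longrightarrow> s \<in> B \<Longrightarrow> r < s \<Longrightarrow> polarize Pl r s f = polarize Mi s r f"
    and harm: "\<And>k l. k \<in> Mi \<Longrightarrow> l \<in> Pl \<Longrightarrow> (\<Sum>r\<in>B. pdiff (Z r k) (pdiff (Z r l) f)) = 0"
  shows "\<And>r s. r \<in> B \<Longrightarrow> s \<in> B \<Longrightarrow> r < s \<Longrightarrow> polarize Pl r s f = 0"
    and "\<And>r k l. r \<in> B \<Longrightarrow> k \<in> Mi \<Longrightarrow> l \<in> Pl \<Longrightarrow> pdiff (Z r k) (pdiff (Z r l) f) = 0"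
proof -
  define w where "w r k l = pdiff (Z r k) (pdiff (Z r l) f)" for r k l
  define G where "G r s = (\<Sum>k\<in>Mi. \<Sum>l\<in>Pl. ip (w s k l) (w r k l))" for r s
  have G: "ip (polarize Pl r s f) (polarize Mi s r f) = G r s" if "r \<noteq> s" for r s
  proof -
    have "ip (polarize Pl r s f) (polarize Mi s r f) =
      (\<Sum>k\<in>Mi. \<Sum>l\<in>Pl. ip (var (Z r l) * pdiff (Z s l) f) (var (Z s k) * pdiff (Z r k) f))"
      by (simp add: polarize_def ip_sum_left ip_sum_right)
    also have "\<dots> = G r s"
      unfolding G_def w_def using that
      by (intro sum.cong refl) (auto simp: ip_var_pdiff pdiff_commute[of "Z r _" "Z r _"])
    finally show ?thesis .
  qed
  have G_cnj: "G s r = cnj (G r s)" for r s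
    unfolding G_def cnj_sum by (intro sum.cong refl) (rule ip_cnj)
  have G_less: "Re (G r s) = Re (ip (polarize Pl r s f) (polarize Pl r s f))"
    if "r \<in> B" "s \<in> B" "r < s" for r s
    using G[of r s] raise[OF that] that by simp
  have G_diag: "Re (G r r) = (\<Sum>k\<in>Mi. \<Sum>l\<in>Pl. Re (ip (w r k l) (w r k l)))" for r
    by (simp add: G_def)
  have G_nonneg: "Re (G r s) \<ge> 0" if "r \<in> B" "s \<in> B" for r s
    using that G_less[of r s] G_less[of s r] G_cnj[of r s] G_diag[of r]
    by (cases r s rule: linorder_cases) (auto simp: ip_self_ge_0 sum_nonneg)
  have G_sum: "(\<Sum>s\<in>B. Re (G r s)) = 0" for r
  proof -
    have "(\<Sum>s\<in>B. G r s) = (\<Sum>k\<in>Mi. \<Sum>l\<in>Pl. ip (\<Sum>s\<in>B. w s k l) (w r k l))"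
      unfolding G_def ip_sum_left
      by (rule trans[OF sum.swap], rule sum.cong[OF refl], rule sum.swap)
    also have "\<dots> = 0" using harm by (simp add: w_def)
    finally show ?thesis by (simp flip: Re_sum)
  qed
  have G_0: "Re (G r s) = 0" if "r \<in> B" "s \<in> B" for r s
    using G_sum[of r] G_nonneg that fin by (subst (asm) sum_nonneg_eq_0_iff) auto
  show "polarize Pl r s f = 0" if "r \<in> B" "s \<in> B" "r < s" for r s
    using G_0 G_less that by (intro ip_self_eq_0) auto
  show "pdiff (Z r k) (pdiff (Z r l) f) = 0" if "r \<in> B" "k \<in> Mi" "l \<in> Pl" for r k l
  proof -
    have "(\<Sum>k\<in>Mi. \<Sum>l\<in>Pl. Re (ip (w r k l) (w r k l))) = 0"
      using G_0[OF that(1) that(1)] G_diag[of r] by simp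
    then have "\<forall>k\<in>Mi. (\<Sum>l\<in>Pl. Re (ip (w r k l) (w r k l))) = 0"
      using fin by (subst (asm) sum_nonneg_eq_0_iff) (auto simp: ip_self_ge_0 sum_nonneg)
    then have "\<forall>l\<in>Pl. Re (ip (w r k l) (w r k l)) = 0"
      using fin that by (subst sum_nonneg_eq_0_iff[symmetric]) (auto simp: ip_self_ge_0)
    then show ?thesis using that by (intro ip_self_eq_0) (auto simp: w_def)
  qed
qed

lemma lookup_euler: "lk (var v * pdiff v f) m = of_nat (lk m v) * lk f m"
proof (cases "lk m v = 0")
  case False
  have "m - unit_exp v + unit_exp v = m" using False by (rule unit_exp_cancel)
  moreover have "lk (m - unit_exp v) v + 1 = lk m v"
    using False by (simp add: lookup_minus)
  ultimately show ?thesis using False by (simp only: lookup_var_mult lookup_pdiff if_False)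
qed (simp add: lookup_var_mult)

text \<open>
  Euler's identity for polynomials that are homogeneous in the variables \<open>A\<close>.
\<close>

lemma euler_sum:
  assumes "\<And>m. m \<in> monoms f \<Longrightarrow> (\<Sum>v\<in>A. lk m v) = d"
  shows "(\<Sum>v\<in>A. var v * pdiff v f) = const (of_nat d) * f"
proof (rule poly_mapping_eqI)
  fix m
  have "lk (\<Sum>v\<in>A. var v * pdiff v f) m = of_nat (\<Sum>v\<in>A. lk m v) * lk f m"
    by (simp add: lookup_sum lookup_euler sum_distrib_right)
  also have "\<dots> = lk (const (of_nat d) * f) m"
    using assms[of m] by (cases "m \<in> monoms f") (auto simp: in_keys_iff)
  finally show "lk (\<Sum>v\<in>A. var v * pdiff v f) m = lk (const (of_nat d) * f) m" .
qed

text \<open>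
  Let \<open>R r s\<close> and \<open>C j k\<close> be the row and column polarizations of \<open>f\<close> in a square block of variables.
  By the symmetry of second derivatives the sums of the squared norms of all \<open>R r s\<close> and of all
  \<open>C j k\<close> agree (a Casimir element of the rows equals one of the columns).  The row data determine
  the first sum: \<open>R r s\<close> is \<open>q f\<close> on the diagonal and zero elsewhere, also for \<open>r > s\<close>, because the
  squared norms of \<open>R r s\<close> and \<open>R s r\<close> differ by a multiple of the difference of two row degrees.
  Expanding the sum of the squared norms of \<open>C j k - \<delta>\<^sub>j\<^sub>k q f\<close>, with the trace known from the total
  degree, gives zero.
\<close>

lemma square_column_sums:
  fixes V :: "nat \<Rightarrow> nat \<Rightarrow> fvar" and n q :: nat
  assumes inj: "\<And>r k r' k'. r < n \<Longrightarrow> k < n \<Longrightarrow> r' < n \<Longrightarrow> k' < n \<Longrightarrow> V r k = V r' k' \<Longrightarrow> r = r' \<and> k = k'"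
    and raise: "\<And>r s. r < s \<Longrightarrow> s < n \<Longrightarrow> (\<Sum>k<n. var (V r k) * pdiff (V s k) f) = 0"
    and rows: "\<And>m r. m \<in> monoms f \<Longrightarrow> r < n \<Longrightarrow> (\<Sum>k<n. lk m (V r k)) = q"
    and m: "m \<in> monoms f" and k: "k < n"
  shows "(\<Sum>r<n. lk m (V r k)) = q"
proof -
  define R where "R r s = (\<Sum>k<n. var (V r k) * pdiff (V s k) f)" for r s
  define C where "C j k = (\<Sum>r<n. var (V r j) * pdiff (V r k) f)" for j k
  define S where "S r s j k = ip (pdiff (V r k) (pdiff (V s j) f)) (pdiff (V r j) (pdiff (V s k) f))" for r s j k
  define D where "D s k = ip (pdiff (V s k) f) (pdiff (V s k) f)" for s k
  define F where "F = ip f f"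
  have RR: "ip (R r s) (R r s) = (\<Sum>j<n. \<Sum>k<n. S r s j k) + (\<Sum>j<n. D s j)" if "r < n" "s < n" for r s
  proof -
    have "ip (R r s) (R r s) =
      (\<Sum>j<n. \<Sum>k<n. ip (var (V r j) * pdiff (V s j) f) (var (V r k) * pdiff (V s k) f))"
      by (simp add: R_def ip_sum_left ip_sum_right) (rule sum.swap)
    also have "\<dots> = (\<Sum>j<n. \<Sum>k<n. S r s j k + (if k = j then D s j else 0))"
      using that inj by (intro sum.cong refl) (auto simp: ip_var_pdiff S_def D_def)
    finally show ?thesis by (simp add: sum.distrib)
  qed
  have CC: "ip (C j k) (C j k) = (\<Sum>r<n. \<Sum>s<n. S r s j k) + (\<Sum>r<n. D r k)" if "j < n" "k < n" for j k
  proof -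
    have "ip (C j k) (C j k) =
      (\<Sum>r<n. \<Sum>s<n. ip (var (V r j) * pdiff (V r k) f) (var (V s j) * pdiff (V s k) f))"
      by (simp add: C_def ip_sum_left ip_sum_right) (rule sum.swap)
    also have "\<dots> = (\<Sum>r<n. \<Sum>s<n. S r s j k + (if s = r then D r k else 0))"
      using that inj
      by (intro sum.cong refl) (auto simp: ip_var_pdiff S_def D_def pdiff_commute[of "V _ j" "V _ k"])
    finally show ?thesis by (simp add: sum.distrib)
  qed
  have D_row: "(\<Sum>j<n. D s j) = of_nat q * F" and R_diag: "R s s = const (of_nat q) * f" if "s < n" for s
  proof -
    have i: "inj_on (V s) {..<n}" using inj that by (auto simp: inj_on_def)
    have "R s s = (\<Sum>v\<in>V s ` {..<n}. var v * pdiff v f)"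
      unfolding R_def by (subst sum.reindex[OF i]) simp
    also have "\<dots> = const (of_nat q) * f"
      by (intro euler_sum) (simp add: sum.reindex[OF i] rows that)
    finally show *: "R s s = const (of_nat q) * f" .
    have "(\<Sum>j<n. D s j) = ip (R s s) f"
      by (simp add: D_def R_def ip_sum_left var_adjoint_pdiff)
    then show "(\<Sum>j<n. D s j) = of_nat q * F" by (simp add: * ip_scale_left F_def)
  qed
  (* the commutator terms are row degrees, which all equal q, so raising and lowering have the same norm *)
  have R_0: "ip (R r s) (R r s) = 0" if rs: "r < n" "s < n" "r \<noteq> s" for r s
  proof -
    have sym: "ip (R r s) (R r s) = ip (R s r) (R s r)"
    proof -
      have "(\<Sum>j<n. \<Sum>k<n. S r s j k) = (\<Sum>k<n. \<Sum>j<n. S r s j k)" by (rule sum.swap)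
      also have "\<dots> = (\<Sum>j<n. \<Sum>k<n. S s r j k)"
        unfolding S_def by (intro sum.cong refl) (simp add: pdiff_commute[of "V s _" "V r _"])
      finally show ?thesis using rs by (simp add: RR D_row)
    qed
    show ?thesis
      using raise[of r s] raise[of s r] rs sym by (cases r s rule: linorder_cases) (auto simp: R_def)
  qed
  have sum_RR: "(\<Sum>r<n. \<Sum>s<n. ip (R r s) (R r s)) = of_nat (n * q\<^sup>2) * F"
  proof -
    have "(\<Sum>r<n. \<Sum>s<n. ip (R r s) (R r s)) = (\<Sum>r<n. \<Sum>s<n. if s = r then of_nat (q\<^sup>2) * F else 0)"
      by (intro sum.cong refl)
        (auto simp: R_0 R_diag ip_scale_left ip_scale_right F_def power2_eq_square)
    then show ?thesis by (simp add: mult_ac)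
  qed
  have sum_CC: "(\<Sum>j<n. \<Sum>k<n. ip (C j k) (C j k)) = of_nat (n * q\<^sup>2) * F"
  proof -
    have "(\<Sum>r<n. \<Sum>s<n. ip (R r s) (R r s)) =
        (\<Sum>r<n. \<Sum>s<n. \<Sum>j<n. \<Sum>k<n. S r s j k) + of_nat n * (\<Sum>s<n. \<Sum>j<n. D s j)"
      by (simp add: RR sum.distrib)
    moreover have "(\<Sum>j<n. \<Sum>k<n. ip (C j k) (C j k)) =
        (\<Sum>j<n. \<Sum>k<n. \<Sum>r<n. \<Sum>s<n. S r s j k) + of_nat n * (\<Sum>k<n. \<Sum>r<n. D r k)"
      by (simp add: CC sum.distrib)
    moreover have "(\<Sum>k<n. \<Sum>r<n. D r k) = (\<Sum>s<n. \<Sum>j<n. D s j)" by (rule sum.swap)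
    moreover have "(\<Sum>j<n. \<Sum>k<n. \<Sum>r<n. \<Sum>s<n. S r s j k) = (\<Sum>r<n. \<Sum>s<n. \<Sum>j<n. \<Sum>k<n. S r s j k)"
    proof -
      have "(\<Sum>j<n. \<Sum>k<n. \<Sum>r<n. \<Sum>s<n. S r s j k) = (\<Sum>j<n. \<Sum>r<n. \<Sum>k<n. \<Sum>s<n. S r s j k)"
        by (rule sum.cong[OF refl], rule sum.swap)
      also have "\<dots> = (\<Sum>r<n. \<Sum>j<n. \<Sum>k<n. \<Sum>s<n. S r s j k)" by (rule sum.swap)
      also have "\<dots> = (\<Sum>r<n. \<Sum>j<n. \<Sum>s<n. \<Sum>k<n. S r s j k)"
        by (rule sum.cong[OF refl], rule sum.cong[OF refl], rule sum.swap)
      also have "\<dots> = (\<Sum>r<n. \<Sum>s<n. \<Sum>j<n. \<Sum>k<n. S r s j k)"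
        by (rule sum.cong[OF refl], rule sum.swap)
      finally show ?thesis .
    qed
    ultimately show ?thesis using sum_RR by simp
  qed
  have tr: "(\<Sum>j<n. ip (C j j) f) = of_nat (n * q) * F"
  proof -
    have "(\<Sum>j<n. ip (C j j) f) = (\<Sum>j<n. \<Sum>r<n. D r j)"
      by (simp add: C_def D_def ip_sum_left var_adjoint_pdiff)
    also have "\<dots> = (\<Sum>r<n. \<Sum>j<n. D r j)" by (rule sum.swap)
    finally show ?thesis by (simp add: D_row)
  qed
  (* a square block transforms under column operations by the q-th power of the determinant as well *)
  define X where "X j k = C j k - const (of_nat (if j = k then q else 0)) * f" for j k
  have XX: "ip (X j k) (X j k) = ip (C j k) (C j k) +
      (if j = k then - of_nat q * ip (C j j) f - of_nat q * cnj (ip (C j j) f) + of_nat (q\<^sup>2) * F else 0)" for j k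
  proof (cases "j = k")
    case True
    have "ip (X k k) (X k k) = ip (C k k) (C k k) - cnj (of_nat q) * ip (C k k) f
        - of_nat q * (ip f (C k k) - cnj (of_nat q) * ip f f)"
      by (simp only: X_def ip_diff_left ip_diff_right ip_scale_left ip_scale_right if_True
          refl right_diff_distrib) (simp add: mult_ac)
    then show ?thesis
      using True ip_cnj[of f "C k k"] by (simp add: F_def algebra_simps power2_eq_square)
  qed (simp add: X_def)
  have "cnj F = F" unfolding F_def using ip_cnj[of f f] by simp
  then have "(\<Sum>j<n. cnj (ip (C j j) f)) = of_nat (n * q) * F"
    using arg_cong[OF tr, of cnj] by simp
  then have "(\<Sum>j<n. \<Sum>k<n. ip (X j k) (X j k)) = 0"
    using tr by (simp add: XX sum.distrib sum_CC sum_subtractf sum_negf flip: sum_distrib_left)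
       (simp add: algebra_simps power2_eq_square)
  then have "(\<Sum>j<n. \<Sum>k<n. Re (ip (X j k) (X j k))) = 0" by (simp flip: Re_sum)
  then have "\<forall>j<n. (\<Sum>k<n. Re (ip (X j k) (X j k))) = 0"
    by (subst (asm) sum_nonneg_eq_0_iff) (auto simp: ip_self_ge_0 sum_nonneg)
  then have "Re (ip (X k k) (X k k)) = 0"
    using k by (subst (asm) sum_nonneg_eq_0_iff) (auto simp: ip_self_ge_0)
  then have "X k k = 0" by (rule ip_self_eq_0)
  then have "lk (C k k) m = of_nat q * lk f m" by (simp add: X_def)
  moreover have "lk (C k k) m = of_nat (\<Sum>r<n. lk m (V r k)) * lk f m"
    by (simp add: C_def lookup_sum lookup_euler sum_distrib_right)
  ultimately show ?thesis using m by (simp add: in_keys_iff del: of_nat_sum)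
qed

text \<open>
  In the coefficient of \<open>m\<close> with one factor moved from row \<open>s\<close> to row \<open>r\<close> in column \<open>k\<close>, the contribution
  of \<open>m\<close> itself is not zero; so another monomial \<open>m'\<close> must cancel it, moving its factor in another
  column \<open>k'\<close>.
\<close>

lemma polarization_exchange:
  fixes V :: "nat \<Rightarrow> nat \<Rightarrow> fvar"
  assumes inj: "\<And>r k r' k'. r < n \<Longrightarrow> k < n \<Longrightarrow> r' < n \<Longrightarrow> k' < n \<Longrightarrow> V r k = V r' k' \<Longrightarrow> r = r' \<and> k = k'"
    and raise: "(\<Sum>k<n. var (V r k) * pdiff (V s k) f) = 0"
    and rs: "r < n" "s < n" "r \<noteq> s"
    and m: "m \<in> monoms f" and k: "k < n" "lk m (V s k) \<noteq> 0"
  obtains k' m' where "k' < n" "k' \<noteq> k" "lk m (V r k') \<noteq> 0" "m' \<in> monoms f"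
    "m' + unit_exp (V s k) + unit_exp (V r k') = m + unit_exp (V r k) + unit_exp (V s k')"
proof -
  (* the monomial at which the vanishing polarization is evaluated *)
  define m1 where "m1 = m - unit_exp (V s k) + unit_exp (V r k)"
  define t where "t j = lk (var (V r j) * pdiff (V s j) f) m1" for j
  have t: "t j = (if lk m1 (V r j) = 0 then 0
      else of_nat (lk (m1 - unit_exp (V r j)) (V s j) + 1) * lk f (m1 - unit_exp (V r j) + unit_exp (V s j)))" for j
    by (simp only: t_def lookup_var_mult lookup_pdiff)
  have sum_t: "(\<Sum>j<n. t j) = 0"
    using arg_cong[OF raise, of "\<lambda>f. lk f m1"] by (simp add: t_def lookup_sum)
  have m1: "m1 - unit_exp (V r k) + unit_exp (V s k) = m"
    using k by (intro poly_mapping_eqI) (auto simp: m1_def exp_simps)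
  have "lk m1 (V r k) \<noteq> 0" by (simp add: m1_def lookup_add)
  then have "t k \<noteq> 0" using m by (simp only: t m1) (simp add: in_keys_iff del: of_nat_add of_nat_Suc)
  moreover have "(\<Sum>j<n. t j) = t k + (\<Sum>j\<in>{..<n} - {k}. t j)"
    using k by (intro sum.remove) auto
  ultimately have "(\<Sum>j\<in>{..<n} - {k}. t j) \<noteq> 0" using sum_t by auto
  then obtain k' where k': "k' < n" "k' \<noteq> k" "t k' \<noteq> 0"
    by (metis (no_types, lifting) DiffE insertI1 lessThan_iff sum.neutral)
  define m' where "m' = m1 - unit_exp (V r k') + unit_exp (V s k')"
  have 1: "lk m1 (V r k') \<noteq> 0" and 2: "m' \<in> monoms f"
    using k'(3) by (auto simp: t m'_def in_keys_iff split: if_splits)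
  have ne: "V r k' \<noteq> V r k" "V r k' \<noteq> V s k" "V r k \<noteq> V s k"
    using inj[of r k' r k] inj[of r k' s k] inj[of r k s k] k k' rs by auto
  have 3: "lk m (V r k') \<noteq> 0"
    using 1 ne by (auto simp: m1_def lookup_add lookup_minus lookup_single)
  have 4: "m' + unit_exp (V s k) + unit_exp (V r k') = m + unit_exp (V r k) + unit_exp (V s k')"
  proof (rule poly_mapping_eqI)
    fix v
    show "lk (m' + unit_exp (V s k) + unit_exp (V r k')) v = lk (m + unit_exp (V r k) + unit_exp (V s k')) v"
      using 1 3 ne k(2)
      by (cases "v = V s k"; cases "v = V r k'")
         (auto simp: m'_def m1_def exp_simps)
  qed
  show ?thesis using that k' 2 3 4 by blast
qed

text \<open>
  The hypothesis on exchanges is what maximality of \<open>\<Sum>\<^sub>r\<^sub>,\<^sub>k r k m(V r k)\<close> among the monomials of \<open>f\<close> gives.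
  It forces the exchange partner \<open>k'\<close> to lie strictly to the left of \<open>k\<close>, and following the partners through
  the rows shows that \<open>m\<close> is supported on columns \<open>k \<ge> r\<close>.  As row and column sums are all \<open>q\<close>, the
  sum of \<open>(k - r) m(V r k)\<close> is zero, so \<open>m\<close> is diagonal.
\<close>

lemma extremal_monomial_diagonal:
  fixes V :: "nat \<Rightarrow> nat \<Rightarrow> fvar" and n q :: nat
  assumes inj: "\<And>r k r' k'. r < n \<Longrightarrow> k < n \<Longrightarrow> r' < n \<Longrightarrow> k' < n \<Longrightarrow> V r k = V r' k' \<Longrightarrow> r = r' \<and> k = k'"
    and raise: "\<And>r s. r < s \<Longrightarrow> s < n \<Longrightarrow> (\<Sum>k<n. var (V r k) * pdiff (V s k) f) = 0"
    and rows: "\<And>m r. m \<in> monoms f \<Longrightarrow> r < n \<Longrightarrow> (\<Sum>k<n. lk m (V r k)) = q"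
    and m: "m \<in> monoms f"
    and extremal: "\<And>m' r s k k'. m' \<in> monoms f \<Longrightarrow> r < n \<Longrightarrow> s < n \<Longrightarrow> k < n \<Longrightarrow> k' < n \<Longrightarrow>
        m' + unit_exp (V s k) + unit_exp (V r k') = m + unit_exp (V r k) + unit_exp (V s k') \<Longrightarrow>
        r * k + s * k' \<le> s * k + r * k'"
    and rk: "r < n" "k < n"
  shows "lk m (V r k) = (if r = k then q else 0)"
proof -
  have step: "\<exists>k'<k. lk m (V r k') \<noteq> 0" if rs: "r < s" "s < n" and k: "k < n" "lk m (V s k) \<noteq> 0" for r s k
  proof -
    have r: "r < n" "r \<noteq> s" using rs by auto
    obtain k' m' where *: "k' < n" "k' \<noteq> k" "lk m (V r k') \<noteq> 0" "m' \<in> monoms f"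
      "m' + unit_exp (V s k) + unit_exp (V r k') = m + unit_exp (V r k) + unit_exp (V s k')"
      by (rule polarization_exchange[of n V r s f m k]) (use inj raise[OF rs] rs r m k in blast)+
    have le: "r * k + s * k' \<le> s * k + r * k'"
      using extremal[OF *(4) r(1) rs(2) k(1) *(1) *(5)] .
    have "k' \<le> k"
    proof (rule ccontr)
      assume "\<not> k' \<le> k"
      then obtain d where d: "k' = k + d" "d > 0" by (metis less_imp_add_positive not_le)
      with le rs show False by (simp add: ring_distribs)
    qed
    with * show ?thesis by (intro exI[of _ k']) auto
  qed
  have tri: "s \<le> k" if "s < n" "k < n" "lk m (V s k) \<noteq> 0" for s k
    using that
  proof (induction s arbitrary: k)
    case (Suc s)
    from step[of s "Suc s" k] Suc.prems obtain k' where "k' < k" "lk m (V s k') \<noteq> 0" by auto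
    with Suc.IH[of k'] Suc.prems show ?case by simp
  qed simp
  have "(\<Sum>s<n. \<Sum>k<n. k * lk m (V s k)) = (\<Sum>k<n. \<Sum>s<n. k * lk m (V s k))" by (rule sum.swap)
  also have "\<dots> = (\<Sum>k<n. k * q)"
    using square_column_sums[OF inj raise rows m] by (simp flip: sum_distrib_left)
  also have "\<dots> = (\<Sum>s<n. \<Sum>k<n. s * lk m (V s k))"
    using rows[OF m] by (simp flip: sum_distrib_left)
  finally have eq: "(\<Sum>s<n. \<Sum>k<n. s * lk m (V s k)) = (\<Sum>s<n. \<Sum>k<n. k * lk m (V s k))" ..
  have le: "s * lk m (V s k) \<le> k * lk m (V s k)" if "s < n" "k < n" for s k
    using tri[OF that] by (cases "lk m (V s k) = 0") auto
  have off: "lk m (V s k) = 0" if "s < n" "k < n" "s \<noteq> k" for s k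
  proof (rule ccontr)
    assume nz: "lk m (V s k) \<noteq> 0"
    then have "s * lk m (V s k) < k * lk m (V s k)" using tri[OF that(1,2)] that by auto
    then have "(\<Sum>k<n. s * lk m (V s k)) < (\<Sum>k<n. k * lk m (V s k))"
      using that le by (intro sum_strict_mono_ex1) auto
    then have "(\<Sum>s<n. \<Sum>k<n. s * lk m (V s k)) < (\<Sum>s<n. \<Sum>k<n. k * lk m (V s k))"
      using that le by (intro sum_strict_mono_ex1) (auto intro: sum_mono)
    with eq show False by simp
  qed
  have "(\<Sum>j<n. lk m (V r j)) = (\<Sum>j<n. if j = r then lk m (V r r) else 0)"
    using off[OF rk(1)] by (intro sum.cong) auto
  then have "lk m (V r r) = q" using rows[OF m rk(1)] rk by simp
  then show ?thesis using off[OF rk] by auto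
qed

section \<open>The actions on the Fock space\<close>

lemma adjoint_entry:
  fixes A :: "complex mat"
  assumes "A \<in> carrier_mat n n" "i < n" "j < n"
  shows "mat_adjoint A $$ (i, j) = cnj (A $$ (j, i))"
  using assms by (auto simp: mat_adjoint_def mat_of_rows_index)

lemma adjoint_carrier:
  fixes A :: "complex mat"
  assumes "A \<in> carrier_mat n n"
  shows "mat_adjoint A \<in> carrier_mat n n"
  using assms by (auto simp: mat_adjoint_def)

lemma unitary_group_rows:
  assumes "A \<in> unitary_group n" "i < n" "j < n"
  shows "(\<Sum>k<n. A $$ (i, k) * cnj (A $$ (j, k))) = (if i = j then 1 else 0)"
proof -
  have A: "A \<in> carrier_mat n n" "A * mat_adjoint A = 1\<^sub>m n" using assms by (auto simp: unitary_group_def)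
  have "(A * mat_adjoint A) $$ (i, j) = (\<Sum>k<n. A $$ (i, k) * cnj (A $$ (j, k)))"
    using A(1) assms(2,3) adjoint_carrier[OF A(1)]
    by (auto simp: scalar_prod_def adjoint_entry atLeast0LessThan intro!: sum.cong)
  then show ?thesis using assms(2,3) by (simp add: A(2))
qed

lemma unitary_group_columns:
  assumes "A \<in> unitary_group n" "i < n" "j < n"
  shows "(\<Sum>k<n. A $$ (k, i) * cnj (A $$ (k, j))) = (if i = j then 1 else 0)"
proof -
  have A: "A \<in> carrier_mat n n" "A * mat_adjoint A = 1\<^sub>m n" using assms by (auto simp: unitary_group_def)
  have A': "mat_adjoint A * A = 1\<^sub>m n"
    by (rule mat_mult_left_right_inverse[OF A(1) adjoint_carrier[OF A(1)] A(2)])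
  have "(mat_adjoint A * A) $$ (j, i) = (\<Sum>k<n. A $$ (k, i) * cnj (A $$ (k, j)))"
    using A(1) assms(2,3) adjoint_carrier[OF A(1)]
    by (auto simp: scalar_prod_def adjoint_entry atLeast0LessThan mult.commute intro!: sum.cong)
  then show ?thesis using assms(2,3) by (auto simp add: A')
qed

lemma unitary_group_of_rows:
  assumes "A \<in> carrier_mat n n"
    and "\<And>i j. i < n \<Longrightarrow> j < n \<Longrightarrow> (\<Sum>k<n. A $$ (i, k) * cnj (A $$ (j, k))) = (if i = j then 1 else 0)"
  shows "A \<in> unitary_group n"
proof -
  have "A * mat_adjoint A = 1\<^sub>m n"
  proof (rule eq_matI)
    fix i j assume ij: "i < dim_row (1\<^sub>m n :: complex mat)" "j < dim_col (1\<^sub>m n :: complex mat)"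
    then have "(A * mat_adjoint A) $$ (i, j) = (\<Sum>k<n. A $$ (i, k) * cnj (A $$ (j, k)))"
      using assms(1) adjoint_carrier[OF assms(1)]
      by (auto simp: scalar_prod_def adjoint_entry atLeast0LessThan intro!: sum.cong)
    then show "(A * mat_adjoint A) $$ (i, j) = 1\<^sub>m n $$ (i, j)" using ij assms(2) by simp
  qed (use assms(1) adjoint_carrier[OF assms(1)] in auto)
  then show ?thesis using assms(1) by (simp add: unitary_group_def)
qed

lemma K_group_iff: "k \<in> K_group p q \<longleftrightarrow> fst k \<in> unitary_group p \<and> snd k \<in> unitary_group q"
  by (cases k) (auto simp: K_group_def)

lemma K_group_carrier:
  assumes "k \<in> K_group p q"
  shows "fst k \<in> carrier_mat p p" "snd k \<in> carrier_mat q q"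
  using assms by (auto simp: K_group_iff unitary_group_def)

lemma block_carrier:
  assumes "k \<in> K_group p q"
  shows "block k \<in> carrier_mat (p + q) (p + q)"
  using K_group_carrier[OF assms] by (cases k) (auto simp: block_def)

lemma block_entry:
  assumes "fst k \<in> carrier_mat p p" "snd k \<in> carrier_mat q q" "s < p + q" "r < p + q"
  shows "block k $$ (s, r) =
    (if s < p \<and> r < p then fst k $$ (s, r) else if \<not> s < p \<and> \<not> r < p then snd k $$ (s - p, r - p) else 0)"
  using assms by (cases k) (auto simp: block_def)

lemma sum_rows_split:
  fixes F :: "nat \<Rightarrow> 'a::comm_monoid_add"
  shows "(\<Sum>s<p+q. F s) = (\<Sum>s<p. F s) + (\<Sum>s<q. F (p + s))"
proof -
  have "(\<Sum>s<p+q. F s) = (\<Sum>s<p. F s) + (\<Sum>s\<in>{p..<p+q}. F s)"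
    by (subst sum.union_disjoint[symmetric]) (auto intro!: sum.cong)
  also have "(\<Sum>s\<in>{p..<p+q}. F s) = (\<Sum>s<q. F (p + s))"
    by (rule sum.reindex_bij_witness[of _ "\<lambda>s. p + s" "\<lambda>s. s - p"]) auto
  finally show ?thesis .
qed

lemma block_rows:
  assumes k: "k \<in> K_group p q" and "s < p + q" "t < p + q"
  shows "(\<Sum>r<p+q. block k $$ (s, r) * cnj (block k $$ (t, r))) = (if s = t then 1 else 0)"
  using assms unitary_group_rows[of "fst k" p s t] unitary_group_rows[of "snd k" q "s - p" "t - p"]
  by (cases "s < p"; cases "t < p")
     (auto simp: sum_rows_split block_entry[OF K_group_carrier[OF k]] K_group_iff cong: sum.cong_simp)

lemma block_columns:
  assumes k: "k \<in> K_group p q" and "s < p + q" "t < p + q"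
  shows "(\<Sum>r<p+q. block k $$ (r, s) * cnj (block k $$ (r, t))) = (if s = t then 1 else 0)"
  using assms unitary_group_columns[of "fst k" p s t] unitary_group_columns[of "snd k" q "s - p" "t - p"]
  by (cases "s < p"; cases "t < p")
     (auto simp: sum_rows_split block_entry[OF K_group_carrier[OF k]] K_group_iff cong: sum.cong_simp)

lemma block_off_diagonal:
  assumes "k \<in> K_group p q" "s < p + q" "r < p + q" "(s < p) \<noteq> (r < p)"
  shows "block k $$ (s, r) = 0"
  using assms by (auto simp: block_entry[OF K_group_carrier[OF assms(1)]])

definition fvars :: "nat \<Rightarrow> nat \<Rightarrow> nat \<Rightarrow> nat \<Rightarrow> fvar set" where
  "fvars p q a b = {Z r k | r k. r < p + q \<and> k < a + b}"

lemma fock_eq: "fock p q a b = polys_in (fvars p q a b)"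
  by (simp add: fock_def polys_in_def fvars_def)

lemma Z_in_fvars [simp]: "Z r k \<in> fvars p q a b \<longleftrightarrow> r < p + q \<and> k < a + b"
  by (auto simp: fvars_def)

lemma fvars_image: "fvars p q a b = (\<lambda>(r, k). Z r k) ` ({..<p+q} \<times> {..<a+b})"
  by (auto simp: fvars_def)

lemma finite_fvars [simp]: "finite (fvars p q a b)"
  by (simp add: fvars_image)

lemma sum_fvars: "(\<Sum>v\<in>fvars p q a b. F v) = (\<Sum>r<p+q. \<Sum>k<a+b. F (Z r k))"
  unfolding fvars_image by (subst sum.reindex) (auto simp: inj_on_def sum.cartesian_product intro!: sum.cong)

text \<open>
  The coefficient of \<open>Z s l\<close> in the transform of \<open>Z r l\<close>.
\<close>

definition coord_coeff :: "nat \<Rightarrow> nat \<Rightarrow> complex mat \<times> complex mat \<Rightarrow> nat \<Rightarrow> nat \<Rightarrow> nat \<Rightarrow> complex" where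
  "coord_coeff p a k l s r = (if same_sign p a r l then cnj (block k $$ (s, r)) else block k $$ (s, r))"

lemma coord_act_Z:
  "coord_act p q a k (Z r l) = (\<Sum>s<p+q. const (coord_coeff p a k l s r) * var (Z s l))"
  by (simp add: coord_act_def coord_coeff_def)

lemma coord_coeff_orthonormal:
  assumes "k \<in> K_group p q" "r < p + q" "t < p + q"
  shows "(\<Sum>s<p+q. cnj (coord_coeff p a k l s r) * coord_coeff p a k l s t) = (if r = t then 1 else 0)"
proof (cases "(r < p) = (t < p)")
  case True
  then have "same_sign p a r l = same_sign p a t l" by (simp add: same_sign_def)
  then show ?thesis
    using block_columns[OF assms] block_columns[OF assms(1,3,2)]
    by (auto simp: coord_coeff_def mult.commute)
next
  case False
  then have "cnj (coord_coeff p a k l s r) * coord_coeff p a k l s t = 0" if "s < p + q" for s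
    using block_off_diagonal[OF assms(1) that assms(2)] block_off_diagonal[OF assms(1) that assms(3)]
    by (cases "s < p") (auto simp: coord_coeff_def)
  with False show ?thesis by (auto intro!: sum.neutral)
qed

text \<open>
  The chain rule, solved for the transformed derivative with the help of unitarity.
\<close>

lemma psubst_pdiff:
  assumes k: "k \<in> K_group p q" and f: "f \<in> fock p q a b" and r: "r < p + q"
  shows "psubst (coord_act p q a k) (pdiff (Z r l) f) =
    (\<Sum>s<p+q. const (cnj (coord_coeff p a k l s r)) * pdiff (Z s l) (psubst (coord_act p q a k) f))"
  using f unfolding fock_eq
proof (induction rule: polys_in_induct)
  case (add f g)
  then show ?case by (simp add: pdiff_add psubst_add ring_distribs sum.distrib)
next
  case (var v f)
  obtain t j where v: "v = Z t j" and t: "t < p + q" using var by (auto simp: fvars_def)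
  let ?c = "coord_coeff p a k" and ?\<phi> = "psubst (coord_act p q a k)"
  have \<sigma>: "pdiff (Z s l) (coord_act p q a k v * g) =
      (if l = j \<and> s < p + q then const (?c j s t) * g else 0) + coord_act p q a k v * pdiff (Z s l) g" for s g
  proof -
    have "pdiff (Z s l) (coord_act p q a k v * g) =
        (\<Sum>x<p+q. (if x = s then (if l = j then const (?c j s t) * g else 0) else 0)
          + const (?c j x t) * (var (Z x j) * pdiff (Z s l) g))"
      unfolding v coord_act_Z sum_distrib_right pdiff_sum mult.assoc pdiff_scale pdiff_var_mult
      by (intro sum.cong) (auto simp: ring_distribs)
    then show ?thesis by (simp add: sum.distrib v coord_act_Z sum_distrib_right mult.assoc)
  qed
  have "(\<Sum>s<p+q. const (cnj (?c l s r)) * pdiff (Z s l) (?\<phi> (var v * f))) =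
      (\<Sum>s<p+q. const (cnj (?c l s r)) * ((if l = j then const (?c j s t) * ?\<phi> f else 0)
        + coord_act p q a k v * pdiff (Z s l) (?\<phi> f)))"
    by (intro sum.cong) (auto simp: psubst_var_mult \<sigma>)
  also have "\<dots> = (if l = j then const (\<Sum>s<p+q. cnj (?c l s r) * ?c l s t) * ?\<phi> f else 0)
      + coord_act p q a k v * ?\<phi> (pdiff (Z r l) f)"
    by (simp add: var.IH const_sum ring_distribs sum.distrib sum_distrib_left sum_distrib_right
        const_mult_const mult.left_commute[of _ "coord_act p q a k v"])
  also have "\<dots> = ?\<phi> (pdiff (Z r l) (var v * f))"
    by (auto simp: coord_coeff_orthonormal[OF k r t] pdiff_var_mult psubst_add psubst_var_mult v)
  finally show ?case ..
qed simp

text \<open>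
  Whether \<open>heis p a r l\<close> differentiates or multiplies, it transforms by the matrix of the group element;
  the entries between the two row blocks are zero, so the type is constant along the sum.
\<close>

lemma psubst_heis:
  assumes k: "k \<in> K_group p q" and f: "f \<in> fock p q a b" and r: "r < p + q"
  shows "psubst (coord_act p q a k) (heis p a r l f) =
    (\<Sum>s<p+q. const (block k $$ (s, r)) * heis p a s l (psubst (coord_act p q a k) f))"
proof -
  have 1: "const (block k $$ (s, r)) * heis p a s l g =
      const (block k $$ (s, r)) * (if same_sign p a r l then pdiff (Z s l) g else var (Z s l) * g)"
    if "s < p + q" for s g
    using block_off_diagonal[OF k that r] by (auto simp: heis_def same_sign_def)
  have 2: "psubst (coord_act p q a k) (heis p a r l f) =
    (\<Sum>s<p+q. const (block k $$ (s, r)) * (if same_sign p a r l then pdiff (Z s l) (psubst (coord_act p q a k) f)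
       else var (Z s l) * psubst (coord_act p q a k) f))"
    using psubst_pdiff[OF k f r, of l]
    by (auto simp: heis_def psubst_var_mult coord_act_Z coord_coeff_def sum_distrib_right mult.assoc)
  show ?thesis unfolding 2 by (rule sum.cong[OF refl], rule 1[symmetric]) simp
qed

lemma psubst_heis_dual:
  assumes k: "k \<in> K_group p q" and f: "f \<in> fock p q a b" and r: "r < p + q"
  shows "psubst (coord_act p q a k) (heis_dual p a r l f) =
    (\<Sum>s<p+q. const (cnj (block k $$ (s, r))) * heis_dual p a s l (psubst (coord_act p q a k) f))"
proof -
  have 1: "const (cnj (block k $$ (s, r))) * heis_dual p a s l g =
      const (cnj (block k $$ (s, r))) * (if same_sign p a r l then var (Z s l) * g else - pdiff (Z s l) g)"
    if "s < p + q" for s g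
    using block_off_diagonal[OF k that r] by (auto simp: heis_dual_def same_sign_def)
  have 2: "psubst (coord_act p q a k) (heis_dual p a r l f) =
    (\<Sum>s<p+q. const (cnj (block k $$ (s, r))) * (if same_sign p a r l then var (Z s l) * psubst (coord_act p q a k) f
       else - pdiff (Z s l) (psubst (coord_act p q a k) f)))"
    using psubst_pdiff[OF k f r, of l]
    by (auto simp: heis_dual_def psubst_var_mult psubst_uminus coord_act_Z coord_coeff_def sum_distrib_right
        mult.assoc sum_negf)
  show ?thesis unfolding 2 by (rule sum.cong[OF refl], rule 1[symmetric]) simp
qed

lemma heis_add: "heis p a r l (f + g) = heis p a r l f + heis p a r l g"
  and heis_scale: "heis p a r l (const c * f) = const c * heis p a r l f"
  and heis_dual_add: "heis_dual p a r l (f + g) = heis_dual p a r l f + heis_dual p a r l g"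
  and heis_dual_scale: "heis_dual p a r l (const c * f) = const c * heis_dual p a r l f"
  by (simp_all add: heis_def heis_dual_def pdiff_add pdiff_scale ring_distribs mult.left_commute[of "var _" "const c"])

lemma heis_dual_0 [simp]: "heis_dual p a r l 0 = 0"
  by (simp add: heis_dual_def)

lemma heis_dual_sum: "heis_dual p a r l (sum f A) = (\<Sum>x\<in>A. heis_dual p a r l (f x))"
  by (induction A rule: infinite_finite_induct) (auto simp: heis_dual_add)

lemma heis_in_fock:
  assumes "f \<in> fock p q a b" "r < p + q" "l < a + b"
  shows "heis p a r l f \<in> fock p q a b" "heis_dual p a r l f \<in> fock p q a b"
  using assms
  by (auto simp: fock_eq heis_def heis_dual_def polys_in_pdiff polys_in_var_mult polys_in_uminus)

subsection \<open>The quadratic invariants\<close>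

text \<open>
  Summed over the rows of one of the factors of K, pairs of dual Heisenberg operators are invariant:
  for columns of opposite sign these operators are the multiplications by the quadratic invariants and,
  up to sign, the Laplacians.
\<close>

definition quad :: "nat \<Rightarrow> nat \<Rightarrow> nat set \<Rightarrow> nat \<Rightarrow> nat \<Rightarrow> fpoly \<Rightarrow> fpoly" where
  "quad p a B k l f = (\<Sum>r\<in>B. heis_dual p a r k (heis p a r l f))"

definition row_block :: "nat \<Rightarrow> nat \<Rightarrow> nat set \<Rightarrow> bool" where
  "row_block p q B \<longleftrightarrow> B = {..<p} \<or> B = {p..<p+q}"

lemma row_block_subset: "row_block p q B \<Longrightarrow> B \<subseteq> {..<p+q}"
  by (auto simp: row_block_def)

lemma block_partial_rows:
  assumes k: "k \<in> K_group p q" and B: "row_block p q B" and s: "s < p + q" and t: "t < p + q"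
  shows "(\<Sum>r\<in>B. cnj (block k $$ (s, r)) * block k $$ (t, r)) = (if s = t \<and> s \<in> B then 1 else 0)"
proof (cases "s \<in> B")
  case True
  have "(\<Sum>r\<in>B. cnj (block k $$ (s, r)) * block k $$ (t, r)) =
      (\<Sum>r<p+q. block k $$ (t, r) * cnj (block k $$ (s, r)))"
    using True B s block_off_diagonal[OF k s]
    by (intro sum.mono_neutral_cong_left) (auto simp: row_block_def)
  then show ?thesis using block_rows[OF k t s] True by auto
next
  case False
  then have "block k $$ (s, r) = 0" if "r \<in> B" for r
    using that B s block_off_diagonal[OF k s, of r] by (auto simp: row_block_def)
  with False show ?thesis by simp
qed

lemma psubst_quad:
  assumes k: "k \<in> K_group p q" and f: "f \<in> fock p q a b" and B: "row_block p q B"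
    and l: "l < a + b"
  shows "psubst (coord_act p q a k) (quad p a B j l f) = quad p a B j l (psubst (coord_act p q a k) f)"
proof -
  let ?\<phi> = "psubst (coord_act p q a k)"
  let ?g = "\<lambda>s r. block k $$ (s, r)"
  let ?h = "\<lambda>s t. heis_dual p a s j (heis p a t l (?\<phi> f))"
  have "?\<phi> (quad p a B j l f) = (\<Sum>r\<in>B. ?\<phi> (heis_dual p a r j (heis p a r l f)))"
    by (simp add: quad_def psubst_sum)
  also have "\<dots> = (\<Sum>r\<in>B. \<Sum>s<p+q. \<Sum>t<p+q. const (cnj (?g s r) * ?g t r) * ?h s t)"
  proof (intro sum.cong refl)
    fix r assume "r \<in> B"
    then have r: "r < p + q" using row_block_subset[OF B] by auto
    show "?\<phi> (heis_dual p a r j (heis p a r l f)) = (\<Sum>s<p+q. \<Sum>t<p+q. const (cnj (?g s r) * ?g t r) * ?h s t)"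
      by (simp only: psubst_heis_dual[OF k heis_in_fock(1)[OF f r l] r] psubst_heis[OF k f r]
          heis_dual_sum heis_dual_scale sum_distrib_left const_mult_const)
  qed
  also have "\<dots> = (\<Sum>s<p+q. \<Sum>r\<in>B. \<Sum>t<p+q. const (cnj (?g s r) * ?g t r) * ?h s t)"
    by (rule sum.swap)
  also have "\<dots> = (\<Sum>s<p+q. \<Sum>t<p+q. \<Sum>r\<in>B. const (cnj (?g s r) * ?g t r) * ?h s t)"
    by (rule sum.cong[OF refl], rule sum.swap)
  also have "\<dots> = (\<Sum>s<p+q. \<Sum>t<p+q. if t = s then (if s \<in> B then ?h s s else 0) else 0)"
    by (intro sum.cong refl)
       (auto simp: sum_distrib_right[symmetric] const_sum[symmetric] block_partial_rows[OF k B])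
  also have "\<dots> = (\<Sum>s<p+q. if s \<in> B then ?h s s else 0)" by simp
  also have "\<dots> = quad p a B j l (?\<phi> f)"
    unfolding quad_def using row_block_subset[OF B]
    by (intro sum.mono_neutral_cong_right) auto
  finally show ?thesis .
qed

lemma quad_add: "quad p a B k l (f + g) = quad p a B k l f + quad p a B k l g"
  by (simp add: quad_def heis_add heis_dual_add sum.distrib)

lemma quad_scale: "quad p a B k l (const c * f) = const c * quad p a B k l f"
  by (simp add: quad_def heis_scale heis_dual_scale sum_distrib_left)

lemma quad_in_fock:
  assumes "row_block p q B" "k < a + b" "l < a + b" "f \<in> fock p q a b"
  shows "quad p a B k l f \<in> fock p q a b"
proof -
  have "heis_dual p a r k (heis p a r l f) \<in> fock p q a b" if "r \<in> B" for r
    using that row_block_subset[OF assms(1)] assms by (intro heis_in_fock) auto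
  then show ?thesis unfolding quad_def fock_eq by (intro polys_in_sum)
qed

lemma quad_adjoint:
  "ip (quad p a B k l f) g = (if (k < a) = (l < a) then 1 else - 1) * ip f (quad p a B l k g)"
  unfolding quad_def ip_sum_left ip_sum_right sum_distrib_left
  by (intro sum.cong refl)
     (auto simp: heis_def heis_dual_def same_sign_def var_adjoint_pdiff pdiff_adjoint_var
       ip_uminus_left ip_uminus_right pdiff_uminus)

lemma heis_commutator:
  "heis p a r l (heis_dual p a r k f) = heis_dual p a r k (heis p a r l f) + (if k = l then f else 0)"
  by (auto simp: heis_def heis_dual_def pdiff_var_mult pdiff_uminus pdiff_commute[of "Z r l"])

text \<open>
  Normal ordering: the commutators of the symmetrised products are cancelled by the trace term of the
  twist.
\<close>

lemma weil_eq_quad: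
  "weil p q a b Y f =
     - (\<Sum>k<a+b. \<Sum>l<a+b. const (Y $$ (l, k)) * (quad p a {..<p} k l f + quad p a {p..<p+q} k l f))"
proof -
  have split: "(\<Sum>r<p+q. F r) = (\<Sum>r<p. F r) + (\<Sum>r\<in>{p..<p+q}. F r)" for F :: "nat \<Rightarrow> fpoly"
    by (subst sum.union_disjoint[symmetric]) (auto intro!: sum.cong)
  have half: "const (y / 2) * (g + h + g) = const (y / 2) * h + const y * g" for y g h
    by (rule poly_mapping_eqI, simp only: lookup_const_mult lookup_add) (simp add: field_simps)
  have "(\<Sum>r<p+q. \<Sum>k<a+b. \<Sum>l<a+b. const (Y $$ (l, k) / 2) *
            (heis p a r l (heis_dual p a r k f) + heis_dual p a r k (heis p a r l f))) =
        (\<Sum>r<p+q. \<Sum>k<a+b. \<Sum>l<a+b. (if l = k then const (Y $$ (k, k) / 2) * f else 0) +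
            const (Y $$ (l, k)) * heis_dual p a r k (heis p a r l f))"
    unfolding heis_commutator
    by (intro sum.cong refl, simp only: half) simp
  also have "\<dots> = (\<Sum>r<p+q. \<Sum>k<a+b. const (Y $$ (k, k) / 2) * f) +
     (\<Sum>r<p+q. \<Sum>k<a+b. \<Sum>l<a+b. const (Y $$ (l, k)) * heis_dual p a r k (heis p a r l f))"
    by (simp add: sum.distrib)
  also have "(\<Sum>r<p+q. \<Sum>k<a+b. const (Y $$ (k, k) / 2) * f) =
      const (of_nat (p + q) / 2 * (\<Sum>k<a+b. Y $$ (k, k))) * f"
    by (rule poly_mapping_eqI, simp only: lookup_sum lookup_const_mult)
       (simp add: sum_distrib_left sum_distrib_right mult.assoc)
  also have "(\<Sum>r<p+q. \<Sum>k<a+b. \<Sum>l<a+b. const (Y $$ (l, k)) * heis_dual p a r k (heis p a r l f)) =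
      (\<Sum>k<a+b. \<Sum>r<p+q. \<Sum>l<a+b. const (Y $$ (l, k)) * heis_dual p a r k (heis p a r l f))"
    by (rule sum.swap)
  also have "\<dots> = (\<Sum>k<a+b. \<Sum>l<a+b. \<Sum>r<p+q. const (Y $$ (l, k)) * heis_dual p a r k (heis p a r l f))"
    by (rule sum.cong[OF refl], rule sum.swap)
  also have "\<dots> = (\<Sum>k<a+b. \<Sum>l<a+b. const (Y $$ (l, k)) * (quad p a {..<p} k l f + quad p a {p..<p+q} k l f))"
    by (simp only: quad_def split[symmetric] sum_distrib_left[symmetric])
  finally show ?thesis by (simp add: weil_def)
qed

subsection \<open>Equivariant operators\<close>

definition equivariant_op :: "nat \<Rightarrow> nat \<Rightarrow> nat \<Rightarrow> nat \<Rightarrow> (fpoly \<Rightarrow> fpoly) \<Rightarrow> bool" where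
  "equivariant_op p q a b u \<longleftrightarrow>
     (\<forall>f g. u (f + g) = u f + u g) \<and>
     (\<forall>c f. u (const c * f) = const c * u f) \<and>
     (\<forall>f\<in>fock p q a b. u f \<in> fock p q a b) \<and>
     (\<forall>k\<in>K_group p q. \<forall>f\<in>fock p q a b. u (fock_act p q a b k f) = fock_act p q a b k (u f))"

lemma equivariant_quad:
  assumes "row_block p q B" "k < a + b" "l < a + b"
  shows "equivariant_op p q a b (quad p a B k l)"
  using assms
  by (auto simp: equivariant_op_def quad_add quad_scale quad_in_fock fock_act_def psubst_quad)

lemma fock_act_add: "fock_act p q a b k (f + g) = fock_act p q a b k f + fock_act p q a b k g"
  by (simp add: fock_act_def psubst_add ring_distribs)

lemma fock_act_scale: "fock_act p q a b k (const c * f) = const c * fock_act p q a b k f"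
  by (simp add: fock_act_def psubst_mult mult_ac)

lemma equivariant_add:
  "equivariant_op p q a b u \<Longrightarrow> equivariant_op p q a b v \<Longrightarrow> equivariant_op p q a b (\<lambda>f. u f + v f)"
  by (auto simp: equivariant_op_def ring_distribs fock_act_add fock_eq polys_in_add)

lemma equivariant_scale:
  "equivariant_op p q a b u \<Longrightarrow> equivariant_op p q a b (\<lambda>f. const c * u f)"
  by (auto simp: equivariant_op_def ring_distribs fock_act_scale fock_eq polys_in_scale mult_ac)

lemma equivariant_sum:
  assumes "finite A" "\<And>x. x \<in> A \<Longrightarrow> equivariant_op p q a b (u x)"
  shows "equivariant_op p q a b (\<lambda>f. \<Sum>x\<in>A. u x f)"
  using assms
proof (induction A)
  case empty
  show ?case by (simp add: equivariant_op_def fock_eq fock_act_def)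
next
  case (insert x A)
  then show ?case by (simp add: equivariant_add)
qed

lemma equivariant_weil: "equivariant_op p q a b (weil p q a b Y)"
proof -
  have "equivariant_op p q a b (\<lambda>f. const (- 1) * (\<Sum>k<a+b. \<Sum>l<a+b. const (Y $$ (l, k)) *
          (quad p a {..<p} k l f + quad p a {p..<p+q} k l f)))"
    by (intro equivariant_scale equivariant_sum equivariant_add equivariant_quad) (auto simp: row_block_def)
  then show ?thesis
    unfolding weil_eq_quad[abs_def] by (simp flip: const_hom(5))
qed

lemma env_ops_equivariant: "u \<in> env_ops p q a b \<Longrightarrow> equivariant_op p q a b u"
proof (induction rule: env_ops.induct)
  case env_one
  show ?case by (simp add: equivariant_op_def)
next
  case (env_comp u v)
  then show ?case by (simp add: equivariant_op_def)
qed (simp_all add: equivariant_weil equivariant_add equivariant_scale)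

lemma Hom_K_comp:
  assumes "T \<in> Hom_K p q a b X" "equivariant_op p q a b u" "K_submodule p q X"
  shows "restrict (\<lambda>x. u (T x)) X \<in> Hom_K p q a b X"
proof -
  have T: "T x \<in> fock p q a b" if "x \<in> X" for x
    using assms(1) that by (auto simp: Hom_K_def)
  show ?thesis
    using assms T unfolding Hom_K_def K_submodule_def equivariant_op_def by auto
qed

section \<open>Exterior algebra\<close>

text \<open>
  The linear form with given values on the generators, as an element of degree one.
\<close>

definition ext_lin :: "('i \<Rightarrow> 'r::zero) \<Rightarrow> ('i, 'r) ext" where
  "ext_lin L = (\<lambda>S. if is_singleton S then L (the_elem S) else 0)"

text \<open>
  The sign of moving \<open>e\<close> to the front of the increasingly ordered set \<open>S\<close>.
\<close>

definition pos_sign :: "'i::linorder \<Rightarrow> 'i set \<Rightarrow> 'r::comm_ring_1" where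
  "pos_sign e S = (- 1) ^ card {j \<in> S. j < e}"

lemma ext_lin_singleton [simp]: "ext_lin L {e} = L e"
  by (simp add: ext_lin_def)

lemma ext_lin_eqI:
  assumes "\<And>e. x {e} = L e" "\<And>S. \<not> is_singleton S \<Longrightarrow> x S = 0"
  shows "x = ext_lin L"
  using assms by (auto simp: ext_lin_def fun_eq_iff is_singleton_def)

lemma ext_gen_eq_lin: "ext_gen e c = ext_lin (\<lambda>e'. if e' = e then c else 0)"
  by (rule ext_lin_eqI) (auto simp: ext_gen_def is_singleton_def)

lemma pos_sign_square [simp]: "pos_sign e S * pos_sign e S = (1::'r::comm_ring_1)"
  by (simp add: pos_sign_def flip: power_mult_distrib)

lemma pos_sign_insert:
  assumes "finite S" "d \<notin> S"
  shows "pos_sign e (insert d S) = (if d < e then - pos_sign e S else pos_sign e S)"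
proof (cases "d < e")
  case True
  then have "{j \<in> insert d S. j < e} = insert d {j \<in> S. j < e}" by auto
  then show ?thesis using True assms by (simp add: pos_sign_def)
next
  case False
  then have "{j \<in> insert d S. j < e} = {j \<in> S. j < e}" by auto
  then show ?thesis using False by (simp add: pos_sign_def)
qed

lemma pos_sign_remove [simp]: "pos_sign e (S - {e}) = pos_sign e S"
  unfolding pos_sign_def by (rule arg_cong[where f = "\<lambda>A. (- 1) ^ card A"]) auto

lemma pos_sign_swap:
  assumes "finite S" "d \<in> S" "e \<notin> S"
  shows "pos_sign e S * pos_sign d (insert e S) = - (pos_sign d S * pos_sign e (S - {d}) :: 'r::comm_ring_1)"
proof -
  have "insert d (S - {d}) = S" using assms by auto
  then have 1: "(pos_sign e S :: 'r) = (if d < e then - pos_sign e (S - {d}) else pos_sign e (S - {d}))"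
    using pos_sign_insert[of "S - {d}" d e] assms by simp
  have 2: "(pos_sign d (insert e S) :: 'r) = (if e < d then - pos_sign d S else pos_sign d S)"
    using assms by (intro pos_sign_insert) auto
  have "d < e \<longleftrightarrow> \<not> e < d" using assms by (metis not_less_iff_gr_or_eq)
  then show ?thesis unfolding 1 2 by (cases "e < d") (simp_all add: mult.commute)
qed

lemma wedge_lin:
  assumes S: "finite S"
  shows "wedge (ext_lin L) x S = (\<Sum>e\<in>S. pos_sign e S * L e * x (S - {e}))"
proof -
  let ?w = "\<lambda>T. (- 1) ^ card {(i, j). i \<in> T \<and> j \<in> S - T \<and> j < i} * ext_lin L T * x (S - T)"
  have "wedge (ext_lin L) x S = sum ?w ((\<lambda>e. {e}) ` S)"
    unfolding wedge_def using S
    by (intro sum.mono_neutral_right) (auto simp: ext_lin_def is_singleton_def)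
  also have "\<dots> = (\<Sum>e\<in>S. ?w {e})"
    by (subst sum.reindex) (auto simp: inj_on_def)
  also have "\<dots> = (\<Sum>e\<in>S. pos_sign e S * L e * x (S - {e}))"
  proof (intro sum.cong refl)
    fix e assume "e \<in> S"
    have "{(i, j). i \<in> {e} \<and> j \<in> S - {e} \<and> j < i} = Pair e ` {j \<in> S. j < e}" by auto
    then have "card {(i, j). i \<in> {e} \<and> j \<in> S - {e} \<and> j < i} = card {j \<in> S. j < e}"
      by (simp add: card_image inj_on_def)
    then show "?w {e} = pos_sign e S * L e * x (S - {e})" by (simp only: ext_lin_singleton pos_sign_def)
  qed
  finally show ?thesis .
qed

lemma wedge_list_Cons: "wedge_list (x # xs) = wedge x (wedge_list xs)"
  by (simp add: wedge_list_def)

lemma wedge_list_Nil: "wedge_list [] = ext_one"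
  by (simp add: wedge_list_def)

text \<open>
  Contraction with a linear form: transposed to wedging with it, and an antiderivation.
\<close>

definition contract :: "'i set \<Rightarrow> ('i::linorder \<Rightarrow> 'r::comm_ring_1) \<Rightarrow> ('i, 'r) ext \<Rightarrow> ('i, 'r) ext" where
  "contract G L x = (\<lambda>S. \<Sum>e\<in>G - S. pos_sign e S * L e * x (insert e S))"

definition ext_pairing :: "'i set \<Rightarrow> ('i, 'r::comm_ring_1) ext \<Rightarrow> ('i, 'r) ext \<Rightarrow> 'r" where
  "ext_pairing G x y = (\<Sum>S\<in>Pow G. x S * y S)"

lemma pairing_wedge_lin:
  assumes G: "finite G"
  shows "ext_pairing G (wedge (ext_lin L) x) y = ext_pairing G x (contract G L y)"
proof -
  have fin: "finite S" if "S \<in> Pow G" for S using that G by (auto intro: finite_subset)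
  have "ext_pairing G (wedge (ext_lin L) x) y =
      (\<Sum>S\<in>Pow G. \<Sum>e\<in>S. pos_sign e S * L e * x (S - {e}) * y S)"
    unfolding ext_pairing_def by (intro sum.cong refl) (simp add: wedge_lin fin sum_distrib_right)
  also have "\<dots> = (\<Sum>(S, e)\<in>(SIGMA S:Pow G. S). pos_sign e S * L e * x (S - {e}) * y S)"
    using G fin by (intro sum.Sigma) auto
  also have "\<dots> = (\<Sum>(T, e)\<in>(SIGMA T:Pow G. G - T). x T * (pos_sign e T * L e * y (insert e T)))"
    by (rule sum.reindex_bij_witness[of _ "\<lambda>(T, e). (insert e T, e)" "\<lambda>(S, e). (S - {e}, e)"])
       (auto simp: insert_absorb mult_ac)
  also have "\<dots> = (\<Sum>T\<in>Pow G. \<Sum>e\<in>G - T. x T * (pos_sign e T * L e * y (insert e T)))"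
    using G by (intro sum.Sigma[symmetric]) auto
  also have "\<dots> = ext_pairing G x (contract G L y)"
    by (simp add: ext_pairing_def contract_def sum_distrib_left)
  finally show ?thesis .
qed

text \<open>
  Adding \<open>e\<close> and then removing \<open>d\<close>, or the other way round, differ by a sign if \<open>d \<noteq> e\<close>; the terms
  with \<open>d = e\<close> give the pairing of the two linear forms, over the complement of \<open>S\<close> on one side and
  over \<open>S\<close> on the other.
\<close>

lemma contract_wedge_lin:
  assumes G: "finite G" and S: "S \<subseteq> G"
  shows "contract G L (wedge (ext_lin M) x) S =
     (\<Sum>e\<in>G. L e * M e) * x S - wedge (ext_lin M) (contract G L x) S"
proof -
  have finS: "finite S" using G S by (rule finite_subset[rotated])
  let ?R = "\<Sum>e\<in>G - S. \<Sum>d\<in>S. pos_sign d S * pos_sign e (S - {d}) * L e * M d * x (insert e (S - {d}))"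
  have "contract G L (wedge (ext_lin M) x) S = (\<Sum>e\<in>G - S. L e * M e * x S -
      (\<Sum>d\<in>S. pos_sign d S * pos_sign e (S - {d}) * L e * M d * x (insert e (S - {d}))))"
    unfolding contract_def
  proof (intro sum.cong refl)
    fix e assume e: "e \<in> G - S"
    have "wedge (ext_lin M) x (insert e S) =
        pos_sign e (insert e S) * M e * x S + (\<Sum>d\<in>S. pos_sign d (insert e S) * M d * x (insert e S - {d}))"
      using e finS by (subst wedge_lin) auto
    also have "pos_sign e (insert e S) = (pos_sign e S :: 'b)"
      using e finS by (simp add: pos_sign_insert)
    finally have "pos_sign e S * L e * wedge (ext_lin M) x (insert e S) =
        (pos_sign e S * pos_sign e S) * L e * M e * x S +
        (\<Sum>d\<in>S. (pos_sign e S * pos_sign d (insert e S)) * L e * M d * x (insert e S - {d}))"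
      by (simp add: ring_distribs sum_distrib_left mult_ac del: pos_sign_square)
    also have "(\<Sum>d\<in>S. (pos_sign e S * pos_sign d (insert e S)) * L e * M d * x (insert e S - {d})) =
        (\<Sum>d\<in>S. - (pos_sign d S * pos_sign e (S - {d}) * L e * M d * x (insert e (S - {d}))))"
    proof (intro sum.cong refl)
      fix d assume d: "d \<in> S"
      then have "insert e S - {d} = insert e (S - {d})" using e by auto
      then show "(pos_sign e S * pos_sign d (insert e S)) * L e * M d * x (insert e S - {d}) =
          - (pos_sign d S * pos_sign e (S - {d}) * L e * M d * x (insert e (S - {d})))"
        using pos_sign_swap[OF finS d, of e, where 'r = 'b] e by simp
    qed
    finally show "pos_sign e S * L e * wedge (ext_lin M) x (insert e S) = L e * M e * x S -
      (\<Sum>d\<in>S. pos_sign d S * pos_sign e (S - {d}) * L e * M d * x (insert e (S - {d})))"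
      by (simp add: sum_negf)
  qed
  then have 1: "contract G L (wedge (ext_lin M) x) S = (\<Sum>e\<in>G - S. L e * M e) * x S - ?R"
    by (simp add: sum_subtractf sum_distrib_right)
  have "wedge (ext_lin M) (contract G L x) S = (\<Sum>d\<in>S. L d * M d * x S +
      (\<Sum>e\<in>G - S. pos_sign d S * pos_sign e (S - {d}) * L e * M d * x (insert e (S - {d}))))"
    unfolding wedge_lin[OF finS]
  proof (intro sum.cong refl)
    fix d assume d: "d \<in> S"
    have "G - (S - {d}) = insert d (G - S)" using d S by auto
    then have "contract G L x (S - {d}) = pos_sign d S * L d * x S +
        (\<Sum>e\<in>G - S. pos_sign e (S - {d}) * L e * x (insert e (S - {d})))"
      using d G by (simp add: contract_def insert_absorb)
    then have "pos_sign d S * M d * contract G L x (S - {d}) = (pos_sign d S * pos_sign d S) * L d * M d * x S +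
        (\<Sum>e\<in>G - S. pos_sign d S * pos_sign e (S - {d}) * L e * M d * x (insert e (S - {d})))"
      by (simp add: ring_distribs sum_distrib_left mult_ac del: pos_sign_square)
    then show "pos_sign d S * M d * contract G L x (S - {d}) = L d * M d * x S +
        (\<Sum>e\<in>G - S. pos_sign d S * pos_sign e (S - {d}) * L e * M d * x (insert e (S - {d})))"
      by simp
  qed
  also have "\<dots> = (\<Sum>d\<in>S. L d * M d) * x S + ?R"
    by (simp add: sum.distrib sum_distrib_right) (rule sum.swap)
  finally have 2: "wedge (ext_lin M) (contract G L x) S = (\<Sum>d\<in>S. L d * M d) * x S + ?R" .
  have "(\<Sum>e\<in>G. L e * M e) = (\<Sum>e\<in>G - S. L e * M e) + (\<Sum>e\<in>S. L e * M e)"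
    using G S by (rule sum.subset_diff[rotated])
  then show ?thesis unfolding 1 2 by (simp add: ring_distribs)
qed

definition delete_nth :: "nat \<Rightarrow> 'a list \<Rightarrow> 'a list" where
  "delete_nth j xs = take j xs @ drop (Suc j) xs"

lemma length_delete_nth: "j < length xs \<Longrightarrow> length (delete_nth j xs) = length xs - 1"
  by (simp add: delete_nth_def)

lemma nth_delete_nth:
  "j < length xs \<Longrightarrow> i < length xs - 1 \<Longrightarrow> delete_nth j xs ! i = xs ! (if i < j then i else Suc i)"
  by (auto simp: delete_nth_def nth_append min_def)

lemma contract_wedge_list:
  assumes G: "finite G" and "S \<subseteq> G"
  shows "contract G L (wedge_list (map ext_lin Ms)) S =
    (\<Sum>j<length Ms. (- 1) ^ j * (\<Sum>e\<in>G. L e * (Ms ! j) e) * wedge_list (map ext_lin (delete_nth j Ms)) S)"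
  using assms(2)
proof (induction Ms arbitrary: S)
  case Nil
  then show ?case by (simp add: contract_def wedge_list_Nil ext_one_def)
next
  case (Cons M Ms)
  let ?c = "\<lambda>j. (- 1) ^ j * (\<Sum>e\<in>G. L e * (Ms ! j) e)"
  have finS: "finite S" using G Cons.prems by (rule finite_subset[rotated])
  have "wedge (ext_lin M) (contract G L (wedge_list (map ext_lin Ms))) S =
      (\<Sum>e\<in>S. pos_sign e S * M e * (\<Sum>j<length Ms. ?c j * wedge_list (map ext_lin (delete_nth j Ms)) (S - {e})))"
    unfolding wedge_lin[OF finS] using Cons.prems by (intro sum.cong refl) (subst Cons.IH, auto)
  also have "\<dots> = (\<Sum>e\<in>S. \<Sum>j<length Ms. ?c j * (pos_sign e S * M e * wedge_list (map ext_lin (delete_nth j Ms)) (S - {e})))"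
    by (simp add: sum_distrib_left mult_ac)
  also have "\<dots> = (\<Sum>j<length Ms. \<Sum>e\<in>S. ?c j * (pos_sign e S * M e * wedge_list (map ext_lin (delete_nth j Ms)) (S - {e})))"
    by (rule sum.swap)
  also have "\<dots> = (\<Sum>j<length Ms. ?c j * wedge_list (map ext_lin (delete_nth (Suc j) (M # Ms))) S)"
    by (simp add: delete_nth_def wedge_list_Cons wedge_lin[OF finS] sum_distrib_left)
  finally show ?case
    using contract_wedge_lin[OF G Cons.prems, of L M "wedge_list (map ext_lin Ms)"]
    by (simp add: wedge_list_Cons sum.lessThan_Suc_shift sum_negf del: sum.lessThan_Suc)
       (simp add: delete_nth_def)
qed

text \<open>
  Expanding the first factor by contraction is the Laplace expansion of the determinant along the
  first row.  The pairing therefore depends only on the pairings of the linear forms.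
\<close>

lemma pairing_eq_det:
  assumes G: "finite G"
  shows "length Ls = n \<Longrightarrow> length Ms = n \<Longrightarrow>
    ext_pairing G (wedge_list (map ext_lin Ls)) (wedge_list (map ext_lin Ms)) =
      det (mat n n (\<lambda>(i, j). \<Sum>e\<in>G. (Ls ! i) e * (Ms ! j) e))"
proof (induction Ls arbitrary: n Ms)
  case Nil
  have "(\<Sum>S\<in>Pow G. (ext_one S :: 'b) * ext_one S) = (\<Sum>S\<in>Pow G. if S = {} then 1 else 0)"
    by (intro sum.cong) (auto simp: ext_one_def)
  then show ?case using Nil G by (simp add: wedge_list_Nil ext_pairing_def)
next
  case (Cons L Ls)
  then obtain l where n: "n = Suc l" and l: "length Ls = l" by auto
  let ?A = "mat n n (\<lambda>(i, j). \<Sum>e\<in>G. ((L # Ls) ! i) e * (Ms ! j) e)"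
  have IH: "ext_pairing G (wedge_list (map ext_lin Ls)) (wedge_list (map ext_lin (delete_nth j Ms))) =
      det (mat_delete ?A 0 j)" if "j < n" for j
  proof -
    have "mat_delete ?A 0 j = mat l l (\<lambda>(i, j'). \<Sum>e\<in>G. (Ls ! i) e * (delete_nth j Ms ! j') e)"
      using that Cons.prems n by (intro eq_matI) (auto simp: mat_delete_def nth_delete_nth)
    then show ?thesis using Cons.IH[OF l, of "delete_nth j Ms"] that Cons.prems n
      by (simp add: length_delete_nth)
  qed
  have "ext_pairing G (wedge_list (map ext_lin (L # Ls))) (wedge_list (map ext_lin Ms)) =
      ext_pairing G (wedge_list (map ext_lin Ls)) (contract G L (wedge_list (map ext_lin Ms)))"
    by (simp add: wedge_list_Cons pairing_wedge_lin[OF G])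
  also have "\<dots> = (\<Sum>S\<in>Pow G. \<Sum>j<n. (- 1) ^ j * (\<Sum>e\<in>G. L e * (Ms ! j) e) *
      (wedge_list (map ext_lin Ls) S * wedge_list (map ext_lin (delete_nth j Ms)) S))"
    unfolding ext_pairing_def
    by (intro sum.cong refl) (simp add: contract_wedge_list[OF G] Cons.prems sum_distrib_left mult_ac)
  also have "\<dots> = (\<Sum>j<n. \<Sum>S\<in>Pow G. (- 1) ^ j * (\<Sum>e\<in>G. L e * (Ms ! j) e) *
      (wedge_list (map ext_lin Ls) S * wedge_list (map ext_lin (delete_nth j Ms)) S))"
    by (rule sum.swap)
  also have "\<dots> = (\<Sum>j<n. ?A $$ (0, j) * cofactor ?A 0 j)"
  proof (intro sum.cong refl)
    fix j assume "j \<in> {..<n}"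
    then have j: "j < n" by simp
    have A: "?A $$ (0, j) = (\<Sum>e\<in>G. L e * (Ms ! j) e)" using j by simp
    have "(\<Sum>S\<in>Pow G. (- 1) ^ j * (\<Sum>e\<in>G. L e * (Ms ! j) e) *
        (wedge_list (map ext_lin Ls) S * wedge_list (map ext_lin (delete_nth j Ms)) S)) =
        (- 1) ^ j * (\<Sum>e\<in>G. L e * (Ms ! j) e) * det (mat_delete ?A 0 j)"
      by (simp only: sum_distrib_left[symmetric] ext_pairing_def[symmetric] IH[OF j])
    also have "\<dots> = ?A $$ (0, j) * cofactor ?A 0 j"
      unfolding A cofactor_def by (simp only: add_0 mult_ac)
    finally show "(\<Sum>S\<in>Pow G. (- 1) ^ j * (\<Sum>e\<in>G. L e * (Ms ! j) e) *
        (wedge_list (map ext_lin Ls) S * wedge_list (map ext_lin (delete_nth j Ms)) S)) =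
        ?A $$ (0, j) * cofactor ?A 0 j" .
  qed
  also have "\<dots> = det ?A"
    by (rule laplace_expansion_row[symmetric]) (auto simp: n)
  finally show ?case .
qed

text \<open>
  The unspecified sign is that of sorting the list.
\<close>

lemma wedge_list_gens:
  assumes "distinct es"
  shows "\<exists>s::'r::comm_ring_1. (s = 1 \<or> s = - 1) \<and> (sorted es \<longrightarrow> s = 1) \<and>
    (\<forall>S. finite S \<longrightarrow> wedge_list (map (\<lambda>e. ext_gen e (c e)) es) S =
       (if S = set es then s * (\<Prod>e\<in>set es. c e) else 0))"
  using assms
proof (induction es)
  case Nil
  show ?case by (intro exI[of _ 1]) (auto simp: wedge_list_Nil ext_one_def)
next
  case (Cons e es)
  then obtain s :: 'r where s: "s = 1 \<or> s = - 1" "sorted es \<Longrightarrow> s = 1"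
    and eq: "\<And>S. finite S \<Longrightarrow> wedge_list (map (\<lambda>e. ext_gen e (c e)) es) S =
       (if S = set es then s * (\<Prod>e\<in>set es. c e) else 0)" by auto
  let ?s = "pos_sign e (set (e # es)) * s"
  have pm: "(pos_sign e (set (e # es)) :: 'r) = 1 \<or> (pos_sign e (set (e # es)) :: 'r) = - 1"
    unfolding pos_sign_def by (cases "even (card {j \<in> set (e # es). j < e})") auto
  have "wedge_list (map (\<lambda>e. ext_gen e (c e)) (e # es)) S =
      (if S = set (e # es) then ?s * (\<Prod>e\<in>set (e # es). c e) else 0)" if S: "finite S" for S
  proof -
    let ?t = "\<lambda>d. pos_sign d S * (if d = e then c e else 0) *
        (if S - {d} = set es then s * (\<Prod>e\<in>set es. c e) else 0)"
    have "wedge_list (map (\<lambda>e. ext_gen e (c e)) (e # es)) S = sum ?t S"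
      using S by (simp add: wedge_list_Cons ext_gen_eq_lin[of e] wedge_lin eq cong: if_cong)
    also have "\<dots> = (\<Sum>d\<in>S. if d = e then pos_sign e S * c e *
        (if S - {e} = set es then s * (\<Prod>e\<in>set es. c e) else 0) else 0)"
      by (intro sum.cong) auto
    also have "\<dots> = (if e \<in> S then pos_sign e S * c e *
        (if S - {e} = set es then s * (\<Prod>e\<in>set es. c e) else 0) else 0)"
      using S by simp
    also have "\<dots> = (if S = set (e # es) then ?s * (\<Prod>e\<in>set (e # es). c e) else 0)"
      using Cons.prems by (auto simp: mult_ac)
    finally show ?thesis .
  qed
  moreover have "?s = 1 \<or> ?s = - 1" using pm s by auto
  moreover have "?s = 1" if "sorted (e # es)"
  proof -
    have "{j \<in> set (e # es). j < e} = {}" using that by auto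
    then have "pos_sign e (set (e # es)) = (1 :: 'r)"
      by (simp only: pos_sign_def card.empty power_0)
    then show ?thesis using that s(2) by simp
  qed
  ultimately show ?case by (intro exI[of _ ?s]) blast
qed

lemma wedge_list_sorted_gens:
  assumes "finite S" "finite T"
  shows "wedge_list (map (\<lambda>e. ext_gen e (c e)) (sorted_list_of_set T)) S =
    (if S = T then \<Prod>e\<in>T. c e else (0::'r::comm_ring_1))"
proof -
  obtain s :: 'r where "sorted (sorted_list_of_set T) \<longrightarrow> s = 1"
    "\<forall>S. finite S \<longrightarrow> wedge_list (map (\<lambda>e. ext_gen e (c e)) (sorted_list_of_set T)) S =
       (if S = set (sorted_list_of_set T) then s * (\<Prod>e\<in>set (sorted_list_of_set T). c e) else 0)"
    using wedge_list_gens[of "sorted_list_of_set T" c] by auto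
  then show ?thesis using assms by simp
qed

lemma wedge_list_eq_det:
  assumes S: "finite S" "card S = n" and Ls: "length Ls = n"
  shows "wedge_list (map ext_lin Ls) S =
    det (mat n n (\<lambda>(i, j). (Ls ! i) (sorted_list_of_set S ! j)))"
proof -
  define ss where "ss = sorted_list_of_set S"
  have ss: "length ss = n" "set ss = S" using S by (auto simp: ss_def)
  let ?Ms = "map (\<lambda>e e'. if e' = e then 1 else 0) ss"
  have gens: "wedge_list (map ext_lin ?Ms) T = (if T = S then 1 else (0::'b))" if "finite T" for T
    using wedge_list_sorted_gens[OF that S(1), of "\<lambda>_. 1::'b"]
    by (simp add: ss_def comp_def ext_gen_eq_lin)
  have "wedge_list (map ext_lin Ls) S = (\<Sum>T\<in>Pow S. if T = S then wedge_list (map ext_lin Ls) S else 0)"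
    using S by simp
  also have "\<dots> = ext_pairing S (wedge_list (map ext_lin Ls)) (wedge_list (map ext_lin ?Ms))"
    unfolding ext_pairing_def
  proof (intro sum.cong refl)
    fix T assume "T \<in> Pow S"
    then have T: "finite T" using S by (auto intro: finite_subset)
    show "(if T = S then wedge_list (map ext_lin Ls) S else 0) =
        wedge_list (map ext_lin Ls) T * wedge_list (map ext_lin ?Ms) T"
      by (simp only: gens[OF T]) auto
  qed
  also have "\<dots> = det (mat n n (\<lambda>(i, j). \<Sum>e\<in>S. (Ls ! i) e * (?Ms ! j) e))"
    using pairing_eq_det[OF S(1) Ls, of ?Ms] ss by simp
  also have "mat n n (\<lambda>(i, j). \<Sum>e\<in>S. (Ls ! i) e * (?Ms ! j) e) = mat n n (\<lambda>(i, j). (Ls ! i) (ss ! j))"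
  proof (rule cong_mat)
    fix i j assume "i < n" "j < n"
    then have j: "ss ! j \<in> S" and ev: "?Ms ! j = (\<lambda>e'. if e' = ss ! j then 1 else 0)" using ss by auto
    show "(case (i, j) of (i, j) \<Rightarrow> \<Sum>e\<in>S. (Ls ! i) e * (?Ms ! j) e) =
        (case (i, j) of (i, j) \<Rightarrow> (Ls ! i) (ss ! j))"
      unfolding prod.case ev using S(1) j by (simp add: if_distrib[of "\<lambda>x. _ * x"] cong: if_cong)
  qed simp_all
  finally show ?thesis by (simp add: ss_def)
qed

lemma wedge_list_hom:
  fixes h :: "'r::comm_ring_1 \<Rightarrow> 's::comm_ring_1" and Ls :: "('i::linorder \<Rightarrow> 'r) list"
  assumes h: "h 0 = 0" "h 1 = 1" "\<And>x y. h (x + y) = h x + h y" "\<And>x y. h (x * y) = h x * h y"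
    and "finite S"
  shows "wedge_list (map (\<lambda>L. ext_lin (\<lambda>e. h (L e))) Ls) S = h (wedge_list (map ext_lin Ls) S)"
  using assms(5)
proof (induction Ls arbitrary: S)
  case Nil
  then show ?case by (simp add: wedge_list_Nil ext_one_def h)
next
  case (Cons L Ls)
  have sum: "h (sum F A) = (\<Sum>x\<in>A. h (F x))" for F and A :: "'i set"
    by (induction A rule: infinite_finite_induct) (auto simp: h)
  have "h (- 1) = - 1" using h(3)[of 1 "- 1"] h(1,2) by (simp add: eq_neg_iff_add_eq_0 add.commute)
  then have "h ((- 1) ^ n) = (- 1) ^ n" for n by (induction n) (simp_all only: power.simps h)
  then have "h (pos_sign e S) = pos_sign e S" for e :: 'i and S by (simp add: pos_sign_def)
  then show ?case using Cons by (simp add: wedge_list_Cons wedge_lin sum h)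
qed

section \<open>Equivariance of the cocycle\<close>

definition ground :: "nat \<Rightarrow> nat \<Rightarrow> munit set" where
  "ground p q = p_prime p q \<union> p_dprime p q"

lemma E_in_ground:
  "E r s \<in> ground p q \<longleftrightarrow> (r < p \<and> p \<le> s \<and> s < p + q) \<or> (s < p \<and> p \<le> r \<and> r < p + q)"
  by (auto simp: ground_def p_prime_def p_dprime_def)

lemma finite_ground [simp]: "finite (ground p q)"
proof (rule finite_subset)
  show "ground p q \<subseteq> (\<lambda>(r, s). E r s) ` ({..<p+q} \<times> {..<p+q})"
    by (auto simp: ground_def p_prime_def p_dprime_def)
qed simp

lemma card_ext_bideg:
  assumes "x \<in> ext_bideg p q m n" "x S \<noteq> 0"
  shows "S \<in> Pow (ground p q)" "card S = m + n"
proof -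
  from assms have S: "S \<subseteq> ground p q" "card (S \<inter> p_prime p q) = m" "card (S \<inter> p_dprime p q) = n"
    by (auto simp: ext_bideg_def ground_def)
  then show "S \<in> Pow (ground p q)" by simp
  have "S = (S \<inter> p_prime p q) \<union> (S \<inter> p_dprime p q)" using S by (auto simp: ground_def)
  moreover have "finite S" using S(1) finite_ground by (rule finite_subset)
  moreover have "(S \<inter> p_prime p q) \<inter> (S \<inter> p_dprime p q) = {}"
    by (auto simp: p_prime_def p_dprime_def)
  ultimately show "card S = m + n" using S by (metis card_Un_disjoint finite_Int)
qed

text \<open>
  The linear form indexed by a column \<open>j\<close> and \<open>\<mu>\<close> in the product defining the cocycle; the columns
  \<open>j < b\<close> carry the coordinates \<open>z''\<close>, the remaining ones the coordinates \<open>z'\<close>.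
\<close>

definition psi_row :: "nat \<Rightarrow> nat \<Rightarrow> nat \<Rightarrow> nat \<Rightarrow> nat \<Rightarrow> munit \<Rightarrow> fpoly" where
  "psi_row p a b j \<mu> e = (case e of E r s \<Rightarrow>
     if j < b then (if r < p \<and> s = \<mu> then var (Z r (a + j)) else 0)
     else (if s < p \<and> r = \<mu> then var (Z s (j - b)) else 0))"

definition psi_rows :: "nat \<Rightarrow> nat \<Rightarrow> nat \<Rightarrow> nat \<Rightarrow> (munit \<Rightarrow> fpoly) list" where
  "psi_rows p q a b = map (\<lambda>i. psi_row p a b (i div q) (p + i mod q)) [0..<(b + a) * q]"

lemma concat_map_upt:
  "concat (map (\<lambda>j. map (f j) [p..<p+q]) [0..<n]) = map (\<lambda>i. f (i div q) (p + i mod q)) [0..<n * q]"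
proof (induction n)
  case (Suc n)
  have "[0..<Suc n * q] = [0..<n * q] @ map (\<lambda>m. m + n * q) [0..<q]"
  proof -
    have "[0..<Suc n * q] = [0..<n * q] @ [n * q..<n * q + q]"
      using upt_add_eq_append[of 0 "n * q" q] by (simp add: add.commute)
    also have "[n * q..<n * q + q] = map (\<lambda>m. m + n * q) [0..<q]"
      by (simp add: map_add_upt add.commute)
    finally show ?thesis .
  qed
  moreover have "[p..<p+q] = map (\<lambda>m. m + p) [0..<q]"
    by (simp add: map_add_upt add.commute)
  ultimately show ?case using Suc by (simp add: add.commute)
qed simp

lemma psi_form_eq: "psi_form p q a b = wedge_list (map ext_lin (psi_rows p q a b))"
proof -
  have 1: "(\<lambda>S. \<Sum>\<alpha><p. ext_gen (E \<alpha> \<mu>) (var (Z \<alpha> (a + j))) S) = ext_lin (psi_row p a b j \<mu>)"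
    if "j < b" for j \<mu>
  proof (rule ext_lin_eqI)
    fix e
    obtain r s where e: "e = E r s" by (cases e)
    have "(\<Sum>\<alpha><p. ext_gen (E \<alpha> \<mu>) (var (Z \<alpha> (a + j))) {e}) =
        (\<Sum>\<alpha><p. if \<alpha> = r then (if s = \<mu> then var (Z r (a + j)) else 0) else 0)"
      by (intro sum.cong) (auto simp: ext_gen_def e)
    also have "\<dots> = psi_row p a b j \<mu> e" using that by (simp add: psi_row_def e)
    finally show "(\<Sum>\<alpha><p. ext_gen (E \<alpha> \<mu>) (var (Z \<alpha> (a + j))) {e}) = psi_row p a b j \<mu> e" .
  qed (auto simp: ext_gen_def is_singleton_def intro!: sum.neutral)
  have 2: "(\<lambda>S. \<Sum>\<alpha><p. ext_gen (E \<mu> \<alpha>) (var (Z \<alpha> i)) S) = ext_lin (psi_row p a b (i + b) \<mu>)" for i \<mu>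
  proof (rule ext_lin_eqI)
    fix e
    obtain r s where e: "e = E r s" by (cases e)
    have "(\<Sum>\<alpha><p. ext_gen (E \<mu> \<alpha>) (var (Z \<alpha> i)) {e}) =
        (\<Sum>\<alpha><p. if \<alpha> = s then (if r = \<mu> then var (Z s i) else 0) else 0)"
      by (intro sum.cong) (auto simp: ext_gen_def e)
    also have "\<dots> = psi_row p a b (i + b) \<mu> e" by (simp add: psi_row_def e)
    finally show "(\<Sum>\<alpha><p. ext_gen (E \<mu> \<alpha>) (var (Z \<alpha> i)) {e}) = psi_row p a b (i + b) \<mu> e" .
  qed (auto simp: ext_gen_def is_singleton_def intro!: sum.neutral)
  have "psi_form p q a b = wedge_list
     (concat (map (\<lambda>j. map (\<lambda>\<mu>. ext_lin (psi_row p a b j \<mu>)) [p..<p+q]) [0..<b]) @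
      concat (map (\<lambda>i. map (\<lambda>\<mu>. ext_lin (psi_row p a b (i + b) \<mu>)) [p..<p+q]) [0..<a]))"
    unfolding psi_form_def 2
    by (intro arg_cong[where f = wedge_list] arg_cong2[where f = append] arg_cong[where f = concat] map_cong refl)
       (auto simp: 1)
  also have "\<dots> = wedge_list (concat (map (\<lambda>j. map (\<lambda>\<mu>. ext_lin (psi_row p a b j \<mu>)) [p..<p+q]) [0..<b+a]))"
  proof -
    have "[0..<b+a] = [0..<b] @ map (\<lambda>i. i + b) [0..<a]"
      using upt_add_eq_append[of 0 b a] by (simp add: map_add_upt add.commute[of a])
    then show ?thesis by (simp add: comp_def)
  qed
  finally show ?thesis by (simp add: concat_map_upt psi_rows_def comp_def)
qed

lemma psi_eq: "psi p q a b x = (\<Sum>S\<in>Pow (ground p q). const (x S) * psi_form p q a b S)"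
  by (simp add: psi_def ground_def)

definition Ad_coeff :: "nat \<Rightarrow> nat \<Rightarrow> complex mat \<times> complex mat \<Rightarrow> munit \<Rightarrow> munit \<Rightarrow> complex" where
  "Ad_coeff p q k e e' = (case e of E r s \<Rightarrow> case e' of E r' s' \<Rightarrow>
     if r' < p + q \<and> s' < p + q then block k $$ (r', r) * cnj (block k $$ (s', s)) else 0)"

lemma Ad_unit_eq_lin:
  assumes k: "k \<in> K_group p q" and e: "e \<in> ground p q"
  shows "Ad_unit p q k e = ext_lin (Ad_coeff p q k e)"
proof (rule ext_lin_eqI)
  obtain r s where rs: "e = E r s" by (cases e)
  have s: "s < p + q" using e by (auto simp: rs E_in_ground)
  have ent: "mat_adjoint (block k) $$ (s, s') = cnj (block k $$ (s', s))" if "s' < p + q" for s'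
    by (rule adjoint_entry[OF block_carrier[OF k] s that])
  fix e'
  obtain r0 s0 where e': "e' = E r0 s0" by (cases e')
  have "Ad_unit p q k e {e'} = (\<Sum>r'<p+q. \<Sum>s'<p+q. if s' = s0 then
      (if r' = r0 then block k $$ (r', r) * cnj (block k $$ (s0, s)) else 0) else 0)"
    unfolding Ad_unit_def rs munit.case by (intro sum.cong refl) (auto simp: ext_gen_def e' ent)
  also have "\<dots> = (\<Sum>r'<p+q. if r' = r0 then (if s0 < p + q then block k $$ (r', r) * cnj (block k $$ (s0, s)) else 0) else 0)"
    by (intro sum.cong refl) auto
  also have "\<dots> = Ad_coeff p q k e e'" by (simp add: Ad_coeff_def rs e')
  finally show "Ad_unit p q k e {e'} = Ad_coeff p q k e e'" .
next
  fix S :: "munit set" assume "\<not> is_singleton S"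
  then show "Ad_unit p q k e S = 0"
    by (cases e) (auto simp: Ad_unit_def ext_gen_def is_singleton_def intro!: sum.neutral)
qed

lemma ext_act_eq:
  assumes k: "k \<in> K_group p q"
  shows "ext_act p q k x S = (\<Sum>T\<in>Pow (ground p q).
     x T * wedge_list (map ext_lin (map (Ad_coeff p q k) (sorted_list_of_set T))) S)"
proof -
  have "map (Ad_unit p q k) (sorted_list_of_set T) = map ext_lin (map (Ad_coeff p q k) (sorted_list_of_set T))"
    if "T \<in> Pow (ground p q)" for T
  proof -
    have "finite T" using that finite_ground by (auto intro: finite_subset)
    then show ?thesis using that by (auto simp: Ad_unit_eq_lin[OF k])
  qed
  then show ?thesis
    unfolding ext_act_def ground_def[symmetric] by (intro sum.cong refl) (simp only:)
qed

text \<open>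
  The matrix by which the index \<open>\<mu>\<close> transforms: for \<open>j < b\<close> it comes from the factor \<open>V\<^sub>-\<^sup>*\<close> of \<open>p'\<close>, for
  the other columns from the factor \<open>V\<^sub>-\<close> of \<open>p''\<close>.
\<close>

definition psi_twist :: "nat \<Rightarrow> nat \<Rightarrow> complex mat \<times> complex mat \<Rightarrow> nat \<Rightarrow> nat \<Rightarrow> nat \<Rightarrow> complex" where
  "psi_twist p b k j m m' = (if j < b then cnj (block k $$ (p + m, p + m')) else block k $$ (p + m, p + m'))"

text \<open>
  Transforming the argument by \<open>k\<close> acts on both tensor factors of the matrix unit.  The factor in \<open>V\<^sub>+\<close>
  is compensated by transforming the coordinates, and the factor in \<open>V\<^sub>-\<close> leaves \<open>psi_twist\<close>.
\<close>

lemma psi_row_pullback: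
  assumes k: "k \<in> K_group p q" and m: "m < q" and e: "e \<in> ground p q" and j: "j < b + a"
  shows "(\<Sum>e'\<in>ground p q. psi_row p a b j (p + m) e' * const (Ad_coeff p q k e e')) =
    (\<Sum>m'<q. const (psi_twist p b k j m m') * psubst (coord_act p q a k) (psi_row p a b j (p + m') e))"
proof -
  obtain r s where rs: "e = E r s" by (cases e)
  let ?g = "\<lambda>s r. block k $$ (s, r)"
  (* x is the index of e in the definite part V+, y the one in V-, and kappa is the conjugation for j >= b *)
  define x where "x = (if j < b then r else s)"
  define y where "y = (if j < b then s else r)"
  define l where "l = (if j < b then a + j else j - b)"
  define \<kappa> where "\<kappa> z = (if j < b then z else cnj z)" for z
  define F where "F \<alpha> = (if j < b then E \<alpha> (p + m) else E (p + m) \<alpha>)" for \<alpha>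
  have xy: "x < p + q" "y < p + q" "x < p \<Longrightarrow> p \<le> y"
    using e by (auto simp: rs E_in_ground x_def y_def split: if_splits)
  have off: "?g \<alpha> x = 0" if "(\<alpha> < p) \<noteq> (x < p)" "\<alpha> < p + q" for \<alpha>
    by (rule block_off_diagonal[OF k that(2) xy(1) that(1)])
  have "(\<Sum>e'\<in>ground p q. psi_row p a b j (p + m) e' * const (Ad_coeff p q k e e')) =
      (\<Sum>e'\<in>F ` {..<p}. psi_row p a b j (p + m) e' * const (Ad_coeff p q k e e'))"
    using m by (intro sum.mono_neutral_right)
      (auto simp: F_def E_in_ground psi_row_def split: munit.splits if_splits)
  also have "\<dots> = (\<Sum>\<alpha><p. var (Z \<alpha> l) * const (\<kappa> (?g \<alpha> x) * cnj (\<kappa> (?g (p + m) y))))"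
    using m by (subst sum.reindex)
      (auto simp: inj_on_def F_def psi_row_def Ad_coeff_def rs x_def y_def l_def \<kappa>_def mult.commute)
  also have "\<dots> = (\<Sum>m'<q. const (psi_twist p b k j m m') * psubst (coord_act p q a k) (psi_row p a b j (p + m') e))"
  proof (cases "x < p")
    case True
    then have y: "p \<le> y" "y < p + q" using xy by auto
    have "(\<Sum>m'<q. const (psi_twist p b k j m m') * psubst (coord_act p q a k) (psi_row p a b j (p + m') e)) =
        (\<Sum>m'<q. if m' = y - p then const (cnj (\<kappa> (?g (p + m) y))) * coord_act p q a k (Z x l) else 0)"
      using True y by (intro sum.cong refl)
        (auto simp: psi_row_def rs psi_twist_def x_def y_def l_def \<kappa>_def)
    also have "\<dots> = const (cnj (\<kappa> (?g (p + m) y))) * coord_act p q a k (Z x l)" using y by simp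
    also have "coord_act p q a k (Z x l) = (\<Sum>\<alpha><p+q. const (\<kappa> (?g \<alpha> x)) * var (Z \<alpha> l))"
      using True j by (auto simp: coord_act_Z coord_coeff_def same_sign_def l_def \<kappa>_def less_diff_conv2)
    also have "\<dots> = (\<Sum>\<alpha><p. const (\<kappa> (?g \<alpha> x)) * var (Z \<alpha> l))"
      using off True by (intro sum.mono_neutral_right) (auto simp: \<kappa>_def)
    finally show ?thesis
      by (simp add: sum_distrib_left mult_ac flip: const_hom(4))
  next
    case False
    then have "?g \<alpha> x = 0" if "\<alpha> < p" for \<alpha> using that by (intro off) auto
    then show ?thesis using False by (auto simp: psi_row_def rs \<kappa>_def x_def intro!: sum.neutral)
  qed
  finally show ?thesis .
qed

lemma det_block_diagonal:
  fixes c :: "nat \<Rightarrow> nat \<Rightarrow> nat \<Rightarrow> 'a::idom"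
  shows "det (mat (n * q) (n * q) (\<lambda>(i, i'). if i div q = i' div q then c (i div q) (i mod q) (i' mod q) else 0)) =
    (\<Prod>j<n. det (mat q q (\<lambda>(m, m'). c j m m')))"
proof (induction n)
  case (Suc n)
  let ?D = "\<lambda>n. mat (n * q) (n * q) (\<lambda>(i, i'). if i div q = i' div q then c (i div q) (i mod q) (i' mod q) else 0)"
  let ?c = "mat q q (\<lambda>(m, m'). c n m m')"
  have "?D (Suc n) = four_block_mat (?D n) (0\<^sub>m (n * q) q) (0\<^sub>m q (n * q)) ?c"
  proof (rule eq_matI)
    fix i i' assume "i < dim_row (four_block_mat (?D n) (0\<^sub>m (n * q) q) (0\<^sub>m q (n * q)) ?c)"
      "i' < dim_col (four_block_mat (?D n) (0\<^sub>m (n * q) q) (0\<^sub>m q (n * q)) ?c)"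
    then have i: "i < n * q + q" "i' < n * q + q" by auto
    have lo: "x div q < n" if "x < n * q" for x using that by (rule less_mult_imp_div_less)
    have hi: "x div q = n \<and> x mod q = x - n * q" if "\<not> x < n * q" "x < n * q + q" for x
    proof -
      define m where "m = x - n * q"
      have "x = m + n * q" "m < q" "0 < q" using that by (auto simp: m_def)
      then show ?thesis by simp
    qed
    show "?D (Suc n) $$ (i, i') = four_block_mat (?D n) (0\<^sub>m (n * q) q) (0\<^sub>m q (n * q)) ?c $$ (i, i')"
    proof -
      have i2: "i < Suc n * q" "i' < Suc n * q" using i by simp_all
      have "?D (Suc n) $$ (i, i') = (if i div q = i' div q then c (i div q) (i mod q) (i' mod q) else 0)"
        using i2 by (simp only: index_mat prod.case)
      also have "\<dots> = (if i < n * q then if i' < n * q then ?D n $$ (i, i') else 0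
          else if i' < n * q then 0 else ?c $$ (i - n * q, i' - n * q))"
        using i lo[of i] lo[of i'] hi[of i] hi[of i']
        by (cases "i < n * q"; cases "i' < n * q") (simp_all add: less_diff_conv2)
      also have "\<dots> = four_block_mat (?D n) (0\<^sub>m (n * q) q) (0\<^sub>m q (n * q)) ?c $$ (i, i')"
        using i by (auto simp: less_diff_conv2)
      finally show ?thesis .
    qed
  qed simp_all
  then have "det (?D (Suc n)) = det (?D n) * det ?c"
    by (simp only:) (rule det_four_block_mat_lower_left_zero[of _ "n * q" _ q], auto)
  then show ?case using Suc by simp
qed simp

lemma det_unitary:
  assumes "B \<in> unitary_group q"
  shows "det B * cnj (det B) = 1" "det (mat q q (\<lambda>(m, m'). cnj (B $$ (m, m')))) = cnj (det B)"
proof -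
  have B: "B \<in> carrier_mat q q" "B * mat_adjoint B = 1\<^sub>m q" using assms by (auto simp: unitary_group_def)
  interpret c: comm_ring_hom cnj by unfold_locales auto
  have "mat q q (\<lambda>(m, m'). cnj (B $$ (m, m'))) = map_mat cnj B" using B by (intro eq_matI) auto
  then show 1: "det (mat q q (\<lambda>(m, m'). cnj (B $$ (m, m')))) = cnj (det B)" by (simp add: c.hom_det)
  have "mat_adjoint B = transpose_mat (map_mat cnj B)"
    using B adjoint_carrier[OF B(1)] by (intro eq_matI) (auto simp: adjoint_entry[OF B(1)])
  then have "det (mat_adjoint B) = cnj (det B)"
    using B by (simp add: det_transpose[of _ q] c.hom_det)
  then show "det B * cnj (det B) = 1"
    using det_mult[OF B(1) adjoint_carrier[OF B(1)]] B(2) by simp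
qed

text \<open>
  Both sides are determinants of pairings of linear forms.  The matrices differ by a factor that is
  block diagonal, with \<open>b\<close> complex conjugates of \<open>k\<^sub>-\<close> and \<open>a\<close> copies of \<open>k\<^sub>-\<close>; its determinant is the
  character \<open>det(k\<^sub>-)\<^bsup>a-b\<^esup>\<close> of the Fock space.
\<close>

lemma psi_wedge_pullback:
  assumes k: "k \<in> K_group p q" and S: "S \<in> Pow (ground p q)" "card S = (b + a) * q"
  shows "(\<Sum>T\<in>Pow (ground p q). const (wedge_list (map ext_lin (map (Ad_coeff p q k) (sorted_list_of_set S))) T) *
      psi_form p q a b T) = fock_act p q a b k (psi_form p q a b S)"
proof -
  let ?G = "ground p q" and ?N = "(b + a) * q" and ?\<phi> = "psubst (coord_act p q a k)"
  define ss where "ss = sorted_list_of_set S"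
  have finS: "finite S" using S finite_ground by (auto intro: finite_subset)
  have ss: "length ss = ?N" "set ss = S" using S finS by (auto simp: ss_def)
  let ?R = "psi_rows p q a b"
  have lenR: "length ?R = ?N" by (simp add: psi_rows_def)
  let ?Ms = "map (\<lambda>e e'. const (Ad_coeff p q k e e')) ss"
  have cW: "const (wedge_list (map ext_lin (map (Ad_coeff p q k) ss)) T) = wedge_list (map ext_lin ?Ms) T"
    if "finite T" for T
    using wedge_list_hom[of const T "map (Ad_coeff p q k) ss"] that by (simp add: comp_def)
  define C where "C = mat ?N ?N (\<lambda>(i, i'). if i div q = i' div q
      then psi_twist p b k (i div q) (i mod q) (i' mod q) else 0)"
  define M where "M = mat ?N ?N (\<lambda>(i, j). ?\<phi> ((?R ! i) (ss ! j)))"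
  have "(\<Sum>T\<in>Pow ?G. const (wedge_list (map ext_lin (map (Ad_coeff p q k) ss)) T) * psi_form p q a b T) =
      ext_pairing ?G (wedge_list (map ext_lin ?R)) (wedge_list (map ext_lin ?Ms))"
    unfolding ext_pairing_def psi_form_eq
    by (intro sum.cong refl, subst cW) (auto intro: finite_subset simp: mult.commute)
  also have "\<dots> = det (mat ?N ?N (\<lambda>(i, j). \<Sum>e\<in>?G. (?R ! i) e * (?Ms ! j) e))"
    using lenR ss by (intro pairing_eq_det) auto
  also have "mat ?N ?N (\<lambda>(i, j). \<Sum>e\<in>?G. (?R ! i) e * (?Ms ! j) e) = map_mat const C * M"
  proof (rule eq_matI)
    fix i j assume "i < dim_row (map_mat const C * M)" "j < dim_col (map_mat const C * M)"
    then have i: "i < ?N" and j: "j < ?N" by (auto simp: C_def M_def)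
    have q: "q > 0" using i by (cases q) auto
    let ?J = "i div q" and ?e = "ss ! j"
    have J: "?J < b + a" using i by (simp add: less_mult_imp_div_less)
    have e: "?e \<in> ?G" using ss S j nth_mem[of j ss] by auto
    let ?F = "\<lambda>i'. const (if ?J = i' div q then psi_twist p b k ?J (i mod q) (i' mod q) else 0)
        * ?\<phi> (psi_row p a b (i' div q) (p + i' mod q) ?e)"
    have Rn: "?R ! i' = psi_row p a b (i' div q) (p + i' mod q)" if "i' < ?N" for i'
      using that by (simp add: psi_rows_def)
    have "(\<Sum>e\<in>?G. (?R ! i) e * (?Ms ! j) e) =
        (\<Sum>m'<q. const (psi_twist p b k ?J (i mod q) m') * ?\<phi> (psi_row p a b ?J (p + m') ?e))"
      using psi_row_pullback[OF k _ e J, of "i mod q"] q i j ss by (simp add: Rn)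
    also have "\<dots> = (\<Sum>J'<b+a. if J' = ?J then
        (\<Sum>m'<q. const (psi_twist p b k ?J (i mod q) m') * ?\<phi> (psi_row p a b ?J (p + m') ?e)) else 0)"
      using J by simp
    also have "\<dots> = (\<Sum>J'<b+a. sum ?F {J' * q..<J' * q + q})"
    proof (intro sum.cong refl)
      fix J'
      have "sum ?F {J' * q..<J' * q + q} = (\<Sum>m'<q. ?F (J' * q + m'))"
        by (rule sum.reindex_bij_witness[of _ "\<lambda>m'. J' * q + m'" "\<lambda>x. x - J' * q"]) auto
      also have "\<dots> = (if J' = ?J then
        (\<Sum>m'<q. const (psi_twist p b k ?J (i mod q) m') * ?\<phi> (psi_row p a b ?J (p + m') ?e)) else 0)"
        using q by auto
      finally show "(if J' = ?J then
        (\<Sum>m'<q. const (psi_twist p b k ?J (i mod q) m') * ?\<phi> (psi_row p a b ?J (p + m') ?e)) else 0) =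
        sum ?F {J' * q..<J' * q + q}" ..
    qed
    also have "\<dots> = sum ?F {..<?N}" by (rule sum.nat_group)
    also have "\<dots> = (map_mat const C * M) $$ (i, j)"
      using i j by (simp add: scalar_prod_def C_def M_def Rn atLeast0LessThan)
    finally show "mat ?N ?N (\<lambda>(i, j). \<Sum>e\<in>?G. (?R ! i) e * (?Ms ! j) e) $$ (i, j) =
        (map_mat const C * M) $$ (i, j)" using i j by simp
  qed (auto simp: C_def M_def)
  also have "det (map_mat const C * M) = const (det C) * det M"
  proof -
    interpret c: comm_ring_hom const by unfold_locales auto
    have "det (map_mat const C * M) = det (map_mat const C) * det M"
      by (rule det_mult[of _ ?N]) (auto simp: C_def M_def)
    then show ?thesis by (simp add: c.hom_det)
  qed
  also have "det C = det (snd k) powi (int a - int b)"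
  proof -
    have B: "snd k \<in> unitary_group q" and Bc: "snd k \<in> carrier_mat q q"
      using k K_group_carrier[OF k] by (auto simp: K_group_iff)
    have blk: "block k $$ (p + m, p + m') = snd k $$ (m, m')" if "m < q" "m' < q" for m m'
      using that by (simp add: block_entry[OF K_group_carrier[OF k]])
    have d: "det (mat q q (\<lambda>(m, m'). psi_twist p b k j m m')) = (if j < b then cnj (det (snd k)) else det (snd k))" for j
    proof (cases "j < b")
      case True
      have "mat q q (\<lambda>(m, m'). psi_twist p b k j m m') = mat q q (\<lambda>(m, m'). cnj (snd k $$ (m, m')))"
        using True by (intro cong_mat) (auto simp: psi_twist_def blk)
      then show ?thesis using det_unitary(2)[OF B] True by simp
    next
      case False
      have "mat q q (\<lambda>(m, m'). psi_twist p b k j m m') = snd k"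
        using False Bc by (intro eq_matI) (auto simp: psi_twist_def blk)
      then show ?thesis using False by simp
    qed
    have nz: "det (snd k) \<noteq> 0" "cnj (det (snd k)) = inverse (det (snd k))"
      using det_unitary(1)[OF B] by (auto simp: inverse_unique)
    have "det C = (\<Prod>j<b+a. if j < b then cnj (det (snd k)) else det (snd k))"
      by (simp add: C_def det_block_diagonal d)
    also have "\<dots> = cnj (det (snd k)) ^ b * det (snd k) ^ a"
      by (induction a) (auto simp: mult_ac)
    also have "\<dots> = det (snd k) powi (int a - int b)"
      unfolding nz(2) using nz(1) by (simp add: power_int_diff field_simps)
    finally show ?thesis .
  qed
  also have "det M = ?\<phi> (psi_form p q a b S)"
  proof -
    have "?\<phi> (psi_form p q a b S) = wedge_list (map ext_lin (map (\<lambda>L e. ?\<phi> (L e)) ?R)) S"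
      unfolding psi_form_eq using wedge_list_hom[of ?\<phi> S ?R] finS
      by (simp add: psubst_add psubst_mult comp_def)
    also have "\<dots> = det (mat ?N ?N (\<lambda>(i, j). (map (\<lambda>L e. ?\<phi> (L e)) ?R ! i) (sorted_list_of_set S ! j)))"
      using finS S lenR by (intro wedge_list_eq_det) auto
    also have "\<dots> = det M"
      unfolding M_def ss_def using lenR by (intro arg_cong[where f = det] cong_mat) auto
    finally show ?thesis ..
  qed
  finally show ?thesis by (simp add: fock_act_def ss_def)
qed

lemma psi_equivariant:
  assumes k: "k \<in> K_group p q" and x: "x \<in> ext_bideg p q (b * q) (a * q)"
  shows "psi p q a b (ext_act p q k x) = fock_act p q a b k (psi p q a b x)"
proof -
  let ?P = "Pow (ground p q)"
  let ?W = "\<lambda>S. wedge_list (map ext_lin (map (Ad_coeff p q k) (sorted_list_of_set S)))"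
  have "psi p q a b (ext_act p q k x) = (\<Sum>T\<in>?P. \<Sum>S\<in>?P. const (x S) * (const (?W S T) * psi_form p q a b T))"
    unfolding psi_eq ext_act_eq[OF k] const_sum sum_distrib_right
    by (intro sum.cong refl) (simp add: const_mult_const)
  also have "\<dots> = (\<Sum>S\<in>?P. \<Sum>T\<in>?P. const (x S) * (const (?W S T) * psi_form p q a b T))"
    by (rule sum.swap)
  also have "\<dots> = (\<Sum>S\<in>?P. const (x S) * fock_act p q a b k (psi_form p q a b S))"
  proof (intro sum.cong refl)
    fix S assume S: "S \<in> ?P"
    show "(\<Sum>T\<in>?P. const (x S) * (const (?W S T) * psi_form p q a b T)) =
        const (x S) * fock_act p q a b k (psi_form p q a b S)"
    proof (cases "x S = 0")
      case False
      then have "card S = (b + a) * q" using card_ext_bideg(2)[OF x] by (simp add: ring_distribs)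
      then show ?thesis by (simp only: sum_distrib_left[symmetric] psi_wedge_pullback[OF k S])
    qed simp
  qed
  also have "\<dots> = fock_act p q a b k (psi p q a b x)"
    by (simp add: psi_eq fock_act_def psubst_sum psubst_mult sum_distrib_left mult_ac)
  finally show ?thesis .
qed

section \<open>Degrees and nonvanishing of the cocycle\<close>

definition total_deg :: "nat \<Rightarrow> nat \<Rightarrow> nat \<Rightarrow> nat \<Rightarrow> (fvar \<Rightarrow>\<^sub>0 nat) \<Rightarrow> nat" where
  "total_deg p q a b m = (\<Sum>v\<in>fvars p q a b. lk m v)"

definition deg_less :: "nat \<Rightarrow> nat \<Rightarrow> nat \<Rightarrow> nat \<Rightarrow> nat \<Rightarrow> fpoly set" where
  "deg_less p q a b n = {f. \<forall>m\<in>monoms f. total_deg p q a b m < n}"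

lemma deg_less_iff: "f \<in> deg_less p q a b n \<longleftrightarrow> (\<forall>m. lk f m \<noteq> 0 \<longrightarrow> total_deg p q a b m < n)"
  by (auto simp: deg_less_def in_keys_iff)

lemma total_deg_add_unit:
  "v \<in> fvars p q a b \<Longrightarrow> total_deg p q a b (m + unit_exp v) = Suc (total_deg p q a b m)"
  by (simp add: total_deg_def lookup_add sum.distrib lookup_single when_def)

lemma deg_less_add: "f \<in> deg_less p q a b n \<Longrightarrow> g \<in> deg_less p q a b n \<Longrightarrow> f + g \<in> deg_less p q a b n"
  by (auto simp: deg_less_iff lookup_add) (metis add_0)

lemma deg_less_0 [simp]: "0 \<in> deg_less p q a b n"
  by (simp add: deg_less_iff)

lemma deg_less_sum: "(\<And>x. x \<in> A \<Longrightarrow> f x \<in> deg_less p q a b n) \<Longrightarrow> sum f A \<in> deg_less p q a b n"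
  by (induction A rule: infinite_finite_induct) (auto simp: deg_less_add)

lemma deg_less_scale: "f \<in> deg_less p q a b n \<Longrightarrow> const c * f \<in> deg_less p q a b n"
  by (simp add: deg_less_iff)

lemma deg_less_uminus: "f \<in> deg_less p q a b n \<Longrightarrow> - f \<in> deg_less p q a b n"
  by (simp add: deg_less_iff)

lemma deg_less_pdiff:
  "v \<in> fvars p q a b \<Longrightarrow> f \<in> deg_less p q a b (Suc n) \<Longrightarrow> pdiff v f \<in> deg_less p q a b n"
  unfolding deg_less_iff lookup_pdiff
  by (metis Suc_less_eq mult_zero_right total_deg_add_unit)

lemma deg_less_var_mult:
  assumes "v \<in> fvars p q a b" "f \<in> deg_less p q a b n"
  shows "var v * f \<in> deg_less p q a b (Suc n)"
  unfolding deg_less_iff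
proof (intro allI impI)
  fix m assume "lk (var v * f) m \<noteq> 0"
  then have m: "lk m v \<noteq> 0" "lk f (m - unit_exp v) \<noteq> 0" by (auto simp: lookup_var_mult split: if_splits)
  have "m = m - unit_exp v + unit_exp v" using m(1) by (simp add: unit_exp_cancel)
  then have "total_deg p q a b m = Suc (total_deg p q a b (m - unit_exp v))"
    using total_deg_add_unit[OF assms(1)] by metis
  then show "total_deg p q a b m < Suc n" using assms(2) m(2) by (simp add: deg_less_iff)
qed

lemma wedge_list_vars_deg:
  assumes "\<And>L e. L \<in> set Ls \<Longrightarrow> L e = 0 \<or> (\<exists>v\<in>fvars p q a b. L e = var v)" and "finite S"
  shows "wedge_list (map ext_lin Ls) S \<in> fock p q a b \<inter> deg_less p q a b (Suc (length Ls))"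
  using assms
proof (induction Ls arbitrary: S)
  case Nil
  have "1 \<in> fock p q a b \<inter> deg_less p q a b 1"
    using polys_in_const[of 1] by (auto simp: fock_eq deg_less_def total_deg_def simp del: polys_in_const)
  then show ?case by (auto simp: wedge_list_Nil ext_one_def fock_eq One_nat_def)
next
  case (Cons L Ls)
  have sgn: "(pos_sign e S :: fpoly) = const (pos_sign e S)" for e
  proof -
    have "(- 1 :: fpoly) = const (- 1)" by (simp flip: const_hom(5))
    then have "(- 1 :: fpoly) ^ n = const ((- 1) ^ n)" for n
      by (induction n) (simp_all only: power.simps const_hom)
    then show ?thesis by (simp only: pos_sign_def)
  qed
  have "pos_sign e S * L e * wedge_list (map ext_lin Ls) (S - {e})
      \<in> fock p q a b \<inter> deg_less p q a b (Suc (length (L # Ls)))" for e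
  proof -
    have IH: "wedge_list (map ext_lin Ls) (S - {e}) \<in> fock p q a b \<inter> deg_less p q a b (Suc (length Ls))"
      using Cons.prems by (intro Cons.IH) auto
    consider "L e = 0" | v where "v \<in> fvars p q a b" "L e = var v"
      using Cons.prems(1)[of L e] by auto
    then show ?thesis
    proof cases
      case 2
      then have "const (pos_sign e S) * (var v * wedge_list (map ext_lin Ls) (S - {e}))
          \<in> fock p q a b \<inter> deg_less p q a b (Suc (length (L # Ls)))"
        using IH by (auto simp: fock_eq intro!: deg_less_scale polys_in_scale polys_in_var_mult deg_less_var_mult)
      then show ?thesis by (simp only: sgn 2 mult.assoc)
    qed (simp add: fock_eq)
  qed
  then show ?case
    using Cons.prems(2)
    by (auto simp: wedge_list_Cons wedge_lin fock_eq intro!: polys_in_sum deg_less_sum)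
qed

lemma psi_row_vars:
  assumes "\<mu> < p + q" "j < b + a"
  shows "psi_row p a b j \<mu> e = 0 \<or> (\<exists>v\<in>fvars p q a b. psi_row p a b j \<mu> e = var v)"
  using assms by (cases e) (auto simp: psi_row_def intro!: bexI[of _ "Z _ _"])

lemma psi_form_deg:
  assumes "finite S"
  shows "psi_form p q a b S \<in> fock p q a b \<inter> deg_less p q a b (Suc ((b + a) * q))"
proof -
  have "L e = 0 \<or> (\<exists>v\<in>fvars p q a b. L e = var v)" if L: "L \<in> set (psi_rows p q a b)" for L e
  proof -
    obtain i where i: "i < (b + a) * q" "L = psi_row p a b (i div q) (p + i mod q)"
      using L by (auto simp: psi_rows_def)
    then have "q > 0" by (cases q) auto
    then show ?thesis using i psi_row_vars[of "p + i mod q" p q "i div q" b a e]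
      by (simp add: less_mult_imp_div_less)
  qed
  then show ?thesis
    using wedge_list_vars_deg[of "psi_rows p q a b" p q a b S] assms
    by (simp add: psi_form_eq psi_rows_def)
qed

lemma psi_deg: "psi p q a b x \<in> fock p q a b \<inter> deg_less p q a b (Suc ((b + a) * q))"
proof -
  have "finite S" if "S \<in> Pow (ground p q)" for S
    using that finite_ground by (auto intro: finite_subset)
  then show ?thesis
    using psi_form_deg[of _ p q a b]
    by (auto simp: psi_eq fock_eq intro!: polys_in_sum deg_less_sum polys_in_scale deg_less_scale)
qed

text \<open>
  The generators that occur in the highest weight vector of \<open>X\<close>.
\<close>

definition top_set :: "nat \<Rightarrow> nat \<Rightarrow> nat \<Rightarrow> nat \<Rightarrow> munit set" where
  "top_set p q a b = {E r s | r s. r < b \<and> p \<le> s \<and> s < p + q} \<union> {E s r | r s. p - a \<le> r \<and> r < p \<and> p \<le> s \<and> s < p + q}"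

text \<open>
  Setting \<open>Z r (a + j)\<close> to \<open>\<delta>\<^sub>r\<^sub>j\<close> and \<open>Z r k\<close> to 1 or 0 according to \<open>r = p - 1 - k\<close> turns each linear form
  into a single generator; these are distinct and make up \<open>top_set\<close>.
\<close>

lemma psi_form_top_nonzero:
  assumes ab: "a + b \<le> p"
  shows "psi_form p q a b (top_set p q a b) \<noteq> 0"
proof -
  let ?N = "(b + a) * q" and ?S = "top_set p q a b"
  define \<sigma> :: "fvar \<Rightarrow> fpoly" where
    "\<sigma> v = (case v of Z r k \<Rightarrow> if k = (if k < a then p - 1 - r else a + r) then 1 else 0)" for v
  (* the generator that survives in the i-th linear form *)
  define g where "g i = (let j = i div q; \<mu> = p + i mod q in if j < b then E j \<mu> else E \<mu> (p - 1 - (j - b)))" for i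
  have "?S \<subseteq> ground p q" using ab by (auto simp: top_set_def E_in_ground)
  then have finS: "finite ?S" using finite_ground by (rule finite_subset)
  have row: "psubst \<sigma> (psi_row p a b (i div q) (p + i mod q) e) = (if e = g i then 1 else 0)" if i: "i < ?N" for i e
  proof -
    have j: "i div q < b + a" using i by (simp add: less_mult_imp_div_less)
    obtain r s where e: "e = E r s" by (cases e)
    show ?thesis
    proof (cases "i div q < b")
      case True
      then show ?thesis using ab by (auto simp: psi_row_def \<sigma>_def g_def e Let_def)
    next
      case False
      then show ?thesis using ab j by (auto simp: psi_row_def \<sigma>_def g_def e Let_def)
    qed
  qed
  have dm: "i = i'" if "i div q = i' div q" "i mod q = i' mod q" for i i' :: nat
    using that by (metis div_mult_mod_eq)
  have "inj_on g {0..<?N}"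
  proof (rule inj_onI)
    fix i i' assume i: "i \<in> {0..<?N}" "i' \<in> {0..<?N}" and eq: "g i = g i'"
    define j j' where "j = i div q" and "j' = i' div q"
    have j: "j < b + a" "j' < b + a" using i by (simp_all add: less_mult_imp_div_less j_def j'_def)
    have "(if j < b then E j (p + i mod q) else E (p + i mod q) (p - 1 - (j - b))) =
        (if j' < b then E j' (p + i' mod q) else E (p + i' mod q) (p - 1 - (j' - b)))"
      using eq by (simp only: g_def Let_def j_def j'_def)
    then have "j = j' \<and> i mod q = i' mod q"
      using j ab by (cases "j < b"; cases "j' < b") (simp_all, linarith+)
    then show "i = i'" using dm[of i i'] by (simp add: j_def j'_def)
  qed
  then have dist: "distinct (map g [0..<?N])" by (simp add: distinct_map)
  have "g ` {0..<?N} = ?S"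
  proof (intro equalityI subsetI)
    fix e assume "e \<in> g ` {0..<?N}"
    then obtain i where i: "i < ?N" "e = g i" by auto
    then have "q > 0" by (cases q) auto
    moreover have "i div q < b + a" using i by (simp add: less_mult_imp_div_less)
    ultimately show "e \<in> ?S" using i ab by (auto simp: g_def top_set_def Let_def)
  next
    fix e assume "e \<in> ?S"
    then consider r s where "e = E r s" "r < b" "p \<le> s" "s < p + q"
      | r s where "e = E s r" "p - a \<le> r" "r < p" "p \<le> s" "s < p + q" by (auto simp: top_set_def)
    then show "e \<in> g ` {0..<?N}"
    proof cases
      case 1
      then obtain x where x: "s = p + x" "x < q" by (metis le_Suc_ex nat_add_left_cancel_less)
      have "e = g (x + r * q)" using 1 x by (simp add: g_def Let_def)
      moreover have "x + r * q < Suc r * q" using x by simp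
      moreover have "Suc r * q \<le> ?N" using 1 by (intro mult_right_mono) auto
      ultimately show ?thesis by (intro image_eqI[of _ _ "x + r * q"]) auto
    next
      case 2
      let ?j = "b + (p - 1 - r)"
      from 2 obtain x where x: "s = p + x" "x < q" by (metis le_Suc_ex nat_add_left_cancel_less)
      have "e = g (x + ?j * q)" using 2 x by (simp add: g_def Let_def)
      moreover have "x + ?j * q < Suc ?j * q" using x by simp
      moreover have "Suc ?j * q \<le> ?N" using 2 by (intro mult_right_mono) auto
      ultimately show ?thesis by (intro image_eqI[of _ _ "x + ?j * q"]) auto
    qed
  qed
  then have setg: "set (map g [0..<?N]) = ?S" by simp
  obtain s :: fpoly where s: "s = 1 \<or> s = - 1"
    and w: "\<forall>S. finite S \<longrightarrow> wedge_list (map (\<lambda>e. ext_gen e 1) (map g [0..<?N])) S =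
       (if S = set (map g [0..<?N]) then s * (\<Prod>e\<in>set (map g [0..<?N]). 1) else 0)"
    using wedge_list_gens[OF dist, of "\<lambda>_. 1"] by blast
  have "psubst \<sigma> (psi_form p q a b ?S) =
      wedge_list (map (\<lambda>L. ext_lin (\<lambda>e. psubst \<sigma> (L e))) (psi_rows p q a b)) ?S"
    unfolding psi_form_eq using finS by (intro wedge_list_hom[symmetric]) (auto simp: psubst_add psubst_mult)
  also have "map (\<lambda>L. ext_lin (\<lambda>e. psubst \<sigma> (L e))) (psi_rows p q a b) = map (\<lambda>e. ext_gen e 1) (map g [0..<?N])"
    unfolding psi_rows_def by (auto simp: row ext_gen_eq_lin)
  also have "wedge_list \<dots> ?S = s" using w finS setg by simp
  finally have "psubst \<sigma> (psi_form p q a b ?S) \<noteq> 0" using s by auto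
  then show ?thesis by auto
qed

section \<open>Weights\<close>

definition torus :: "nat \<Rightarrow> nat \<Rightarrow> (nat \<Rightarrow> complex) \<Rightarrow> complex mat \<times> complex mat" where
  "torus p q t = (mat_diag p t, mat_diag q (\<lambda>i. t (p + i)))"

lemma torus_in_K:
  assumes "\<And>r. r < p + q \<Longrightarrow> cmod (t r) = 1"
  shows "torus p q t \<in> K_group p q"
proof -
  have "mat_diag n u \<in> unitary_group n" if u: "\<And>r. r < n \<Longrightarrow> cmod (u r) = 1" for n and u :: "nat \<Rightarrow> complex"
  proof (rule unitary_group_of_rows)
    fix i j assume ij: "i < n" "j < n"
    have "u i * cnj (u i) = 1" using u[OF ij(1)] by (simp add: complex_mult_cnj cmod_def)
    moreover have "(\<Sum>k<n. mat_diag n u $$ (i, k) * cnj (mat_diag n u $$ (j, k))) =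
        (\<Sum>k<n. if k = i then (if i = j then u i * cnj (u i) else 0) else 0)"
      using ij by (intro sum.cong) (auto simp: mat_diag_def)
    ultimately show "(\<Sum>k<n. mat_diag n u $$ (i, k) * cnj (mat_diag n u $$ (j, k))) = (if i = j then 1 else 0)"
      using ij by simp metis
  qed simp
  then show ?thesis using assms by (simp add: torus_def K_group_iff)
qed

lemma block_torus:
  assumes "s < p + q" "r < p + q"
  shows "block (torus p q t) $$ (s, r) = (if s = r then t r else 0)"
  using assms by (subst block_entry) (auto simp: torus_def mat_diag_def)

fun unit_row :: "munit \<Rightarrow> nat" where "unit_row (E r s) = r"
fun unit_col :: "munit \<Rightarrow> nat" where "unit_col (E r s) = s"

text \<open>
  \<open>E r s\<close> has weight \<open>\<epsilon>\<^sub>r - \<epsilon>\<^sub>s\<close>.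
\<close>

definition ext_weight :: "munit set \<Rightarrow> nat \<Rightarrow> int" where
  "ext_weight S r = int (card {e \<in> S. unit_row e = r}) - int (card {e \<in> S. unit_col e = r})"

lemma torus_character_ext:
  assumes t: "\<And>r. r < p + q \<Longrightarrow> cmod (t r) = 1" and S: "S \<in> Pow (ground p q)"
  shows "(\<Prod>e\<in>S. t (unit_row e) * cnj (t (unit_col e))) = (\<Prod>r<p+q. t r powi ext_weight S r)"
proof -
  have fin: "finite S" using S finite_ground by (auto intro: finite_subset)
  have G: "(\<Prod>e\<in>S. u (g e)) = (\<Prod>r<p+q. u r ^ card {e \<in> S. g e = r})"
    if "g ` S \<subseteq> {..<p+q}" for u :: "nat \<Rightarrow> complex" and g
  proof -
    have "(\<Prod>e\<in>S. u (g e)) = (\<Prod>r<p+q. \<Prod>e\<in>{e \<in> S. g e = r}. u (g e))"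
      using fin that by (intro prod.group[symmetric]) auto
    also have "\<dots> = (\<Prod>r<p+q. u r ^ card {e \<in> S. g e = r})"
      by (intro prod.cong refl) simp
    finally show ?thesis .
  qed
  have sub: "unit_row ` S \<subseteq> {..<p+q}" "unit_col ` S \<subseteq> {..<p+q}"
    using S by (auto simp: ground_def p_prime_def p_dprime_def)
  have "t r ^ n * cnj (t r) ^ l = t r powi (int n - int l)" if "r < p + q" for r n l
  proof -
    have nz: "t r \<noteq> 0" using t[OF that] by auto
    have "t r * cnj (t r) = 1" using t[OF that] by (simp add: complex_mult_cnj cmod_def)
    then have "cnj (t r) = inverse (t r)" by (simp add: inverse_unique)
    then show ?thesis using nz by (simp add: power_int_diff power_inverse divide_inverse)
  qed
  then show ?thesis
    by (simp add: prod.distrib G[OF sub(1)] G[OF sub(2), of "\<lambda>r. cnj (t r)"] prod.distrib[symmetric] ext_weight_def)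
qed

lemma ext_act_torus:
  assumes t: "\<And>r. r < p + q \<Longrightarrow> cmod (t r) = 1" and S: "S \<in> Pow (ground p q)"
  shows "ext_act p q (torus p q t) x S = (\<Prod>r<p+q. t r powi ext_weight S r) * x S"
proof -
  have fin: "finite T" if "T \<in> Pow (ground p q)" for T using that finite_ground by (auto intro: finite_subset)
  have K: "torus p q t \<in> K_group p q" using t by (rule torus_in_K)
  let ?c = "\<lambda>e. t (unit_row e) * cnj (t (unit_col e))"
  have Ad: "ext_lin (Ad_coeff p q (torus p q t) e) = ext_gen e (?c e)" if "e \<in> ground p q" for e
    unfolding ext_gen_eq_lin
  proof (intro arg_cong[where f = ext_lin] ext)
    fix e'
    obtain r s r' s' where e: "e = E r s" "e' = E r' s'" by (cases e; cases e')
    show "Ad_coeff p q (torus p q t) e e' = (if e' = e then ?c e else 0)"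
      using that by (auto simp: e Ad_coeff_def block_torus E_in_ground)
  qed
  have "ext_act p q (torus p q t) x S = (\<Sum>T\<in>Pow (ground p q). x T *
      wedge_list (map (\<lambda>e. ext_gen e (?c e)) (sorted_list_of_set T)) S)"
    unfolding ext_act_eq[OF K]
  proof (intro sum.cong refl)
    fix T assume T: "T \<in> Pow (ground p q)"
    have "map ext_lin (map (Ad_coeff p q (torus p q t)) (sorted_list_of_set T)) =
        map (\<lambda>e. ext_gen e (?c e)) (sorted_list_of_set T)"
      using T fin[OF T] by (auto simp: Ad)
    then show "x T * wedge_list (map ext_lin (map (Ad_coeff p q (torus p q t)) (sorted_list_of_set T))) S =
        x T * wedge_list (map (\<lambda>e. ext_gen e (?c e)) (sorted_list_of_set T)) S" by (simp only:)
  qed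
  also have "\<dots> = (\<Sum>T\<in>Pow (ground p q). if T = S then x S * (\<Prod>e\<in>S. ?c e) else 0)"
    by (intro sum.cong refl, subst wedge_list_sorted_gens) (auto simp: fin fin[OF S])
  also have "\<dots> = x S * (\<Prod>e\<in>S. ?c e)" using S by simp
  also have "(\<Prod>e\<in>S. ?c e) = (\<Prod>r<p+q. t r powi ext_weight S r)"
    by (rule torus_character_ext) (fact t S)+
  finally show ?thesis by (simp only: mult.commute)
qed

text \<open>
  The coordinates of type \<open>V'\<close> have negative weight; the last summand is the weight of the constants.
\<close>

definition fock_weight :: "nat \<Rightarrow> nat \<Rightarrow> nat \<Rightarrow> (fvar \<Rightarrow>\<^sub>0 nat) \<Rightarrow> nat \<Rightarrow> int" where
  "fock_weight p a b m r = (\<Sum>k<a+b. (if same_sign p a r k then - 1 else 1) * int (lk m (Z r k)))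
     + (if r < p then 0 else int a - int b)"

lemma psubst_diagonal:
  assumes "f \<in> polys_in V" "finite V" "\<And>v. v \<in> V \<Longrightarrow> \<sigma> v = const (c v) * var v"
  shows "lk (psubst \<sigma> f) m = (\<Prod>v\<in>V. c v ^ lk m v) * lk f m"
  using assms(1)
proof (induction arbitrary: m rule: polys_in_induct)
  case (const c)
  then show ?case by (simp add: lookup_const)
next
  case (add f g)
  then show ?case by (simp add: psubst_add lookup_add ring_distribs)
next
  case (var v f)
  have P: "psubst \<sigma> (var v * f) = const (c v) * (var v * psubst \<sigma> f)"
    by (simp add: psubst_var_mult assms(3)[OF var(1)] mult.assoc)
  show ?case
  proof (cases "lk m v = 0")
    case False
    have "(\<Prod>w\<in>V. c w ^ lk m w) = (\<Prod>w\<in>V. (if w = v then c v else 1) * c w ^ lk (m - unit_exp v) w)"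
    proof (intro prod.cong refl)
      fix w
      show "c w ^ lk m w = (if w = v then c v else 1) * c w ^ lk (m - unit_exp v) w"
        using False by (cases "lk m v") (auto simp: lookup_minus lookup_single when_def One_nat_def)
    qed
    also have "\<dots> = c v * (\<Prod>w\<in>V. c w ^ lk (m - unit_exp v) w)"
      using assms(2) var(1) by (simp add: prod.distrib prod.delta)
    finally show ?thesis using False by (simp add: P lookup_var_mult var.IH)
  qed (simp add: P lookup_var_mult)
qed

text \<open>
  One-parameter subgroups of the torus suffice to separate weights.
\<close>

definition circle :: "nat \<Rightarrow> complex \<Rightarrow> nat \<Rightarrow> complex" where
  "circle r0 u = (\<lambda>r. if r = r0 then u else 1)"

lemma fock_act_circle:
  assumes u: "cmod u = 1" and f: "f \<in> fock p q a b" and r0: "r0 < p + q"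
  shows "lk (fock_act p q a b (torus p q (circle r0 u)) f) m = u powi fock_weight p a b m r0 * lk f m"
proof -
  let ?t = "circle r0 u" and ?k = "torus p q (circle r0 u)"
  have nz: "u \<noteq> 0" using u by auto
  have "u * cnj u = 1" using u by (simp add: complex_mult_cnj cmod_def)
  then have inv: "cnj u = inverse u" by (simp add: inverse_unique)
  define c where "c v = (case v of Z r l \<Rightarrow> if same_sign p a r l then cnj (?t r) else ?t r)" for v
  have \<sigma>: "coord_act p q a ?k v = const (c v) * var v" if "v \<in> fvars p q a b" for v
  proof -
    obtain r l where v: "v = Z r l" "r < p + q" using \<open>v \<in> fvars p q a b\<close> by (auto simp: fvars_def)
    have "coord_act p q a ?k v = (\<Sum>s<p+q. if s = r then const (c v) * var v else 0)"
      unfolding v(1) coord_act_Z using v(2)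
      by (intro sum.cong refl) (auto simp: coord_coeff_def block_torus c_def)
    then show ?thesis using v(2) by simp
  qed
  have "(\<Prod>v\<in>fvars p q a b. c v ^ lk m v) = (\<Prod>r<p+q. \<Prod>l<a+b. c (Z r l) ^ lk m (Z r l))"
    unfolding fvars_image
    by (subst prod.reindex) (auto simp: inj_on_def prod.cartesian_product intro!: prod.cong)
  also have "\<dots> = (\<Prod>r<p+q. if r = r0 then (\<Prod>l<a+b. c (Z r0 l) ^ lk m (Z r0 l)) else 1)"
    by (intro prod.cong refl) (auto simp: c_def circle_def)
  also have "\<dots> = (\<Prod>l<a+b. c (Z r0 l) ^ lk m (Z r0 l))" using r0 by simp
  also have "\<dots> = (\<Prod>l<a+b. u powi ((if same_sign p a r0 l then - 1 else 1) * int (lk m (Z r0 l))))"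
    by (intro prod.cong refl) (auto simp: c_def circle_def inv power_int_minus power_inverse)
  also have "\<dots> = u powi (\<Sum>l<a+b. (if same_sign p a r0 l then - 1 else 1) * int (lk m (Z r0 l)))"
  proof -
    have "(\<Prod>l<n. u powi F l) = u powi (\<Sum>l<n. F l)" for F :: "nat \<Rightarrow> int" and n
      by (induction n) (auto simp: power_int_add nz)
    then show ?thesis .
  qed
  finally have P: "(\<Prod>v\<in>fvars p q a b. c v ^ lk m v) =
      u powi (\<Sum>l<a+b. (if same_sign p a r0 l then - 1 else 1) * int (lk m (Z r0 l)))" .
  have "det (snd ?k) = (\<Prod>i<q. ?t (p + i))"
  proof -
    have "det (mat_diag q (\<lambda>i. ?t (p + i))) = prod_list (diag_mat (mat_diag q (\<lambda>i. ?t (p + i))))"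
      by (rule det_upper_triangular[of _ q]) (auto simp: mat_diag_def)
    then show ?thesis
      by (simp add: torus_def diag_mat_def mat_diag_def prod.list_conv_set_nth atLeast0LessThan)
  qed
  also have "\<dots> = (\<Prod>i<q. if i = r0 - p then (if r0 < p then 1 else u) else 1)"
    by (intro prod.cong refl) (auto simp: circle_def)
  also have "\<dots> = (if r0 < p then 1 else u)" using r0 by (auto simp: prod.delta)
  finally have "det (snd ?k) powi (int a - int b) = u powi (if r0 < p then 0 else int a - int b)" by simp
  then show ?thesis
    using psubst_diagonal[OF f[unfolded fock_eq], of "coord_act p q a ?k" c m] \<sigma>
    by (simp add: fock_act_def P fock_weight_def power_int_add nz mult_ac)
qed

lemma separating_unit:
  assumes "(i::int) \<noteq> j"
  obtains u :: complex where "cmod u = 1" "u powi i \<noteq> u powi j"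
proof -
  define d where "d = i - j"
  (* then u powi i and u powi j differ by the factor -1 *)
  define u where "u = cis (pi / of_int d)"
  have u: "cmod u = 1" by (simp add: u_def)
  then have nz: "u \<noteq> 0" by auto
  have "u powi d = cis (of_int d * (pi / of_int d))" by (simp add: u_def cis_power_int)
  also have "\<dots> = - 1" using assms by (simp add: d_def)
  finally have "u powi i = - (u powi j)"
    using nz by (simp add: d_def power_int_diff field_simps)
  then have "u powi i \<noteq> u powi j" using nz by (auto simp: neg_equal_iff_equal)
  then show ?thesis using u that by blast
qed

lemma V_copyD:
  assumes "is_V_copy p q a b X"
  shows "X \<subseteq> ext_bideg p q (b * q) (a * q)" "K_submodule p q X" "K_irreducible p q X"
    "has_highest_weight p q X (V_weight p q a b)"
  using assms by (auto simp: is_V_copy_def K_irreducible_def)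

lemma ext_bideg_0_outside:
  "x \<in> ext_bideg p q m n \<Longrightarrow> S \<notin> Pow (ground p q) \<Longrightarrow> x S = 0"
  using card_ext_bideg(1) by blast

lemma Hom_KD:
  assumes "T \<in> Hom_K p q a b X"
  shows "\<And>x. x \<in> X \<Longrightarrow> T x \<in> fock p q a b"
    "\<And>x y. x \<in> X \<Longrightarrow> y \<in> X \<Longrightarrow> T (ext_add x y) = T x + T y"
    "\<And>c x. x \<in> X \<Longrightarrow> T (ext_scale c x) = const c * T x"
    "\<And>k x. k \<in> K_group p q \<Longrightarrow> x \<in> X \<Longrightarrow> T (ext_act p q k x) = fock_act p q a b k (T x)"
  using assms by (auto simp: Hom_K_def)

lemma K_submoduleD:
  assumes "K_submodule p q X"
  shows "ext_zero \<in> X" "\<And>x y. x \<in> X \<Longrightarrow> y \<in> X \<Longrightarrow> ext_add x y \<in> X"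
    "\<And>c x. x \<in> X \<Longrightarrow> ext_scale c x \<in> X"
    "\<And>k x. k \<in> K_group p q \<Longrightarrow> x \<in> X \<Longrightarrow> ext_act p q k x \<in> X"
  using assms by (auto simp: K_submodule_def)

text \<open>
  A polynomial in torus elements projects to a weight space: for each unwanted weight \<open>v\<close> it contains
  a factor \<open>(t - v(t)) / (w'(t) - v(t))\<close> for some \<open>t\<close> that separates \<open>v\<close> from \<open>w'\<close>.  It preserves \<open>X\<close> and
  commutes with \<open>T\<close>, and \<open>c\<close> records the scalar by which it acts on each weight space.
\<close>

lemma weight_component:
  assumes T: "T \<in> Hom_K p q a b X" and X: "K_submodule p q X"
    and y: "y \<in> X" and "finite \<Omega>"
  shows "\<exists>y'\<in>X. \<exists>c :: (nat \<Rightarrow> int) \<Rightarrow> complex. c w' = 1 \<and>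
    (\<forall>v\<in>\<Omega>. (\<exists>r<p+q. v r \<noteq> w' r) \<longrightarrow> c v = 0) \<and>
    (\<forall>S\<in>Pow (ground p q). y' S = c (ext_weight S) * y S) \<and>
    (\<forall>m. lk (T y') m = c (fock_weight p a b m) * lk (T y) m)"
  using assms(4)
proof (induction \<Omega>)
  case empty
  show ?case by (rule bexI[OF _ y], rule exI[of _ "\<lambda>_. 1"]) simp
next
  case (insert v \<Omega>)
  then obtain y' c where y': "y' \<in> X" and c: "c w' = 1"
    "\<forall>v\<in>\<Omega>. (\<exists>r<p+q. v r \<noteq> w' r) \<longrightarrow> c v = 0"
    "\<forall>S\<in>Pow (ground p q). y' S = c (ext_weight S) * y S"
    "\<forall>m. lk (T y') m = c (fock_weight p a b m) * lk (T y) m" by blast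
  show ?case
  proof (cases "\<exists>r<p+q. v r \<noteq> w' r")
    case False
    then show ?thesis using y' c by (intro bexI[of _ y'] exI[of _ c]) auto
  next
    case True
    then obtain r where r: "r < p + q" "w' r \<noteq> v r" by auto
    obtain u :: complex where u: "cmod u = 1" "u powi w' r \<noteq> u powi v r"
      using separating_unit[OF r(2)] by blast
    let ?k = "torus p q (circle r u)"
    have t: "cmod (circle r u s) = 1" for s using u by (simp add: circle_def)
    have k: "?k \<in> K_group p q" by (rule torus_in_K) (rule t)
    define d where "d = u powi w' r - u powi v r"
    have d: "d \<noteq> 0" using u by (simp add: d_def)
    define y'' where "y'' = ext_add (ext_scale (1 / d) (ext_act p q ?k y')) (ext_scale (- (u powi v r) / d) y')"
    define c' where "c' x = (u powi x r - u powi v r) / d * c x" for x :: "nat \<Rightarrow> int"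
    have "y'' \<in> X" unfolding y''_def by (intro K_submoduleD[OF X] k y')
    moreover have "c' w' = 1" using d c by (simp add: c'_def d_def)
    moreover have "\<forall>x\<in>insert v \<Omega>. (\<exists>r<p+q. x r \<noteq> w' r) \<longrightarrow> c' x = 0" using c by (auto simp: c'_def)
    moreover have "\<forall>S\<in>Pow (ground p q). y'' S = c' (ext_weight S) * y S"
    proof
      fix S assume S: "S \<in> Pow (ground p q)"
      have "(\<Prod>s<p+q. circle r u s powi ext_weight S s) = (\<Prod>s<p+q. if s = r then u powi ext_weight S r else 1)"
        by (intro prod.cong) (auto simp: circle_def)
      then have "ext_act p q ?k y' S = u powi ext_weight S r * y' S"
        using ext_act_torus[of p q "circle r u" S y'] t S r by simp
      then show "y'' S = c' (ext_weight S) * y S"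
        using c(3) S d by (simp add: y''_def c'_def ext_add_def ext_scale_def field_simps)
    qed
    moreover have "\<forall>m. lk (T y'') m = c' (fock_weight p a b m) * lk (T y) m"
    proof
      fix m
      have "T y'' = const (1 / d) * fock_act p q a b ?k (T y') + const (- (u powi v r) / d) * T y'"
        unfolding y''_def using y' k
        by (simp only: Hom_KD[OF T] K_submoduleD[OF X])
      then have "lk (T y'') m = 1 / d * (u powi fock_weight p a b m r * lk (T y') m) + (- (u powi v r) / d) * lk (T y') m"
        using fock_act_circle[OF u(1) Hom_KD(1)[OF T y'] r(1)] by (simp add: lookup_add lookup_minus)
      then show "lk (T y'') m = c' (fock_weight p a b m) * lk (T y) m"
        using c(4) d by (simp add: c'_def field_simps)
    qed
    ultimately show ?thesis by blast
  qed
qed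

text \<open>
  A monomial of \<open>T y\<close> of weight \<open>w'\<close> forces the component of \<open>y\<close> of weight \<open>w'\<close> to be nonzero, so \<open>w'\<close> is
  a weight of \<open>X\<close>.
\<close>

lemma fock_weights_below:
  assumes T: "T \<in> Hom_K p q a b X" and V: "is_V_copy p q a b X"
    and y: "y \<in> X" and m: "m \<in> monoms (T y)"
  shows "weight_le p q (fock_weight p a b m) (V_weight p q a b)"
proof -
  note X = V_copyD[OF V]
  let ?w = "fock_weight p a b m"
  obtain y' c where y': "y' \<in> X" and c: "c ?w = (1::complex)"
    "\<forall>v\<in>ext_weight ` Pow (ground p q). (\<exists>r<p+q. v r \<noteq> ?w r) \<longrightarrow> c v = 0"
    "\<forall>S\<in>Pow (ground p q). y' S = c (ext_weight S) * y S"
    "\<forall>m. lk (T y') m = c (fock_weight p a b m) * lk (T y) m"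
    using weight_component[OF T X(2) y, of "ext_weight ` Pow (ground p q)" ?w] by auto
  have "lk (T y') m \<noteq> 0" using c m by (simp add: in_keys_iff)
  moreover have "T ext_zero = 0"
    using Hom_KD(3)[OF T K_submoduleD(1)[OF X(2)], of 0] by (simp add: ext_scale_def ext_zero_def)
  ultimately have nz: "y' \<noteq> ext_zero" by auto
  have "is_weight p q X ?w"
    unfolding is_weight_def
  proof (intro bexI[of _ y'] conjI allI impI nz y')
    fix t :: "nat \<Rightarrow> complex" assume t: "\<forall>r<p+q. cmod (t r) = 1"
    let ?k = "torus p q t"
    have k: "?k \<in> K_group p q" using t by (intro torus_in_K) auto
    have "ext_act p q ?k y' S = ext_scale (\<Prod>r<p+q. t r powi ?w r) y' S" for S
    proof (cases "S \<in> Pow (ground p q)")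
      case True
      have "ext_act p q ?k y' S = (\<Prod>r<p+q. t r powi ext_weight S r) * y' S"
        using t True by (intro ext_act_torus) auto
      also have "\<dots> = (\<Prod>r<p+q. t r powi ?w r) * y' S"
      proof (cases "y' S = 0")
        case False
        then have "c (ext_weight S) \<noteq> 0" using c(3) True by auto
        then have "ext_weight S r = ?w r" if "r < p + q" for r using c(2) True that by blast
        then show ?thesis by simp
      qed simp
      finally show ?thesis by (simp add: ext_scale_def)
    next
      case False
      have 1: "ext_act p q ?k y' \<in> X" by (intro K_submoduleD[OF X(2)] k y')
      have 2: "x S = 0" if "x \<in> X" for x
        using False that X(1) ext_bideg_0_outside by blast
      show ?thesis using 2[OF 1] 2[OF y'] by (simp add: ext_scale_def)
    qed
    then show "ext_act p q (mat_diag p t, mat_diag q (\<lambda>i. t (p + i))) y' = ext_scale (\<Prod>r<p+q. t r powi ?w r) y'"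
      by (auto simp: torus_def)
  qed
  then show ?thesis using X(4) by (simp add: has_highest_weight_def)
qed

definition hw_vector :: "nat \<Rightarrow> nat \<Rightarrow> nat \<Rightarrow> nat \<Rightarrow> (munit, complex) ext \<Rightarrow> bool" where
  "hw_vector p q a b x \<longleftrightarrow> x \<noteq> ext_zero \<and>
     (\<forall>t. (\<forall>r<p+q. cmod (t r) = 1) \<longrightarrow>
        ext_act p q (torus p q t) x = ext_scale (\<Prod>r<p+q. t r powi V_weight p q a b r) x)"

lemma prod_circle: "r < n \<Longrightarrow> (\<Prod>s<n. circle r u s powi w s) = u powi w r"
proof -
  assume "r < n"
  moreover have "(\<Prod>s<n. circle r u s powi w s) = (\<Prod>s<n. if s = r then u powi w r else 1)"
    by (intro prod.cong) (auto simp: circle_def)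
  ultimately show ?thesis by simp
qed

lemma hw_vector_exists:
  assumes "is_V_copy p q a b X"
  obtains x where "x \<in> X" "hw_vector p q a b x"
  using V_copyD(4)[OF assms] by (auto simp: has_highest_weight_def is_weight_def hw_vector_def torus_def)

lemma hw_image_weight:
  assumes T: "T \<in> Hom_K p q a b X" and x: "x \<in> X" "hw_vector p q a b x"
    and m: "m \<in> monoms (T x)" and r: "r < p + q"
  shows "fock_weight p a b m r = V_weight p q a b r"
proof (rule ccontr)
  assume "fock_weight p a b m r \<noteq> V_weight p q a b r"
  then obtain u :: complex where u: "cmod u = 1"
    "u powi fock_weight p a b m r \<noteq> u powi V_weight p q a b r"
    using separating_unit[of "fock_weight p a b m r" "V_weight p q a b r"] by blast
  let ?k = "torus p q (circle r u)"
  have t: "\<forall>s<p+q. cmod (circle r u s) = 1" using u by (simp add: circle_def)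
  then have k: "?k \<in> K_group p q" by (intro torus_in_K) auto
  have "fock_act p q a b ?k (T x) = T (ext_act p q ?k x)" using Hom_KD(4)[OF T k x(1)] ..
  also have "\<dots> = const (u powi V_weight p q a b r) * T x"
    using x t r by (simp add: hw_vector_def prod_circle Hom_KD(3)[OF T])
  finally have "u powi fock_weight p a b m r * lk (T x) m = u powi V_weight p q a b r * lk (T x) m"
    using fock_act_circle[OF u(1) Hom_KD(1)[OF T x(1)] r, of m] by auto
  then show False using u m by (auto simp: in_keys_iff)
qed

text \<open>
  The weight requires, in \<open>S\<close>, at least \<open>q\<close> generators \<open>E r \<mu>\<close> for every \<open>r < b\<close> and at least \<open>q\<close> generators
  \<open>E \<mu> r\<close> for every \<open>r \<ge> p - a\<close>.  There are no more than \<open>q\<close> of each, and together they already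
  exhaust the bidegree.
\<close>

lemma hw_vector_support:
  assumes ab: "a + b \<le> p" and x: "x \<in> ext_bideg p q (b * q) (a * q)" "hw_vector p q a b x"
    and S: "x S \<noteq> 0"
  shows "S = top_set p q a b"
proof -
  have SG: "S \<in> Pow (ground p q)" by (rule card_ext_bideg(1)[OF x(1) S])
  have fin: "finite S" using SG finite_ground by (auto intro: finite_subset)
  have c1: "card (S \<inter> p_prime p q) = b * q" and c2: "card (S \<inter> p_dprime p q) = a * q"
    using x(1) S by (auto simp: ext_bideg_def)
  have w: "ext_weight S r = V_weight p q a b r" if r: "r < p + q" for r
  proof (rule ccontr)
    assume "ext_weight S r \<noteq> V_weight p q a b r"
    then obtain u :: complex where u: "cmod u = 1"
      "u powi ext_weight S r \<noteq> u powi V_weight p q a b r"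
      using separating_unit[of "ext_weight S r" "V_weight p q a b r"] by blast
    have t: "\<forall>s<p+q. cmod (circle r u s) = 1" using u by (simp add: circle_def)
    have "ext_act p q (torus p q (circle r u)) x S = u powi V_weight p q a b r * x S"
      using x(2) t r by (simp add: hw_vector_def prod_circle ext_scale_def)
    moreover have "ext_act p q (torus p q (circle r u)) x S = u powi ext_weight S r * x S"
      using ext_act_torus[of p q "circle r u" S x] t SG r by (simp add: prod_circle)
    ultimately show False using u S by simp
  qed
  let ?row = "\<lambda>r. {e \<in> S. unit_row e = r}" and ?col = "\<lambda>r. {e \<in> S. unit_col e = r}"
  have row_sub: "?row r \<subseteq> E r ` {p..<p+q}" if "r < p" for r
    using that SG by (auto simp: ground_def p_prime_def p_dprime_def)
  have col_sub: "?col r \<subseteq> (\<lambda>s. E s r) ` {p..<p+q}" if "r < p" for r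
    using that SG by (auto simp: ground_def p_prime_def p_dprime_def)
  have row: "?row r = E r ` {p..<p+q}" if r: "r < b" for r
  proof (rule card_seteq)
    have "int (card (?row r)) - int (card (?col r)) = int q"
      using w[of r] r ab by (simp add: ext_weight_def V_weight_def)
    then have "q \<le> card (?row r)" by linarith
    then show "card (E r ` {p..<p+q}) \<le> card (?row r)" by (simp add: card_image inj_on_def)
  qed (use row_sub r ab in auto)
  have col: "?col r = (\<lambda>s. E s r) ` {p..<p+q}" if r: "p - a \<le> r" "r < p" for r
  proof (rule card_seteq)
    have "int (card (?row r)) - int (card (?col r)) = - int q"
      using w[of r] r ab by (simp add: ext_weight_def V_weight_def)
    then have "q \<le> card (?col r)" by linarith
    then show "card ((\<lambda>s. E s r) ` {p..<p+q}) \<le> card (?col r)" by (simp add: card_image inj_on_def)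
  qed (use col_sub r in auto)
  let ?A = "{E r s | r s. r < b \<and> p \<le> s \<and> s < p + q}"
  let ?B = "{E s r | r s. p - a \<le> r \<and> r < p \<and> p \<le> s \<and> s < p + q}"
  have "?A = S \<inter> p_prime p q"
  proof (rule card_subset_eq)
    show "?A \<subseteq> S \<inter> p_prime p q"
    proof
      fix e assume "e \<in> ?A"
      then obtain r s where e: "e = E r s" "r < b" "p \<le> s" "s < p + q" by auto
      then have "e \<in> ?row r" using row[of r] by auto
      then show "e \<in> S \<inter> p_prime p q" using e ab by (auto simp: p_prime_def)
    qed
    have "?A = (\<lambda>(r, s). E r s) ` ({..<b} \<times> {p..<p+q})" by auto
    then have "card ?A = b * q" by (simp add: card_image inj_on_def card_cartesian_product)
    then show "card ?A = card (S \<inter> p_prime p q)" using c1 by simp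
  qed (use fin in auto)
  moreover have "?B = S \<inter> p_dprime p q"
  proof (rule card_subset_eq)
    show "?B \<subseteq> S \<inter> p_dprime p q"
    proof
      fix e assume "e \<in> ?B"
      then obtain r s where e: "e = E s r" "p - a \<le> r" "r < p" "p \<le> s" "s < p + q" by auto
      then have "e \<in> ?col r" using col[of r] by auto
      then show "e \<in> S \<inter> p_dprime p q" using e by (auto simp: p_dprime_def)
    qed
    have "?B = (\<lambda>(r, s). E s r) ` ({p - a..<p} \<times> {p..<p+q})" by auto
    then have "card ?B = a * q" using ab by (simp add: card_image inj_on_def card_cartesian_product)
    then show "card ?B = card (S \<inter> p_dprime p q)" using c2 by simp
  qed (use fin in auto)
  moreover have "S = (S \<inter> p_prime p q) \<union> (S \<inter> p_dprime p q)" using SG by (auto simp: ground_def)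
  ultimately show ?thesis by (simp add: top_set_def)
qed

lemma psi_hw_vector_nonzero:
  assumes ab: "a + b \<le> p" and x: "x \<in> ext_bideg p q (b * q) (a * q)" "hw_vector p q a b x"
  shows "psi p q a b x \<noteq> 0"
proof -
  let ?S = "top_set p q a b"
  have supp: "x S = 0" if "S \<noteq> ?S" for S using hw_vector_support[OF ab x] that by blast
  have "x \<noteq> ext_zero" using x by (simp add: hw_vector_def)
  then have nz: "x ?S \<noteq> 0" using supp by (auto simp: ext_zero_def fun_eq_iff) metis
  have "?S \<in> Pow (ground p q)" by (rule card_ext_bideg(1)[OF x(1) nz])
  then have "psi p q a b x = (\<Sum>S\<in>{?S}. const (x S) * psi_form p q a b S)"
    unfolding psi_eq by (intro sum.mono_neutral_right) (auto simp: supp)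
  then show ?thesis using nz psi_form_top_nonzero[OF ab, of q] by simp
qed

lemma psi_Hom_K:
  assumes V: "is_V_copy p q a b X"
  shows "restrict (psi p q a b) X \<in> Hom_K p q a b X"
proof -
  note X = V_copyD[OF V]
  have add: "psi p q a b (ext_add x y) = psi p q a b x + psi p q a b y" for x y
    by (simp add: psi_eq ext_add_def sum.distrib[symmetric] distrib_right[symmetric])
  have scale: "psi p q a b (ext_scale c x) = const c * psi p q a b x" for c x
    by (simp add: psi_eq ext_scale_def sum_distrib_left const_mult_const)
  have fock: "psi p q a b x \<in> fock p q a b" for x using psi_deg by blast
  have equiv: "psi p q a b (ext_act p q k x) = fock_act p q a b k (psi p q a b x)"
    if "k \<in> K_group p q" "x \<in> X" for k x
    using that X(1) by (intro psi_equivariant) auto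
  show ?thesis
    unfolding Hom_K_def mem_Collect_eq
    by (intro conjI ballI allI) (simp_all add: fock add scale equiv K_submoduleD[OF X(2)])
qed

subsection \<open>Rotations and raising operators\<close>

definition rot_entry :: "nat \<Rightarrow> nat \<Rightarrow> real \<Rightarrow> nat \<Rightarrow> nat \<Rightarrow> complex" where
  "rot_entry r s \<theta> i j =
     (if i = r then (if j = r then of_real (cos \<theta>) else if j = s then - of_real (sin \<theta>) else 0)
      else if i = s then (if j = r then of_real (sin \<theta>) else if j = s then of_real (cos \<theta>) else 0)
      else if j = i then 1 else 0)"

lemma rot_unitary:
  assumes rs: "r < n" "s < n" "r \<noteq> s"
  shows "mat n n (\<lambda>(i, j). rot_entry r s \<theta> i j) \<in> unitary_group n"
proof (rule unitary_group_of_rows)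
  have cs: "(of_real (sin \<theta>) :: complex) * of_real (sin \<theta>) + of_real (cos \<theta>) * of_real (cos \<theta>) = 1"
    by (metis of_real_1 of_real_add of_real_mult power2_eq_square sin_cos_squared_add)
  have cs': "(of_real (cos \<theta>) :: complex) * of_real (cos \<theta>) + of_real (sin \<theta>) * of_real (sin \<theta>) = 1"
    using cs by (simp only: add.commute)
  have row: "(\<Sum>k<n. rot_entry r s \<theta> i k * x k) =
     (if i = r then of_real (cos \<theta>) * x r - of_real (sin \<theta>) * x s
      else if i = s then of_real (sin \<theta>) * x r + of_real (cos \<theta>) * x s else x i)" if "i < n" for i x
  proof -
    have "(\<Sum>k<n. rot_entry r s \<theta> i k * x k) = (\<Sum>k<n.
       (if k = r then rot_entry r s \<theta> i r * x r else 0) + (if k = s then rot_entry r s \<theta> i s * x s else 0)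
       + (if k = i then (if i = r \<or> i = s then 0 else x i) else 0))"
      using rs by (intro sum.cong) (auto simp: rot_entry_def)
    then show ?thesis using rs that by (simp add: sum.distrib) (simp add: rot_entry_def)
  qed
  fix i j assume ij: "i < n" "j < n"
  have "(\<Sum>k<n. mat n n (\<lambda>(i, j). rot_entry r s \<theta> i j) $$ (i, k) *
      cnj (mat n n (\<lambda>(i, j). rot_entry r s \<theta> i j) $$ (j, k))) =
      (\<Sum>k<n. rot_entry r s \<theta> i k * cnj (rot_entry r s \<theta> j k))"
    using ij by (intro sum.cong) auto
  also have "\<dots> = (if i = j then 1 else 0)"
    unfolding row[OF ij(1)] using rs
    by (cases "i = r"; cases "i = s"; cases "j = r"; cases "j = s")
       (simp_all add: rot_entry_def cs cs' mult.commute[of "of_real (cos \<theta>)" "of_real (sin \<theta>)"])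
  finally show "(\<Sum>k<n. mat n n (\<lambda>(i, j). rot_entry r s \<theta> i j) $$ (i, k) *
      cnj (mat n n (\<lambda>(i, j). rot_entry r s \<theta> i j) $$ (j, k))) = (if i = j then 1 else 0)" .
qed simp

definition rotation :: "nat \<Rightarrow> nat \<Rightarrow> nat \<Rightarrow> nat \<Rightarrow> real \<Rightarrow> complex mat \<times> complex mat" where
  "rotation p q r s \<theta> = (if s < p then (mat p p (\<lambda>(i, j). rot_entry r s \<theta> i j), 1\<^sub>m q)
     else (1\<^sub>m p, mat q q (\<lambda>(i, j). rot_entry (r - p) (s - p) \<theta> i j)))"

definition same_block :: "nat \<Rightarrow> nat \<Rightarrow> nat \<Rightarrow> nat \<Rightarrow> bool" where
  "same_block p q r s \<longleftrightarrow> r < p \<and> s < p \<or> p \<le> r \<and> r < p + q \<and> p \<le> s \<and> s < p + q"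

lemma one_unitary: "1\<^sub>m n \<in> unitary_group n"
proof (rule unitary_group_of_rows)
  fix i j assume "i < n" "j < n"
  moreover from this have "(\<Sum>k<n. 1\<^sub>m n $$ (i, k) * cnj (1\<^sub>m n $$ (j, k))) = (\<Sum>k<n. if k = i then (if i = j then 1 else 0) else 0 :: complex)"
    by (intro sum.cong) auto
  ultimately show "(\<Sum>k<n. 1\<^sub>m n $$ (i, k) * cnj (1\<^sub>m n $$ (j, k))) = (if i = j then 1 else (0 :: complex))" by simp
qed simp

lemma rotation_in_K:
  assumes "same_block p q r s" "r < s"
  shows "rotation p q r s \<theta> \<in> K_group p q"
  using assms rot_unitary[of r p s \<theta>] rot_unitary[of "r - p" q "s - p" \<theta>] one_unitary[of p] one_unitary[of q]
  by (auto simp: rotation_def K_group_iff same_block_def)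

lemma block_rotation:
  assumes "same_block p q r s" "r < s" "i < p + q" "j < p + q"
  shows "block (rotation p q r s \<theta>) $$ (i, j) = rot_entry r s \<theta> i j"
proof -
  have "fst (rotation p q r s \<theta>) \<in> carrier_mat p p" "snd (rotation p q r s \<theta>) \<in> carrier_mat q q"
    by (auto simp: rotation_def)
  note * = block_entry[OF this assms(3,4)]
  show ?thesis
  proof -
    have e: "(x - p = y - p) = (x = y)" if "p \<le> x" "p \<le> y" for x y using that by auto
    show ?thesis
      unfolding * using assms
      by (cases "s < p"; cases "i < p"; cases "j < p")
         (auto simp: rotation_def same_block_def rot_entry_def e)
  qed
qed

text \<open>
  Coefficientwise derivatives at 0 suffice, since only single coefficients are compared.
\<close>

definition poly_deriv_at0 :: "(real \<Rightarrow> fpoly) \<Rightarrow> fpoly \<Rightarrow> bool" where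
  "poly_deriv_at0 F F' \<longleftrightarrow> (\<forall>m. ((\<lambda>\<theta>. lk (F \<theta>) m) has_vector_derivative lk F' m) (at 0))"

lemma poly_deriv_linear_mult:
  assumes c: "\<And>x. x \<in> A \<Longrightarrow> ((\<lambda>\<theta>. c \<theta> x) has_vector_derivative c' x) (at 0)"
    and F: "poly_deriv_at0 F F'"
  shows "poly_deriv_at0 (\<lambda>\<theta>. (\<Sum>x\<in>A. const (c \<theta> x) * var (d x)) * F \<theta>)
     ((\<Sum>x\<in>A. const (c' x) * var (d x)) * F 0 + (\<Sum>x\<in>A. const (c 0 x) * var (d x)) * F')"
  unfolding poly_deriv_at0_def
proof
  fix m
  have L: "lk ((\<Sum>x\<in>A. const (c x) * var (d x)) * G) m = (\<Sum>x\<in>A. c x * lk (var (d x) * G) m)"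
    for c :: "_ \<Rightarrow> complex" and G
    by (simp add: sum_distrib_right lookup_sum mult.assoc)
  have F1: "((\<lambda>\<theta>. lk (var v * F \<theta>) m) has_vector_derivative lk (var v * F') m) (at 0)" for v
    using F by (cases "lk m v = 0") (simp_all add: lookup_var_mult poly_deriv_at0_def)
  have "((\<lambda>\<theta>. \<Sum>x\<in>A. c \<theta> x * lk (var (d x) * F \<theta>) m) has_vector_derivative
      (\<Sum>x\<in>A. c 0 x * lk (var (d x) * F') m + c' x * lk (var (d x) * F 0) m)) (at 0)"
    using c F1 by (intro has_vector_derivative_sum has_vector_derivative_mult) auto
  then show "((\<lambda>\<theta>. lk ((\<Sum>x\<in>A. const (c \<theta> x) * var (d x)) * F \<theta>) m) has_vector_derivative
     lk ((\<Sum>x\<in>A. const (c' x) * var (d x)) * F 0 + (\<Sum>x\<in>A. const (c 0 x) * var (d x)) * F') m) (at 0)"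
    by (simp add: L lookup_add sum.distrib add.commute)
qed

text \<open>
  A curve of linear substitutions through the identity acts infinitesimally by a derivation.
\<close>

lemma poly_deriv_psubst:
  assumes f: "f \<in> polys_in V" and V: "finite V"
    and \<sigma>: "\<And>\<theta> v. v \<in> V \<Longrightarrow> \<sigma> \<theta> v = (\<Sum>x\<in>A. const (c v \<theta> x) * var (d v x))"
    and \<sigma>0: "\<And>v. v \<in> V \<Longrightarrow> \<sigma> 0 v = var v"
    and c: "\<And>v x. v \<in> V \<Longrightarrow> x \<in> A \<Longrightarrow> ((\<lambda>\<theta>. c v \<theta> x) has_vector_derivative c' v x) (at 0)"
  shows "psubst (\<sigma> 0) f = f \<and>
     poly_deriv_at0 (\<lambda>\<theta>. psubst (\<sigma> \<theta>) f) (\<Sum>v\<in>V. (\<Sum>x\<in>A. const (c' v x) * var (d v x)) * pdiff v f)"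
  using f
proof (induction rule: polys_in_induct)
  case (const c)
  then show ?case by (simp add: poly_deriv_at0_def)
next
  case (add f g)
  then show ?case
    by (auto simp: poly_deriv_at0_def psubst_add lookup_add pdiff_add ring_distribs sum.distrib
        intro: has_vector_derivative_add)
next
  case (var v f)
  let ?J = "\<lambda>v. \<Sum>x\<in>A. const (c' v x) * var (d v x)"
  have "poly_deriv_at0 (\<lambda>\<theta>. \<sigma> \<theta> v * psubst (\<sigma> \<theta>) f)
      (?J v * psubst (\<sigma> 0) f + \<sigma> 0 v * (\<Sum>w\<in>V. ?J w * pdiff w f))"
    unfolding \<sigma>[OF var(1)] using var c by (intro poly_deriv_linear_mult) auto
  moreover have "(\<Sum>w\<in>V. ?J w * pdiff w (var v * f)) = (\<Sum>w\<in>V. (if w = v then ?J v * f else 0) + var v * (?J w * pdiff w f))"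
    by (intro sum.cong refl) (auto simp: pdiff_var_mult distrib_left mult.left_commute[of _ "var v"])
  then have "(\<Sum>w\<in>V. ?J w * pdiff w (var v * f)) = ?J v * f + var v * (\<Sum>w\<in>V. ?J w * pdiff w f)"
    using V var(1) by (simp add: sum.distrib sum_distrib_left)
  ultimately show ?case using var by (simp add: psubst_var_mult \<sigma>0)
qed

lemma rotation_derivative:
  assumes f: "f \<in> fock p q a b" and rs: "same_block p q r s" "r < s"
  shows "poly_deriv_at0 (\<lambda>\<theta>. psubst (coord_act p q a (rotation p q r s \<theta>)) f)
     (\<Sum>l<a+b. var (Z s l) * pdiff (Z r l) f - var (Z r l) * pdiff (Z s l) f)"
proof -
  define J where "J i j = (if i = r \<and> j = s then - 1 else if i = s \<and> j = r then 1 else 0 :: complex)" for i j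
  define d where "d v x = (case v of Z r' l \<Rightarrow> Z x l)" for v x
  define c where "c v \<theta> x = (case v of Z r' l \<Rightarrow> rot_entry r s \<theta> x r')" for v \<theta> x
  define c' where "c' v x = (case v of Z r' l \<Rightarrow> J x r')" for v x
  have rs': "r < p + q" "s < p + q" "r \<noteq> s" using rs by (auto simp: same_block_def)
  have cnj_rot: "cnj (rot_entry r s \<theta> i j) = rot_entry r s \<theta> i j" for \<theta> i j by (simp add: rot_entry_def)
  have \<sigma>: "coord_act p q a (rotation p q r s \<theta>) v = (\<Sum>x\<in>{..<p+q}. const (c v \<theta> x) * var (d v x))"
    if "v \<in> fvars p q a b" for \<theta> v
  proof -
    obtain r' l where v: "v = Z r' l" "r' < p + q" using \<open>v \<in> fvars p q a b\<close> by (auto simp: fvars_def)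
    show ?thesis unfolding v(1) coord_act_Z using v(2)
      by (intro sum.cong refl) (auto simp: coord_coeff_def block_rotation[OF rs] cnj_rot c_def d_def)
  qed
  have \<sigma>0: "coord_act p q a (rotation p q r s 0) v = var v" if "v \<in> fvars p q a b" for v
  proof -
    obtain r' l where v: "v = Z r' l" "r' < p + q" using \<open>v \<in> fvars p q a b\<close> by (auto simp: fvars_def)
    have "coord_act p q a (rotation p q r s 0) v = (\<Sum>x<p+q. if x = r' then var v else 0)"
      unfolding \<sigma>[OF that] using rs'
      by (intro sum.cong refl) (auto simp: v c_def d_def rot_entry_def)
    then show ?thesis using v by simp
  qed
  have cd: "((\<lambda>\<theta>. c v \<theta> x) has_vector_derivative c' v x) (at 0)" for v x
  proof -
    obtain r' l where v: "v = Z r' l" by (cases v)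
    have C: "((\<lambda>\<theta>. complex_of_real (cos \<theta>)) has_vector_derivative 0) (at 0)"
      by (rule has_vector_derivative_eq_rhs[OF has_vector_derivative_of_real])
         (auto intro!: derivative_eq_intros)
    have S: "((\<lambda>\<theta>. complex_of_real (sin \<theta>)) has_vector_derivative 1) (at 0)"
      by (rule has_vector_derivative_eq_rhs[OF has_vector_derivative_of_real])
         (auto intro!: derivative_eq_intros)
    have S': "((\<lambda>\<theta>. - complex_of_real (sin \<theta>)) has_vector_derivative - 1) (at 0)"
      using has_vector_derivative_minus[OF S] .
    show ?thesis using rs'(3)
      by (cases "x = r"; cases "x = s"; cases "r' = r"; cases "r' = s")
         (simp_all add: v c_def c'_def rot_entry_def J_def C S S')
  qed
  have "(\<Sum>v\<in>fvars p q a b. (\<Sum>x<p+q. const (c' v x) * var (d v x)) * pdiff v f) =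
      (\<Sum>r'<p+q. \<Sum>l<a+b. (\<Sum>x<p+q. const (J x r') * var (Z x l)) * pdiff (Z r' l) f)"
    by (simp add: sum_fvars c'_def d_def)
  also have "\<dots> = (\<Sum>l<a+b. \<Sum>r'<p+q. (\<Sum>x<p+q. const (J x r') * var (Z x l)) * pdiff (Z r' l) f)"
    by (rule sum.swap)
  also have "\<dots> = (\<Sum>l<a+b. var (Z s l) * pdiff (Z r l) f - var (Z r l) * pdiff (Z s l) f)"
  proof (intro sum.cong refl)
    fix l
    have "(\<Sum>x<p+q. const (J x r') * var (Z x l)) =
        (if r' = r then var (Z s l) else if r' = s then - var (Z r l) else 0)" if "r' < p + q" for r'
    proof -
      have "(\<Sum>x<p+q. const (J x r') * var (Z x l)) = (\<Sum>x<p+q. (if x = s then (if r' = r then var (Z s l) else 0) else 0)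
          + (if x = r then (if r' = s then - var (Z r l) else 0) else 0))"
        using rs'(3) by (intro sum.cong refl) (auto simp: J_def simp flip: const_hom(5))
      then show ?thesis using rs' by (simp add: sum.distrib)
    qed
    then have "(\<Sum>r'<p+q. (\<Sum>x<p+q. const (J x r') * var (Z x l)) * pdiff (Z r' l) f) =
        (\<Sum>r'<p+q. (if r' = r then var (Z s l) * pdiff (Z r l) f else 0)
           + (if r' = s then - (var (Z r l) * pdiff (Z s l) f) else 0))"
      using rs'(3) by (intro sum.cong refl) auto
    then show "(\<Sum>r'<p+q. (\<Sum>x<p+q. const (J x r') * var (Z x l)) * pdiff (Z r' l) f) =
        var (Z s l) * pdiff (Z r l) f - var (Z r l) * pdiff (Z s l) f"
      using rs' by (simp add: sum.distrib)
  qed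
  finally show ?thesis
    using poly_deriv_psubst[where V = "fvars p q a b" and A = "{..<p+q}" and f = f and c = c and c' = c' and d = d
        and \<sigma> = "\<lambda>\<theta>. coord_act p q a (rotation p q r s \<theta>)"]
      f \<sigma> \<sigma>0 cd by (simp add: fock_eq)
qed

lemma monoms_var_pdiff:
  assumes "m \<in> monoms (var u * pdiff v f)"
  shows "\<exists>m0\<in>monoms f. m + unit_exp v = m0 + unit_exp u"
proof (rule bexI)
  have u: "lk m u \<noteq> 0" and f: "lk f (m - unit_exp u + unit_exp v) \<noteq> 0"
    using assms by (auto simp: in_keys_iff lookup_var_mult lookup_pdiff split: if_splits)
  show "m + unit_exp v = m - unit_exp u + unit_exp v + unit_exp u"
    using u by (intro poly_mapping_eqI) (auto simp: exp_simps)
  show "m - unit_exp u + unit_exp v \<in> monoms f" using f by (simp add: in_keys_iff)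
qed

lemma fock_weight_add_unit:
  assumes "k < a + b"
  shows "fock_weight p a b (m + unit_exp (Z x k)) r =
    fock_weight p a b m r + (if x = r then (if same_sign p a r k then - 1 else 1) else 0)"
proof -
  let ?\<epsilon> = "\<lambda>l. if same_sign p a r l then - 1 else 1 :: int"
  have "(\<Sum>l<a+b. ?\<epsilon> l * int (lk (m + unit_exp (Z x k)) (Z r l))) =
      (\<Sum>l<a+b. ?\<epsilon> l * int (lk m (Z r l)) + (if l = k then (if x = r then ?\<epsilon> k else 0) else 0))"
    by (intro sum.cong refl) (auto simp: lookup_add lookup_single when_def)
  then show ?thesis using assms by (simp add: fock_weight_def sum.distrib)
qed

lemma weight_polarize:
  assumes "m \<in> monoms (polarize C x y f)" and w: "\<And>m. m \<in> monoms f \<Longrightarrow> fock_weight p a b m i = w"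
    and C: "\<And>k. k \<in> C \<Longrightarrow> k < a + b \<and> same_sign p a x k = \<sigma> \<and> same_sign p a y k = \<sigma>"
  shows "fock_weight p a b m i = w + (if \<sigma> then - 1 else 1) * (of_bool (i = x) - of_bool (i = y))"
proof -
  obtain k where k: "k \<in> C" "m \<in> monoms (var (Z x k) * pdiff (Z y k) f)"
    using assms(1) keys_sum[of "\<lambda>k. var (Z x k) * pdiff (Z y k) f" C] unfolding polarize_def by blast
  obtain m0 where m0: "m0 \<in> monoms f" "m + unit_exp (Z y k) = m0 + unit_exp (Z x k)"
    using monoms_var_pdiff[OF k(2)] by blast
  have "fock_weight p a b (m + unit_exp (Z y k)) i = fock_weight p a b (m0 + unit_exp (Z x k)) i"
    by (simp only: m0)
  then show ?thesis
    using w[OF m0(1)] C[OF k(1)] by (auto simp: fock_weight_add_unit split: if_splits)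
qed

text \<open>
  A sum of positive roots has nonnegative partial sums of coordinates; minus \<open>\<epsilon>\<^sub>r - \<epsilon>\<^sub>s\<close> has
  the partial sum -1 at \<open>r\<close>.
\<close>

lemma not_weight_le_raised:
  assumes rs: "r < s" "s < p + q"
    and w': "\<And>i. i < p + q \<Longrightarrow> w' i = w i + of_bool (i = r) - of_bool (i = s)"
  shows "\<not> weight_le p q w' w"
proof
  assume "weight_le p q w' w"
  then obtain c :: "nat \<Rightarrow> nat" where c: "\<forall>i<p+q. w i - w' i =
      (\<Sum>j \<in> {j. Suc j < p \<or> p \<le> j \<and> Suc j < p + q}. int (c j) * (of_bool (i = j) - of_bool (i = Suc j)))"
    by (auto simp: weight_le_def)
  let ?J = "{j. Suc j < p \<or> p \<le> j \<and> Suc j < p + q}"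
  have "(\<Sum>i<Suc r. w i - w' i) = (\<Sum>i<Suc r. if i = r then - 1 else 0)"
    using rs w' by (intro sum.cong) auto
  then have "(\<Sum>i<Suc r. w i - w' i) = - 1" by simp
  moreover have "(\<Sum>i<Suc r. w i - w' i) = (\<Sum>i<Suc r. \<Sum>j\<in>?J. int (c j) * (of_bool (i = j) - of_bool (i = Suc j)))"
    using rs c by (intro sum.cong) auto
  moreover have "\<dots> = (\<Sum>j\<in>?J. \<Sum>i<Suc r. int (c j) * (of_bool (i = j) - of_bool (i = Suc j)))"
    by (rule sum.swap)
  moreover have "\<dots> \<ge> 0"
  proof (rule sum_nonneg)
    fix j
    have "(\<Sum>i<n. of_bool (i = k)) = (of_bool (k < n) :: int)" for n k :: nat
      by (induction n) (auto simp: less_Suc_eq)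
    then have "(\<Sum>i<Suc r. int (c j) * (of_bool (i = j) - of_bool (i = Suc j))) =
        int (c j) * (of_bool (j < Suc r) - of_bool (Suc j < Suc r))"
      by (simp only: sum_distrib_left[symmetric] sum_subtractf)
    then show "(\<Sum>i<Suc r. int (c j) * (of_bool (i = j) - of_bool (i = Suc j))) \<ge> 0" by simp
  qed
  ultimately show False by linarith
qed

text \<open>
  The rotations in the plane of \<open>r\<close> and \<open>s\<close> have as derivative the difference of the lowering operator \<open>h\<close>
  and the raising operator \<open>g\<close>.  A rotated highest weight vector has no component of the
  raised weight, so the derivative has none either; and \<open>h\<close> produces a different weight.
  The raising operator consists of a polarization in the columns \<open>Pl\<close>, whose coordinates transform like
  \<open>V''\<close>, and the negative of an opposite one in the columns \<open>Mi\<close>.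
\<close>

lemma hw_image_raising:
  assumes T: "T \<in> Hom_K p q a b X" and V: "is_V_copy p q a b X"
    and x: "x \<in> X" "hw_vector p q a b x" and rs: "same_block p q r s" "r < s"
    and Pl: "Pl = {l. l < a + b \<and> \<not> same_sign p a r l}" and Mi: "Mi = {l. l < a + b \<and> same_sign p a r l}"
  shows "polarize Pl r s (T x) = polarize Mi s r (T x)"
proof -
  let ?f = "T x"
  have f: "?f \<in> fock p q a b" by (rule Hom_KD(1)[OF T x(1)])
  have rs': "r < p + q" "s < p + q" using rs by (auto simp: same_block_def)
  have sgn: "same_sign p a s l = same_sign p a r l" for l using rs by (auto simp: same_block_def same_sign_def)
  define g where "g = polarize Pl r s ?f - polarize Mi s r ?f"
  define h where "h = polarize Pl s r ?f - polarize Mi r s ?f"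
  let ?D = "\<Sum>l<a+b. var (Z s l) * pdiff (Z r l) ?f - var (Z r l) * pdiff (Z s l) ?f"
  have D: "?D = h - g"
  proof -
    have "(\<Sum>l<a+b. F l) = sum F Pl + sum F Mi" for F :: "nat \<Rightarrow> fpoly"
      unfolding Pl Mi by (subst sum.union_disjoint[symmetric]) (auto intro: sum.cong)
    then show ?thesis by (simp add: g_def h_def polarize_def sum_subtractf)
  qed
  note w = hw_image_weight[OF T x]
  have PM: "k < a + b \<and> same_sign p a x k = \<sigma> \<and> same_sign p a y k = \<sigma>"
    if "x \<in> {r, s}" "y \<in> {r, s}" "k \<in> (if \<sigma> then Mi else Pl)" for x y k \<sigma>
    using that sgn by (auto simp: Pl Mi split: if_splits)
  have wg: "fock_weight p a b m i = V_weight p q a b i + of_bool (i = r) - of_bool (i = s)"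
    if m: "m \<in> monoms g" and i: "i < p + q" for m i
  proof -
    have "m \<in> monoms (polarize Pl r s ?f) \<union> monoms (polarize Mi s r ?f)"
      using m keys_diff[of "polarize Pl r s ?f" "polarize Mi s r ?f"] by (auto simp: g_def)
    then show ?thesis
      using weight_polarize[of m Pl r s ?f p a b i _ False] weight_polarize[of m Mi s r ?f p a b i _ True]
        w i PM[of r s _ False] PM[of s r _ True] by auto
  qed
  have wh: "fock_weight p a b m r = V_weight p q a b r - 1" if m: "m \<in> monoms h" for m
  proof -
    have "m \<in> monoms (polarize Pl s r ?f) \<union> monoms (polarize Mi r s ?f)"
      using m keys_diff[of "polarize Pl s r ?f" "polarize Mi r s ?f"] by (auto simp: h_def)
    then show ?thesis
      using weight_polarize[of m Pl s r ?f p a b r _ False] weight_polarize[of m Mi r s ?f p a b r _ True]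
        w rs' rs PM[of s r _ False] PM[of r s _ True] by auto
  qed
  have "monoms g = {}"
  proof (rule ccontr)
    assume "monoms g \<noteq> {}"
    then obtain m where m: "m \<in> monoms g" by (meson ex_in_conv)
    have "fock_weight p a b m r = V_weight p q a b r + 1"
      using wg[OF m rs'(1)] rs by simp
    then have "m \<notin> monoms h" using wh[of m] by auto
    have nle: "\<not> weight_le p q (fock_weight p a b m) (V_weight p q a b)"
      using wg[OF m] by (intro not_weight_le_raised[OF rs(2) rs'(2)])
    have zero: "lk (psubst (coord_act p q a (rotation p q r s \<theta>)) ?f) m = 0" for \<theta>
    proof -
      let ?k = "rotation p q r s \<theta>"
      have k: "?k \<in> K_group p q" by (rule rotation_in_K[OF rs])
      have "ext_act p q ?k x \<in> X" by (rule K_submoduleD(4)[OF V_copyD(2)[OF V] k x(1)])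
      then have "m \<notin> monoms (T (ext_act p q ?k x))" using fock_weights_below[OF T V] nle by blast
      then have "lk (fock_act p q a b ?k ?f) m = 0" by (simp add: Hom_KD(4)[OF T k x(1)] in_keys_iff)
      moreover have "det (snd ?k) \<noteq> 0"
        using det_unitary(1)[of "snd ?k" q] k by (auto simp: K_group_iff)
      ultimately show ?thesis by (simp add: fock_act_def)
    qed
    have "((\<lambda>\<theta>. lk (psubst (coord_act p q a (rotation p q r s \<theta>)) ?f) m) has_vector_derivative lk ?D m) (at 0)"
      using rotation_derivative[OF f rs] unfolding poly_deriv_at0_def by blast
    then have "((\<lambda>\<theta>::real. 0) has_vector_derivative lk ?D m) (at 0)"
      by (simp only: zero)
    then have "((\<lambda>\<theta>::real. 0 :: complex) has_derivative (\<lambda>t. t *\<^sub>R lk ?D m)) (at 0)"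
      by (simp only: has_vector_derivative_def)
    then have "(\<lambda>t::real. t *\<^sub>R lk ?D m) = (\<lambda>t. 0)" by (rule has_derivative_zero_unique)
    from fun_cong[OF this, of 1] have "lk ?D m = 0" by simp
    then have "lk h m = lk g m" by (simp add: D lookup_minus)
    then show False using m \<open>m \<notin> monoms h\<close> by (simp add: in_keys_iff)
  qed
  then show ?thesis by (simp add: g_def)
qed

section \<open>Uniqueness of the harmonic highest weight vector\<close>

definition plus_deg :: "nat \<Rightarrow> nat \<Rightarrow> (fvar \<Rightarrow>\<^sub>0 nat) \<Rightarrow> nat \<Rightarrow> nat" where
  "plus_deg a b m r = (\<Sum>l\<in>{a..<a+b}. lk m (Z r l))"

definition minus_deg :: "nat \<Rightarrow> (fvar \<Rightarrow>\<^sub>0 nat) \<Rightarrow> nat \<Rightarrow> nat" where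
  "minus_deg a m r = (\<Sum>k<a. lk m (Z r k))"

lemma sum_columns_split:
  fixes F :: "nat \<Rightarrow> 'a::comm_monoid_add"
  shows "(\<Sum>k<a+b. F k) = (\<Sum>k<a. F k) + (\<Sum>l\<in>{a..<a+b}. F l)"
  by (subst sum.union_disjoint[symmetric]) (auto intro!: sum.cong)

lemma fock_weight_eq:
  "fock_weight p a b m r = (if r < p then int (plus_deg a b m r) - int (minus_deg a m r)
     else int (minus_deg a m r) - int (plus_deg a b m r) + int a - int b)"
  unfolding fock_weight_def sum_columns_split plus_deg_def minus_deg_def
  by (auto simp: same_sign_def sum_negf)

lemma total_deg_eq: "total_deg p q a b m = (\<Sum>r<p+q. minus_deg a m r + plus_deg a b m r)"
  by (simp add: total_deg_def sum_fvars sum_columns_split plus_deg_def minus_deg_def)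

text \<open>
  Each row \<open>r < p\<close> has total degree at least the absolute value of its weight.
\<close>

lemma hw_total_deg_ge:
  assumes ab: "a + b \<le> p" and w: "\<And>r. r < p + q \<Longrightarrow> fock_weight p a b m r = V_weight p q a b r"
  shows "(a + b) * q \<le> total_deg p q a b m"
proof -
  have "(a + b) * q = (\<Sum>r\<in>{..<b} \<union> {p - a..<p}. q)"
    using ab by (subst sum.union_disjoint) (auto simp: ring_distribs)
  also have "\<dots> \<le> (\<Sum>r\<in>{..<b} \<union> {p - a..<p}. minus_deg a m r + plus_deg a b m r)"
  proof (rule sum_mono)
    fix r assume r: "r \<in> {..<b} \<union> {p - a..<p}"
    then have "r < p" using ab by auto
    then show "q \<le> minus_deg a m r + plus_deg a b m r"
      using w[of r] r ab by (auto simp: fock_weight_eq V_weight_def split: if_splits)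
  qed
  also have "\<dots> \<le> total_deg p q a b m"
    unfolding total_deg_eq using ab by (intro sum_mono2) auto
  finally show ?thesis .
qed

text \<open>
  The exponent \<open>q\<close> on the diagonal of the block of rows \<open>r < b\<close> and columns \<open>a + r\<close>, and on the
  antidiagonal of the block of rows \<open>p - a \<le> r < p\<close> and columns \<open>k < a\<close>: the rows of the second block
  are counted from the last one because its polarizations act in the opposite direction.
\<close>

definition diag_exp :: "nat \<Rightarrow> nat \<Rightarrow> nat \<Rightarrow> nat \<Rightarrow> fvar \<Rightarrow> nat" where
  "diag_exp p q a b v = (case v of Z r k \<Rightarrow>
     if r < b \<and> k = a + r \<or> k < a \<and> Suc (r + k) = p then q else 0)"

lemma pdiff2_eq_0_exclusive:
  assumes "pdiff u (pdiff v f) = 0" "u \<noteq> v" "m \<in> monoms f"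
  shows "lk m u = 0 \<or> lk m v = 0"
proof (rule ccontr)
  assume nz: "\<not> ?thesis"
  let ?n = "m - unit_exp u - unit_exp v"
  have "?n + unit_exp u + unit_exp v = m"
    using nz assms(2) by (intro poly_mapping_eqI) (auto simp: exp_simps)
  moreover have "lk (pdiff u (pdiff v f)) ?n = 0" using assms(1) by simp
  ultimately show False using assms(3) by (auto simp: lookup_pdiff in_keys_iff simp del: of_nat_add)
qed

text \<open>
  Once the two types are decoupled in every row, the weight gives the row degrees: \<open>q\<close> in the columns
  \<open>\<ge> a\<close> for \<open>r < b\<close>, \<open>q\<close> in the columns \<open>< a\<close> for \<open>p - a \<le> r < p\<close>, and zero otherwise, in particular in
  the rows of \<open>V\<^sub>-\<close>.  One monomial that is extremal for both blocks at the same time is diagonal in both.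
\<close>

lemma harmonic_hw_diagonal:
  assumes ab: "a + b \<le> p" and f: "f \<in> fock p q a b" "f \<noteq> 0"
    and w: "\<And>m r. m \<in> monoms f \<Longrightarrow> r < p + q \<Longrightarrow> fock_weight p a b m r = V_weight p q a b r"
    and raise1: "\<And>r s. r < s \<Longrightarrow> s < p \<Longrightarrow> polarize {a..<a+b} r s f = polarize {..<a} s r f"
    and raise2: "\<And>r s. p \<le> r \<Longrightarrow> r < s \<Longrightarrow> s < p + q \<Longrightarrow> polarize {..<a} r s f = polarize {a..<a+b} s r f"
    and harm: "\<And>B k l. row_block p q B \<Longrightarrow> k < a \<Longrightarrow> a \<le> l \<Longrightarrow> l < a + b \<Longrightarrow>
        (\<Sum>r\<in>B. pdiff (Z r k) (pdiff (Z r l) f)) = 0"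
  shows "\<exists>m\<in>monoms f. lk m = diag_exp p q a b"
proof -
  have A: "polarize {a..<a+b} r s f = 0" if "r < s" "s < p" for r s
    using that raise1 harm[of "{..<p}"]
    by (intro harmonic_raising_eq_0(1)[of "{..<p}" "{a..<a+b}" "{..<a}"]) (auto simp: row_block_def)
  have B: "polarize {..<a} s r f = 0" if "r < s" "s < p" for r s
    using A[OF that] raise1[OF that] by simp
  have ex1: "pdiff (Z r k) (pdiff (Z r l) f) = 0" if "r < p" "k < a" "a \<le> l" "l < a + b" for r k l
    using that raise1 harm[of "{..<p}"]
    by (intro harmonic_raising_eq_0(2)[of "{..<p}" "{a..<a+b}" "{..<a}"]) (auto simp: row_block_def)
  have harm2: "(\<Sum>r\<in>{p..<p+q}. pdiff (Z r l) (pdiff (Z r k) f)) = 0" if "k < a" "a \<le> l" "l < a + b" for k l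
    using harm[of "{p..<p+q}" k l] that
    by (subst sum.cong[OF refl pdiff_commute]) (simp add: row_block_def)
  have ex2: "pdiff (Z r l) (pdiff (Z r k) f) = 0" if "p \<le> r" "r < p + q" "k < a" "a \<le> l" "l < a + b" for r k l
    using that raise2 harm2
    by (intro harmonic_raising_eq_0(2)[of "{p..<p+q}" "{..<a}" "{a..<a+b}"])
       auto
  have excl: "minus_deg a m r = 0 \<or> plus_deg a b m r = 0" if m: "m \<in> monoms f" and r: "r < p + q" for m r
  proof (rule ccontr)
    assume "\<not> ?thesis"
    then obtain k l where kl: "k < a" "lk m (Z r k) \<noteq> 0" "a \<le> l" "l < a + b" "lk m (Z r l) \<noteq> 0"
      by (auto simp: minus_deg_def plus_deg_def)
    have "pdiff (Z r k) (pdiff (Z r l) f) = 0"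
      using ex1[of r k l] ex2[of r k l] kl r by (cases "r < p") (auto simp: pdiff_commute[of "Z r l"])
    from pdiff2_eq_0_exclusive[OF this _ m] kl show False by auto
  qed
  have degs: "plus_deg a b m r = (if r < b then q else 0)"
      "minus_deg a m r = (if r < p \<and> p - a \<le> r then q else 0)"
    if m: "m \<in> monoms f" and r: "r < p + q" for m r
    using excl[OF m r] w[OF m r] ab by (auto simp: fock_weight_eq V_weight_def split: if_splits)
  (* a linear functional on exponents whose maximum is extremal in both blocks; an exchange in one
     block does not change the contribution of the other *)
  define c where "c v = (case v of Z r k \<Rightarrow> if k < a then (p - 1 - r) * k else r * (k - a))" for v
  define \<phi> where "\<phi> m = (\<Sum>v\<in>fvars p q a b. c v * lk m v)" for m :: "fvar \<Rightarrow>\<^sub>0 nat"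
  have \<phi>_add: "\<phi> (m + unit_exp v) = \<phi> m + c v" if "v \<in> fvars p q a b" for m v
    using that by (simp add: \<phi>_def lookup_add ring_distribs sum.distrib lookup_single when_def if_distrib[of "\<lambda>x. _ * x"] cong: if_cong)
  have "monoms f \<noteq> {}" using f by simp
  then have "Max (\<phi> ` monoms f) \<in> \<phi> ` monoms f" by (intro Max_in) auto
  then obtain m where m: "m \<in> monoms f" and "\<phi> m = Max (\<phi> ` monoms f)" by auto
  then have max: "\<phi> m' \<le> \<phi> m" if "m' \<in> monoms f" for m' using that by simp
  have d1: "lk m (Z r (a + k)) = (if r = k then q else 0)" if rk: "r < b" "k < b" for r k
  proof (rule extremal_monomial_diagonal[where V = "\<lambda>r k. Z r (a + k)" and n = b and f = f])
    show "(\<Sum>k<b. var (Z r (a + k)) * pdiff (Z s (a + k)) f) = 0" if "r < s" "s < b" for r s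
    proof -
      have "(\<Sum>k<b. var (Z r (a + k)) * pdiff (Z s (a + k)) f) = polarize {a..<a+b} r s f"
        unfolding polarize_def by (rule sum.reindex_bij_witness[of _ "\<lambda>l. l - a" "\<lambda>k. a + k"]) auto
      then show ?thesis using A that ab by simp
    qed
    show "(\<Sum>k<b. lk m (Z r (a + k))) = q" if "m \<in> monoms f" "r < b" for m r
    proof -
      have "(\<Sum>k<b. lk m (Z r (a + k))) = plus_deg a b m r"
        unfolding plus_deg_def by (rule sum.reindex_bij_witness[of _ "\<lambda>l. l - a" "\<lambda>k. a + k"]) auto
      then show ?thesis using degs(1)[OF that(1)] that ab by simp
    qed
    show "r * k + s * k' \<le> s * k + r * k'"
      if m': "m' \<in> monoms f" and lt: "r < b" "s < b" "k < b" "k' < b"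
      and eq: "m' + unit_exp (Z s (a + k)) + unit_exp (Z r (a + k')) = m + unit_exp (Z r (a + k)) + unit_exp (Z s (a + k'))"
      for m' r s k k'
      using arg_cong[OF eq, of \<phi>] max[OF m'] lt ab by (simp add: \<phi>_add c_def)
  qed (use m rk in auto)
  have d2: "lk m (Z (p - 1 - r) k) = (if r = k then q else 0)" if rk: "r < a" "k < a" for r k
  proof (rule extremal_monomial_diagonal[where V = "\<lambda>r k. Z (p - 1 - r) k" and n = a and f = f])
    show "(\<Sum>k<a. var (Z (p - 1 - r) k) * pdiff (Z (p - 1 - s) k) f) = 0" if "r < s" "s < a" for r s
      using B[of "p - 1 - s" "p - 1 - r"] that ab by (simp add: polarize_def)
    show "(\<Sum>k<a. lk m (Z (p - 1 - r) k)) = q" if "m \<in> monoms f" "r < a" for m r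
      using degs(2)[OF that(1), of "p - 1 - r"] that ab by (simp add: minus_deg_def)
    show "r * k + s * k' \<le> s * k + r * k'"
      if m': "m' \<in> monoms f" and lt: "r < a" "s < a" "k < a" "k' < a"
      and eq: "m' + unit_exp (Z (p - 1 - s) k) + unit_exp (Z (p - 1 - r) k') =
        m + unit_exp (Z (p - 1 - r) k) + unit_exp (Z (p - 1 - s) k')"
      for m' r s k k'
    proof -
      have "p - 1 - (p - 1 - x) = x" if "x < a" for x using that ab by auto
      then show ?thesis
        using arg_cong[OF eq, of \<phi>] max[OF m'] lt ab by (simp add: \<phi>_add c_def)
    qed
  qed (use m rk ab in auto)
  have "lk m v = diag_exp p q a b v" for v
  proof -
    obtain r k where v: "v = Z r k" by (cases v)
    show ?thesis
    proof (cases "r < p + q \<and> k < a + b")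
      case False
      then have "lk m v = 0" using f(1) m unfolding fock_eq polys_in_iff in_keys_iff v
        by (metis Z_in_fvars)
      then show ?thesis using False ab by (auto simp: diag_exp_def v)
    next
      case True
      show ?thesis
      proof (cases "k < a")
        case k: True
        show ?thesis
        proof (cases "r < p \<and> p - a \<le> r")
          case r: True
          then have "p - 1 - r < a" "p - 1 - (p - 1 - r) = r" using ab k by linarith+
          then have "lk m v = (if p - 1 - r = k then q else 0)"
            using d2[of "p - 1 - r" k] k by (simp only: v)
          then show ?thesis using r k ab by (auto simp: diag_exp_def v)
        next
          case False
          then have "minus_deg a m r = 0" using degs(2)[OF m] True by auto
          then have "lk m v = 0" using k by (simp add: minus_deg_def v)
          then show ?thesis using False k ab by (auto simp: diag_exp_def v)
        qed
      next
        case k: False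
        show ?thesis
        proof (cases "r < b")
          case r: True
          have "k - a < b" "a + (k - a) = k" using True k by linarith+
          then have "lk m v = (if r = k - a then q else 0)"
            using d1[of r "k - a"] r by (simp only: v)
          then show ?thesis using r k by (auto simp: diag_exp_def v)
        next
          case False
          then have "plus_deg a b m r = 0" using degs(1)[OF m] True by auto
          then have "lk m v = 0" using k True by (simp add: plus_deg_def v)
          then show ?thesis using False k by (auto simp: diag_exp_def v)
        qed
      qed
    qed
  qed
  then show ?thesis using m by blast
qed

section \<open>Creation and annihilation operators\<close>

text \<open>
  The modes are the pairs of columns \<open>k < a \<le> l\<close>, once for each of the groups U(p) (\<open>True\<close>) and U(q).
  The two groups have the roles of \<open>k\<close> and \<open>l\<close> exchanged, since their rows have opposite sign.
\<close>

fun creation :: "nat \<Rightarrow> nat \<Rightarrow> nat \<Rightarrow> bool \<times> nat \<times> nat \<Rightarrow> fpoly \<Rightarrow> fpoly" where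
  "creation p q a (True, k, l) = quad p a {..<p} k l"
| "creation p q a (False, k, l) = quad p a {p..<p+q} l k"

fun annihilation :: "nat \<Rightarrow> nat \<Rightarrow> nat \<Rightarrow> bool \<times> nat \<times> nat \<Rightarrow> fpoly \<Rightarrow> fpoly" where
  "annihilation p q a (True, k, l) = quad p a {..<p} l k"
| "annihilation p q a (False, k, l) = quad p a {p..<p+q} k l"

definition modes :: "nat \<Rightarrow> nat \<Rightarrow> (bool \<times> nat \<times> nat) set" where
  "modes a b = UNIV \<times> {..<a} \<times> {a..<a+b}"

lemma finite_modes: "finite (modes a b)"
  by (simp add: modes_def)

lemma modes_cases:
  assumes "c \<in> modes a b"
  obtains k l where "c = (True, k, l)" "k < a" "a \<le> l" "l < a + b"
    | k l where "c = (False, k, l)" "k < a" "a \<le> l" "l < a + b"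
  using assms by (cases c) (auto simp: modes_def)

lemma row_blocks [simp]: "row_block p q {..<p}" "row_block p q {p..<p+q}"
  by (simp_all add: row_block_def)

lemma equivariant_creation: "c \<in> modes a b \<Longrightarrow> equivariant_op p q a b (creation p q a c)"
  by (erule modes_cases) (auto intro!: equivariant_quad)

lemma equivariant_annihilation: "c \<in> modes a b \<Longrightarrow> equivariant_op p q a b (annihilation p q a c)"
  by (erule modes_cases) (auto intro!: equivariant_quad)

lemma annihilation_adjoint:
  "c \<in> modes a b \<Longrightarrow> ip (annihilation p q a c f) g = - ip f (creation p q a c g)"
  by (erule modes_cases) (auto simp: quad_adjoint)

text \<open>
  A matrix unit of \<open>End(W)\<close> between columns of opposite sign acts on the variables of one group by
  multiplication and on those of the other by a Laplacian.
\<close>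

lemma weil_mode:
  assumes "c \<in> modes a b"
  shows "\<exists>c'\<in>modes a b. (\<lambda>f. creation p q a c f + annihilation p q a c' f) \<in> env_ops p q a b"
proof -
  have W: "(\<lambda>f. quad p a {..<p} k l f + quad p a {p..<p+q} k l f) \<in> env_ops p q a b"
    if kl: "k < a + b" "l < a + b" for k l
  proof -
    define Y :: "complex mat" where "Y = mat (a + b) (a + b) (\<lambda>(i, j). if i = l \<and> j = k then - 1 else 0)"
    have "weil p q a b Y f = quad p a {..<p} k l f + quad p a {p..<p+q} k l f" for f
    proof -
      have "(\<Sum>k'<a+b. \<Sum>l'<a+b. const (Y $$ (l', k')) * (quad p a {..<p} k' l' f + quad p a {p..<p+q} k' l' f)) =
          (\<Sum>k'<a+b. \<Sum>l'<a+b. if l' = l then (if k' = k then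
              - (quad p a {..<p} k l f + quad p a {p..<p+q} k l f) else 0) else 0)"
        by (intro sum.cong refl) (auto simp: Y_def simp flip: const_hom(5))
      also have "\<dots> = (\<Sum>k'<a+b. if k' = k then - (quad p a {..<p} k l f + quad p a {p..<p+q} k l f) else 0)"
        using kl by simp
      also have "\<dots> = - (quad p a {..<p} k l f + quad p a {p..<p+q} k l f)" using kl by simp
      finally show ?thesis by (simp only: weil_eq_quad minus_minus)
    qed
    then have "weil p q a b Y = (\<lambda>f. quad p a {..<p} k l f + quad p a {p..<p+q} k l f)" by auto
    then show ?thesis using env_gen[of Y a b p q] by (simp add: Y_def)
  qed
  show ?thesis using assms
  proof (cases rule: modes_cases)
    case (1 k l)
    then show ?thesis using W[of k l] by (intro bexI[of _ "(False, k, l)"]) (auto simp: modes_def)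
  next
    case (2 k l)
    then show ?thesis using W[of l k] by (intro bexI[of _ "(True, k, l)"]) (auto simp: modes_def add.commute)
  qed
qed

lemma creation_deg:
  assumes "c \<in> modes a b" "f \<in> deg_less p q a b n"
  shows "creation p q a c f \<in> deg_less p q a b (Suc (Suc n))"
  using assms
  by (auto elim!: modes_cases simp: quad_def heis_def heis_dual_def same_sign_def
      intro!: deg_less_sum deg_less_var_mult)

lemma annihilation_deg:
  assumes "c \<in> modes a b" "f \<in> deg_less p q a b (Suc (Suc n))"
  shows "annihilation p q a c f \<in> deg_less p q a b n"
  using assms
  by (auto elim!: modes_cases simp: quad_def heis_def heis_dual_def same_sign_def
      intro!: deg_less_sum deg_less_uminus deg_less_pdiff)

text \<open>
  An annihilation operator is minus the sum of the mixed second derivatives over its rows.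
\<close>

lemma annihilated_harmonic:
  assumes ann: "\<And>c. c \<in> modes a b \<Longrightarrow> annihilation p q a c f = 0"
    and B: "row_block p q B" and kl: "k < a" "a \<le> l" "l < a + b"
  shows "(\<Sum>r\<in>B. pdiff (Z r k) (pdiff (Z r l) f)) = 0"
proof (cases "B = {..<p}")
  case True
  have "0 = annihilation p q a (True, k, l) f" using ann[of "(True, k, l)"] kl by (simp add: modes_def)
  also have "\<dots> = (\<Sum>r<p. - pdiff (Z r k) (pdiff (Z r l) f))"
    using kl by (simp add: quad_def) (auto simp: heis_def heis_dual_def same_sign_def pdiff_commute[of "Z _ l"] intro!: sum.cong)
  finally show ?thesis using True by (simp add: sum_negf)
next
  case False
  then have B': "B = {p..<p+q}" using B by (simp add: row_block_def)
  have "0 = annihilation p q a (False, k, l) f" using ann[of "(False, k, l)"] kl by (simp add: modes_def)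
  also have "\<dots> = (\<Sum>r\<in>{p..<p+q}. - pdiff (Z r k) (pdiff (Z r l) f))"
    using kl by (simp add: quad_def) (auto simp: heis_def heis_dual_def same_sign_def intro!: sum.cong)
  finally show ?thesis using B' by (simp add: sum_negf)
qed

lemma Hom_K_add:
  assumes "T \<in> Hom_K p q a b X" "T' \<in> Hom_K p q a b X" "K_submodule p q X"
  shows "restrict (\<lambda>x. T x + T' x) X \<in> Hom_K p q a b X"
proof -
  note H = Hom_KD[OF assms(1)] Hom_KD[OF assms(2)] K_submoduleD[OF assms(3)]
  have fock: "T x + T' x \<in> fock p q a b" if "x \<in> X" for x
    using H(1)[OF that] H(5)[OF that] unfolding fock_eq by (rule polys_in_add)
  show ?thesis
    unfolding Hom_K_def mem_Collect_eq
    by (intro conjI ballI allI) (simp_all add: H fock fock_act_add distrib_left)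
qed

lemma deg_less_mono: "f \<in> deg_less p q a b m \<Longrightarrow> m \<le> n \<Longrightarrow> f \<in> deg_less p q a b n"
  by (auto simp: deg_less_def)

lemma deg_less_exists: "\<exists>n. f \<in> deg_less p q a b (2 * n + e)"
proof -
  let ?d = "Max (total_deg p q a b ` monoms f)"
  have "total_deg p q a b m < 2 * Suc ?d + e" if "m \<in> monoms f" for m
  proof -
    have "total_deg p q a b m \<le> ?d" using that by simp
    also have "?d < 2 * Suc ?d + e" by simp
    finally show ?thesis .
  qed
  then have "f \<in> deg_less p q a b (2 * Suc ?d + e)" unfolding deg_less_def by blast
  then show ?thesis by blast
qed

text \<open>
  For irreducible \<open>X\<close> and nonzero \<open>x\<close> this set is a faithful copy of the space of homomorphisms, on
  which every equivariant operator acts.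
\<close>

definition hw_values :: "nat \<Rightarrow> nat \<Rightarrow> nat \<Rightarrow> nat \<Rightarrow> (munit, complex) ext set \<Rightarrow> (munit, complex) ext \<Rightarrow> fpoly set" where
  "hw_values p q a b X x = (\<lambda>T. T x) ` Hom_K p q a b X"

lemma hw_values_equivariant:
  assumes "f \<in> hw_values p q a b X x" "equivariant_op p q a b u" "K_submodule p q X" "x \<in> X"
  shows "u f \<in> hw_values p q a b X x"
proof -
  obtain T where T: "T \<in> Hom_K p q a b X" "f = T x" using assms(1) by (auto simp: hw_values_def)
  have "u f = restrict (\<lambda>x. u (T x)) X x" using assms(4) T by simp
  then show ?thesis using Hom_K_comp[OF T(1) assms(2,3)] unfolding hw_values_def by blast
qed

lemma equivariant_id: "equivariant_op p q a b (\<lambda>f. f)"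
  by (simp add: equivariant_op_def)

lemma hw_values_add:
  assumes "f \<in> hw_values p q a b X x" "g \<in> hw_values p q a b X x" "K_submodule p q X" "x \<in> X"
  shows "f + g \<in> hw_values p q a b X x"
proof -
  obtain T T' where T: "T \<in> Hom_K p q a b X" "f = T x" "T' \<in> Hom_K p q a b X" "g = T' x"
    using assms by (auto simp: hw_values_def)
  have "f + g = restrict (\<lambda>x. T x + T' x) X x" using assms(4) T by simp
  then show ?thesis using Hom_K_add[OF T(1,3) assms(3)] unfolding hw_values_def by blast
qed

lemma hw_values_subspace:
  assumes "K_submodule p q X" "x \<in> X" "Hom_K p q a b X \<noteq> {}"
  shows "fp.subspace (hw_values p q a b X x)"
proof (rule fp.subspaceI)
  obtain f where f: "f \<in> hw_values p q a b X x" using assms(3) by (auto simp: hw_values_def)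
  show scale: "const c * g \<in> hw_values p q a b X x" if "g \<in> hw_values p q a b X x" for c g
    using hw_values_equivariant[OF that equivariant_scale[OF equivariant_id] assms(1,2)] .
  show "0 \<in> hw_values p q a b X x" using scale[OF f, of 0] by simp
qed (use hw_values_add assms in blast)

lemma deg_less_subspace: "fp.subspace (deg_less p q a b n)"
  by (rule fp.subspaceI) (auto simp: deg_less_add deg_less_scale)

definition env_orbit :: "nat \<Rightarrow> nat \<Rightarrow> nat \<Rightarrow> nat \<Rightarrow> fpoly \<Rightarrow> fpoly set" where
  "env_orbit p q a b f = (\<lambda>u. u f) ` env_ops p q a b"

lemma env_orbit_iff: "g \<in> env_orbit p q a b f \<longleftrightarrow> (\<exists>u\<in>env_ops p q a b. g = u f)"
  by (auto simp: env_orbit_def)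

lemma env_orbit_closed:
  assumes "u \<in> env_ops p q a b" "g \<in> env_orbit p q a b f"
  shows "u g \<in> env_orbit p q a b f"
proof -
  obtain v where v: "v \<in> env_ops p q a b" "g = v f" using assms(2) by (auto simp: env_orbit_iff)
  show ?thesis unfolding env_orbit_iff v(2) by (rule bexI[OF _ env_comp[OF assms(1) v(1)]]) simp
qed

lemma env_orbit_self: "f \<in> env_orbit p q a b f"
  unfolding env_orbit_iff by (rule bexI[OF _ env_one]) simp

lemma env_orbit_subspace: "fp.subspace (env_orbit p q a b f)"
proof (rule fp.subspaceI)
  show scale: "const c * g \<in> env_orbit p q a b f" if "g \<in> env_orbit p q a b f" for c g
    by (rule env_orbit_closed[OF env_scale[OF env_one] that])
  show "0 \<in> env_orbit p q a b f" using scale[OF env_orbit_self, of 0] by simp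
  show "g + h \<in> env_orbit p q a b f" if gh: "g \<in> env_orbit p q a b f" "h \<in> env_orbit p q a b f" for g h
  proof -
    obtain u v where u: "u \<in> env_ops p q a b" "g = u f" and v: "v \<in> env_ops p q a b" "h = v f"
      using gh by (auto simp: env_orbit_iff)
    show ?thesis unfolding env_orbit_iff u(2) v(2) by (rule bexI[OF _ env_add[OF u(1) v(1)]]) simp
  qed
qed

text \<open>
  Words of length less than \<open>n\<close>.
\<close>

fun creation_words :: "nat \<Rightarrow> nat \<Rightarrow> nat \<Rightarrow> nat \<Rightarrow> fpoly \<Rightarrow> nat \<Rightarrow> fpoly set" where
  "creation_words p q a b f 0 = {}"
| "creation_words p q a b f (Suc n) = insert f (\<Union>c\<in>modes a b. creation p q a c ` creation_words p q a b f n)"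

lemma finite_creation_words: "finite (creation_words p q a b f n)"
  by (induction n) (auto simp: finite_modes)

text \<open>
  Two statements are proved together by induction on \<open>n\<close>: values of degree less than \<open>2 n + (a + b) q\<close>
  are combinations of creation words of length less than \<open>n\<close>, and these words lie in the orbit.  Each
  annihilation operator lowers the degree by 2 and so leads back to the previous stage.
\<close>

lemma hw_values_in_orbit:
  assumes ab: "a + b \<le> p" and V: "is_V_copy p q a b X" and x: "x \<in> X" "hw_vector p q a b x"
    and f: "f \<in> hw_values p q a b X x"
  shows "f \<in> env_orbit p q a b (psi p q a b x)"
proof -
  let ?e = "(a + b) * q" and ?\<Delta> = "psi p q a b x"
  let ?M = "hw_values p q a b X x" and ?N = "env_orbit p q a b (psi p q a b x)"
  let ?D = "\<lambda>n. deg_less p q a b (2 * n + ?e)" and ?B = "creation_words p q a b (psi p q a b x)"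
  note X = V_copyD[OF V]
  have M_sub: "fp.subspace ?M" using hw_values_subspace[OF X(2) x(1)] psi_Hom_K[OF V] by blast
  have M_op: "u g \<in> ?M" if "g \<in> ?M" "equivariant_op p q a b u" for u g
    using hw_values_equivariant[OF that X(2) x(1)] .
  have \<Delta>M: "?\<Delta> \<in> ?M"
    unfolding hw_values_def using psi_Hom_K[OF V] x(1) by (intro image_eqI[of _ _ "restrict (psi p q a b) X"]) auto
  have \<Delta>0: "?\<Delta> \<noteq> 0" using X(1) x by (intro psi_hw_vector_nonzero[OF ab]) auto
  have \<Delta>deg: "?\<Delta> \<in> deg_less p q a b (Suc ?e)" using psi_deg[of p q a b x] by (simp add: add.commute)
  have M_wt: "fock_weight p a b m r = V_weight p q a b r" if "g \<in> ?M" "m \<in> monoms g" "r < p + q" for g m r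
    using that hw_image_weight[OF _ x] by (auto simp: hw_values_def)
  (* the weight alone forces the degree to be at least that of psi x *)
  have low: "g = 0" if "g \<in> ?M" "g \<in> deg_less p q a b ?e" for g
  proof (rule ccontr)
    assume "g \<noteq> 0"
    then obtain m where m: "m \<in> monoms g" by (metis ex_in_conv keys_eq_empty)
    then have "?e \<le> total_deg p q a b m" by (intro hw_total_deg_ge[OF ab] M_wt[OF that(1)])
    then show False using that(2) m by (auto simp: deg_less_def)
  qed
  have top: "\<exists>m\<in>monoms g. lk m = diag_exp p q a b"
    if g: "g \<in> ?M" "g \<noteq> 0" "\<And>c. c \<in> modes a b \<Longrightarrow> annihilation p q a c g = 0" for g
  proof -
    obtain T where T: "T \<in> Hom_K p q a b X" "g = T x" using g(1) by (auto simp: hw_values_def)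
    show ?thesis
    proof (rule harmonic_hw_diagonal[OF ab])
      show "g \<in> fock p q a b" using Hom_KD(1)[OF T(1) x(1)] T(2) by simp
      show "polarize {a..<a+b} r s g = polarize {..<a} s r g" if "r < s" "s < p" for r s
        unfolding T(2) using that
        by (intro hw_image_raising[OF T(1) V x]) (auto simp: same_block_def same_sign_def)
      show "polarize {..<a} r s g = polarize {a..<a+b} s r g" if "p \<le> r" "r < s" "s < p + q" for r s
        unfolding T(2) using that
        by (intro hw_image_raising[OF T(1) V x]) (auto simp: same_block_def same_sign_def)
      show "(\<Sum>r\<in>B. pdiff (Z r k) (pdiff (Z r l) g)) = 0"
        if "row_block p q B" "k < a" "a \<le> l" "l < a + b" for B k l
        using annihilated_harmonic[OF g(3) that] by simp
    qed (use g M_wt in auto)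
  qed
  (* a Laplacian would lower the degree of psi x below the minimum *)
  have \<Delta>_harm: "annihilation p q a c ?\<Delta> = 0" if c: "c \<in> modes a b" for c
  proof (rule low)
    show "annihilation p q a c ?\<Delta> \<in> ?M" by (rule M_op[OF \<Delta>M equivariant_annihilation[OF c]])
    show "annihilation p q a c ?\<Delta> \<in> deg_less p q a b ?e"
      using deg_less_mono[OF \<Delta>deg] by (intro annihilation_deg[OF c]) auto
  qed
  have unique: "\<exists>z. g = const z * ?\<Delta>"
    if g: "g \<in> ?M" "\<And>c. c \<in> modes a b \<Longrightarrow> annihilation p q a c g = 0" for g
  proof -
    obtain m where m: "m \<in> monoms ?\<Delta>" "lk m = diag_exp p q a b" using top[OF \<Delta>M \<Delta>0 \<Delta>_harm] by blast
    define z where "z = lk g m / lk ?\<Delta> m"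
    define g' where "g' = g - const z * ?\<Delta>"
    have "g' \<in> ?M" unfolding g'_def using g(1) \<Delta>M by (intro fp.subspace_diff fp.subspace_scale M_sub)
    moreover have "annihilation p q a c g' = 0" if c: "c \<in> modes a b" for c
    proof -
      have eq: "g' = g + const (- z) * ?\<Delta>" by (simp add: g'_def flip: const_hom(5))
      have "annihilation p q a c (g + const (- z) * ?\<Delta>) =
          annihilation p q a c g + const (- z) * annihilation p q a c ?\<Delta>"
        using equivariant_annihilation[OF c, of p q] by (simp only: equivariant_op_def)
      then show ?thesis by (simp only: eq g(2)[OF c] \<Delta>_harm[OF c]) simp
    qed
    moreover have "m' \<notin> monoms g'" if m': "lk m' = diag_exp p q a b" for m'
    proof -
      have "m' = m" using m' m(2) by (simp add: poly_mapping_eq_iff)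
      then show ?thesis using m(1) by (simp add: g'_def z_def in_keys_iff lookup_minus)
    qed
    ultimately have "g' = 0" using top by blast
    then show ?thesis by (auto simp: g'_def)
  qed
  have main: "(\<forall>g\<in>?M \<inter> ?D n. g \<in> fp.span (?B n)) \<and> ?B n \<subseteq> ?N \<inter> ?M \<inter> ?D n" for n
  proof (induction n)
    case 0
    then show ?case using low by auto
  next
    case (Suc n)
    (* a creation operator is a Weil operator minus an annihilation operator *)
    have B_Suc: "?B (Suc n) \<subseteq> ?N \<inter> ?M \<inter> ?D (Suc n)"
    proof
      fix h assume "h \<in> ?B (Suc n)"
      then consider "h = ?\<Delta>" | c h' where "c \<in> modes a b" "h' \<in> ?B n" "h = creation p q a c h'" by auto
      then show "h \<in> ?N \<inter> ?M \<inter> ?D (Suc n)"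
      proof cases
        case 1
        then show ?thesis using \<Delta>M env_orbit_self deg_less_mono[OF \<Delta>deg] by auto
      next
        case (2 c h')
        have h': "h' \<in> ?N" "h' \<in> ?M" "h' \<in> ?D n" using 2 Suc by auto
        obtain c' where c': "c' \<in> modes a b" "(\<lambda>f. creation p q a c f + annihilation p q a c' f) \<in> env_ops p q a b"
          using weil_mode[OF 2(1)] by blast
        have "creation p q a c h' + annihilation p q a c' h' \<in> ?N" using env_orbit_closed[OF c'(2) h'(1)] .
        moreover have "annihilation p q a c' h' \<in> ?N"
        proof -
          have "annihilation p q a c' h' \<in> ?D n"
            using deg_less_mono[OF h'(3)] by (intro annihilation_deg[OF c'(1)]) auto
          moreover have "annihilation p q a c' h' \<in> ?M" by (rule M_op[OF h'(2) equivariant_annihilation[OF c'(1)]])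
          ultimately have "annihilation p q a c' h' \<in> fp.span (?B n)" using Suc by blast
          moreover have "fp.span (?B n) \<subseteq> ?N" using Suc by (intro fp.span_minimal env_orbit_subspace) auto
          ultimately show ?thesis by blast
        qed
        ultimately have "h \<in> ?N" using fp.subspace_diff[OF env_orbit_subspace] unfolding 2(3) by fastforce
        moreover have "h \<in> ?M" unfolding 2(3) by (rule M_op[OF h'(2) equivariant_creation[OF 2(1)]])
        moreover have "h \<in> ?D (Suc n)" unfolding 2(3) using creation_deg[OF 2(1) h'(3)] by simp
        ultimately show ?thesis by blast
      qed
    qed
    have "g \<in> fp.span (?B (Suc n))" if g: "g \<in> ?M" "g \<in> ?D (Suc n)" for g
    proof -
      (* g' is harmonic: its Laplacians lie in the span of the shorter words and are orthogonal to it *)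
      obtain g' where g': "g - g' \<in> fp.span (?B (Suc n))" "\<forall>h\<in>?B (Suc n). ip g' h = 0"
        using orthogonal_projection[OF finite_creation_words] by blast
      have "fp.span (?B (Suc n)) \<subseteq> ?M \<inter> ?D (Suc n)"
        using B_Suc by (intro fp.span_minimal fp.subspace_inter M_sub deg_less_subspace) auto
      then have "g - g' \<in> ?M" "g - g' \<in> ?D (Suc n)" using g'(1) by blast+
      then have "g - (g - g') \<in> ?M" "g - (g - g') \<in> ?D (Suc n)"
        using g by (blast intro: fp.subspace_diff M_sub deg_less_subspace)+
      then have g'M: "g' \<in> ?M" "g' \<in> ?D (Suc n)" by simp_all
      have "annihilation p q a c g' = 0" if c: "c \<in> modes a b" for c
      proof -
        let ?g = "annihilation p q a c g'"
        have "?g \<in> ?D n" using g'M(2) by (intro annihilation_deg[OF c]) simp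
        moreover have "?g \<in> ?M" by (rule M_op[OF g'M(1) equivariant_annihilation[OF c]])
        ultimately have "?g \<in> fp.span (?B n)" using Suc by blast
        moreover have "ip ?g h = 0" if "h \<in> ?B n" for h
          using g'(2) that c by (auto simp: annihilation_adjoint[OF c])
        ultimately have "ip ?g ?g = 0" by (rule ip_span_eq_0[rotated])
        then show ?thesis by (intro ip_self_eq_0) simp
      qed
      then obtain z where "g' = const z * ?\<Delta>" using unique[OF g'M(1)] by blast
      moreover have "?\<Delta> \<in> fp.span (?B (Suc n))" by (rule fp.span_base) simp
      ultimately have "g' \<in> fp.span (?B (Suc n))" by (simp only: fp.span_scale)
      then show ?thesis using fp.span_add[OF g'(1)] by fastforce
    qed
    then show ?case using B_Suc by blast
  qed
  obtain n where "f \<in> ?D n" using deg_less_exists by blast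
  then have "f \<in> fp.span (?B n)" using main[of n] f by blast
  moreover have "fp.span (?B n) \<subseteq> ?N" using main[of n] by (intro fp.span_minimal env_orbit_subspace) auto
  ultimately show ?thesis by blast
qed

text \<open>
  The vectors on which two homomorphisms agree form a submodule.
\<close>

lemma Hom_K_eqI:
  assumes T: "T \<in> Hom_K p q a b X" "T' \<in> Hom_K p q a b X" and X: "K_irreducible p q X"
    and x: "x \<in> X" "x \<noteq> ext_zero" "T x = T' x"
  shows "T = T'"
proof -
  have Xs: "K_submodule p q X" using X by (simp add: K_irreducible_def)
  note H = Hom_KD[OF T(1)] Hom_KD[OF T(2)] K_submoduleD[OF Xs]
  define Y where "Y = {y \<in> X. T y = T' y}"
  have "T ext_zero = T' ext_zero"
    using H(3)[of ext_zero 0] H(7)[of ext_zero 0] H(9) by (simp add: ext_scale_def ext_zero_def)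
  then have "K_submodule p q Y" by (simp add: K_submodule_def Y_def H)
  moreover have "Y \<subseteq> X" "Y \<noteq> {ext_zero}" using x by (auto simp: Y_def)
  ultimately have "Y = X" using X by (auto simp: K_irreducible_def)
  then have "T y = T' y" if "y \<in> X" for y using that by (auto simp: Y_def)
  moreover have "T \<in> extensional X" "T' \<in> extensional X" using T by (auto simp: Hom_K_def PiE_def)
  ultimately show ?thesis by (intro extensionalityI[of T X T']) auto
qed

theorem theorem5p31:
  fixes p q a b :: nat and X :: "(munit, complex) ext set"
  assumes "a + b \<le> p"
    and "is_V_copy p q a b X"
  shows "Hom_K p q a b X = {restrict (\<lambda>x. u (psi p q a b x)) X | u. u \<in> env_ops p q a b}"
proof -
  note X = V_copyD[OF assms(2)]
  have in_Hom: "restrict (\<lambda>x. u (psi p q a b x)) X \<in> Hom_K p q a b X" if "u \<in> env_ops p q a b" for u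
  proof -
    have "restrict (\<lambda>x. u (psi p q a b x)) X = restrict (\<lambda>x. u (restrict (psi p q a b) X x)) X"
      by (rule restrict_ext) simp
    then show ?thesis
      using Hom_K_comp[OF psi_Hom_K[OF assms(2)] env_ops_equivariant[OF that] X(2)] by simp
  qed
  obtain x where x: "x \<in> X" "hw_vector p q a b x" using hw_vector_exists[OF assms(2)] .
  have "\<exists>u\<in>env_ops p q a b. T = restrict (\<lambda>x. u (psi p q a b x)) X" if T: "T \<in> Hom_K p q a b X" for T
  proof -
    have "T x \<in> hw_values p q a b X x" using T by (simp add: hw_values_def)
    then obtain u where u: "u \<in> env_ops p q a b" "T x = u (psi p q a b x)"
      using hw_values_in_orbit[OF assms x] by (auto simp: env_orbit_def)
    have "T = restrict (\<lambda>x. u (psi p q a b x)) X"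
      using x u(2) by (intro Hom_K_eqI[OF T in_Hom[OF u(1)] X(3) x(1)]) (auto simp: hw_vector_def)
    with u show ?thesis by blast
  qed
  with in_Hom show ?thesis by blast
qed

end
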